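(* Let $X$ be a compact metrizable space with $\dim X\le n$, and let $Z\subset X$ be a nowhere dense closed subset which is $LCC^n$ in $X$ and such that $X\setminus Z$ is $LC^n$. Then $X$ is an absolute neighborhood retract (ANR) and $Z$ is a $Z$-set in $X$. If in addition $X\setminus Z$ is assumed to be contractible, then $X$ is an absolute retract (AR).
   Context: A metrizable space $Y$ is $LC^n$ (locally $n$-connected) if for every $y\in Y$ and every open neighborhood $\mathcal{U}$ of $y$ there is an open neighborhood $\mathcal{V}\subseteq\mathcal{U}$ of $y$ such that the inclusion $\mathcal{V}\hookrightarrow\mathcal{U}$ is trivial in $\pi_i$ for all $0\le i\le n$ (i.e. every continuous map $S^i\to\mathcal{V}$ is nullhomotopic in $\mathcal{U}$). A nowhere dense closed subset $Z\subseteq X$ is $LCC^n$ (locally complementarily $n$-connected) in $X$ if for every $z\in Z$ and every open neighborhood $\mathcal{U}$ of $z$ in $X$ there is a smaller neighborhood $\mathcal{V}\subseteq\mathcal{U}$ of $z$ in $X$ such that the inclusion $\mathcal{V}\setminus Z\hookrightarrow\mathcal{U}\setminus Z$ is trivial in $\pi_i$ for all $0\le i\le n$. A compact metrizable space $X$ is an AR (resp. ANR) if for every compact metrizable space $Y$ containing $X$ as a closed subset, $X$ is a retract of $Y$ (resp. of a neighborhood of $X$ in $Y$). A nowhere dense closed subset $Z$ of a compact metrizable space $X$ is a $Z$-set if there is a homotopy $H:X\times[0,1]\to X$ with $H(x,0)=x$ for all $x\in X$ and $H(X\times(0,1])\subseteq X\setminus Z$. Here $\dim$ is topological (covering) dimension.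 *)

theory Defs
  imports "HOL-Analysis.Analysis"
begin

(* Covering dimension (Lebesgue, Cech): every finite open cover has a finite open refinement
   in which no point lies in more than n + 1 members. *)
definition covering_dim_le :: "'a topology \<Rightarrow> nat \<Rightarrow> bool" where
  "covering_dim_le X n \<longleftrightarrow>
     (\<forall>\<U>. finite \<U> \<and> (\<forall>U\<in>\<U>. openin X U) \<and> \<Union>\<U> = topspace X \<longrightarrow>
        (\<exists>\<V>. finite \<V> \<and> (\<forall>V\<in>\<V>. openin X V) \<and> \<Union>\<V> = topspace X \<and>
             (\<forall>V\<in>\<V>. \<exists>U\<in>\<U>. V \<subseteq> U) \<and>
             (\<forall>x\<in>topspace X. card {V \<in> \<V>. x \<in> V} \<le> n + 1)))"

(* The inclusion of V into U (V \<subseteq> U, both subsets of X) is trivial in pi_i for 0 \<le> i \<le> n, in the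
   sense of free homotopy; a constant map homotopic to f inside U necessarily has its value in U. *)
definition inclusion_pi_trivial :: "nat \<Rightarrow> 'a topology \<Rightarrow> 'a set \<Rightarrow> 'a set \<Rightarrow> bool" where
  "inclusion_pi_trivial n X V U \<longleftrightarrow>
     (\<forall>i\<le>n. \<forall>f. continuous_map (nsphere i) (subtopology X V) f \<longrightarrow>
        (\<exists>c. homotopic_with (\<lambda>_. True) (nsphere i) (subtopology X U) f (\<lambda>_. c)))"

definition LC :: "nat \<Rightarrow> 'a topology \<Rightarrow> bool" where
  "LC n Y \<longleftrightarrow>
     (\<forall>y\<in>topspace Y. \<forall>U. openin Y U \<and> y \<in> U \<longrightarrow>
        (\<exists>V. openin Y V \<and> y \<in> V \<and> V \<subseteq> U \<and> inclusion_pi_trivial n Y V U))"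

definition LCC :: "nat \<Rightarrow> 'a topology \<Rightarrow> 'a set \<Rightarrow> bool" where
  "LCC n X Z \<longleftrightarrow>
     (\<forall>z\<in>Z. \<forall>U. openin X U \<and> z \<in> U \<longrightarrow>
        (\<exists>V. openin X V \<and> z \<in> V \<and> V \<subseteq> U \<and> inclusion_pi_trivial n X (V - Z) (U - Z)))"

definition nowhere_dense_in :: "'a topology \<Rightarrow> 'a set \<Rightarrow> bool" where
  "nowhere_dense_in X Z \<longleftrightarrow> Z \<subseteq> topspace X \<and> X interior_of (X closure_of Z) = {}"

definition Z_set :: "'a topology \<Rightarrow> 'a set \<Rightarrow> bool" where
  "Z_set X Z \<longleftrightarrow>
     closedin X Z \<and> nowhere_dense_in X Z \<and>
     (\<exists>H. continuous_map (prod_topology X (top_of_set {0..1::real})) X H \<and>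
          (\<forall>x\<in>topspace X. H (x, 0) = x) \<and>
          H ` (topspace X \<times> {0<..1}) \<subseteq> topspace X - Z)"

(* The library's AR and ANR only test against spaces of one fixed type built from the type of X,
   so they are not used. Here the test spaces Y live on a separate type 'b, passed as an
   argument; a statement with 'b left as a free type variable covers test spaces of every type.
   "Y contains X as a closed subset" is rendered by an embedding e of X onto a closed subset. *)
definition compact_AR :: "'b itself \<Rightarrow> 'a topology \<Rightarrow> bool" where
  "compact_AR TYPE('b) X \<longleftrightarrow>
     compact_space X \<and> metrizable_space X \<and>
     (\<forall>(Y :: 'b topology) e.
        compact_space Y \<and> metrizable_space Y \<and>
        embedding_map X Y e \<and> closedin Y (e ` topspace X) \<longrightarrow>
        e ` topspace X retract_of_space Y)"

definition compact_ANR :: "'b itself \<Rightarrow> 'a topology \<Rightarrow> bool" where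
  "compact_ANR TYPE('b) X \<longleftrightarrow>
     compact_space X \<and> metrizable_space X \<and>
     (\<forall>(Y :: 'b topology) e.
        compact_space Y \<and> metrizable_space Y \<and>
        embedding_map X Y e \<and> closedin Y (e ` topspace X) \<longrightarrow>
        (\<exists>N. openin Y N \<and> e ` topspace X \<subseteq> N \<and>
             e ` topspace X retract_of_space subtopology Y N))"

(* The empty space satisfies contractible_space but is not contractible in the usual sense. *)
definition nonempty_contractible :: "'a topology \<Rightarrow> bool" where
  "nonempty_contractible X \<longleftrightarrow> topspace X \<noteq> {} \<and> contractible_space X"

end

theory Submission
  imports Defs
begin

text \<open>
  Embed \<open>X\<close> in \<open>\<real>\<^sup>\<nat>\<close> and let \<open>G\<close> be the image of \<open>X - Z\<close>. The two local connectivity hypotheses say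
  together that small maps of spheres of dimension at most \<open>n\<close> into \<open>G\<close> extend over balls, inside
  \<open>G\<close> and with small image. Since \<open>dim X \<le> n\<close>, there are arbitrarily fine finite families of open
  sets of the ambient space covering \<open>X\<close> whose nerves have dimension at most \<open>n\<close>. Choosing such
  families finer and finer, each refining the previous one, the nerves map into \<open>G\<close> and the maps of
  consecutive nerves are joined by small homotopies in \<open>G\<close>: only cells of dimension at most
  \<open>n + 1\<close> have to be filled, although the ambient space is infinite-dimensional. Composing with
  partition functions and gluing along \<open>dist(y, X) \<rightarrow> 0\<close> retracts a neighbourhood of \<open>X\<close> onto \<open>X\<close>
  in such a way that the points off \<open>X\<close> land in \<open>G\<close>. Tietze's theorem turns this retraction into
  the ANR property, and pushing \<open>X\<close> off itself along a spare coordinate before retracting shows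
  that \<open>Z\<close> is a Z-set.
\<close>

text \<open>The hypotheses provide neighbourhoods that depend on the point, and nothing makes
  \<open>G\<close> compact. Working over the compact image of \<open>X\<close>, limit points outside
  \<open>G\<close> included, merges them into one modulus for all of \<open>G\<close>. A
  cell-by-cell extension runs through at most \<open>n + 1\<close> dimensions and spends this
  modulus once in each, so its constants do not depend on the nerve, whose number of cells grows
  beyond any bound as the covers get finer. The dimension count has no slack: a nerve of dimension
  \<open>n\<close> times an interval has dimension \<open>n + 1\<close>, and filling an
  \<open>(n + 1)\<close>-cell means contracting an \<open>n\<close>-sphere. Cubes replace simplices
  because a product of a cubical complex with an interval is again cubical. One extension theorem
  therefore yields both the nerve maps and the homotopies between them, and no prism has to be
  triangulated.\<close>

lemma nsphere_eq_top_of_set: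
  "nsphere m = top_of_set {x::nat \<Rightarrow> real. (\<Sum>i\<le>m. (x i)\<^sup>2) = 1 \<and> (\<forall>i>m. x i = 0)}"
  by (simp add: nsphere euclidean_product_topology)

lemma continuous_on_coordinate: "continuous_on S (\<lambda>x :: 'j \<Rightarrow> 'a::topological_space. x i)"
  by (rule continuous_on_subset[OF continuous_on_product_coordinates]) simp

lemma compact_space_nsphere: "compact_space (nsphere m)"
proof -
  let ?S = "{x::nat \<Rightarrow> real. (\<Sum>i\<le>m. (x i)\<^sup>2) = 1 \<and> (\<forall>i>m. x i = 0)}"
  let ?K = "Pi\<^sub>E UNIV (\<lambda>_::nat. {-1..1::real})"
  have K: "compact ?K"
    by (metis compactin_PiE compactin_euclidean_iff euclidean_product_topology compact_Icc)
  have "closed {x::nat \<Rightarrow> real. (\<Sum>i\<le>m. (x i)\<^sup>2) = 1}"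
    by (intro closed_Collect_eq continuous_intros continuous_on_coordinate)
  moreover have "closed {x::nat \<Rightarrow> real. i > m \<longrightarrow> x i = 0}" for i
    by (cases "i > m") (auto intro!: closed_Collect_eq continuous_intros continuous_on_coordinate)
  then have "closed (\<Inter>i. {x::nat \<Rightarrow> real. i > m \<longrightarrow> x i = 0})"
    by (intro closed_INT) auto
  ultimately have "closed ({x::nat \<Rightarrow> real. (\<Sum>i\<le>m. (x i)\<^sup>2) = 1} \<inter> (\<Inter>i. {x. i > m \<longrightarrow> x i = 0}))"
    by (rule closed_Int)
  also have "({x::nat \<Rightarrow> real. (\<Sum>i\<le>m. (x i)\<^sup>2) = 1} \<inter> (\<Inter>i. {x. i > m \<longrightarrow> x i = 0})) = ?S"
    by auto
  finally have "closed ?S" .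
  moreover have "?S \<subseteq> ?K"
  proof
    fix x :: "nat \<Rightarrow> real"
    assume x: "x \<in> ?S"
    have "(x i)\<^sup>2 \<le> 1" for i
    proof (cases "i \<le> m")
      case True
      then have "(x i)\<^sup>2 \<le> (\<Sum>i\<le>m. (x i)\<^sup>2)"
        by (intro member_le_sum) auto
      then show ?thesis using x by simp
    qed (use x in auto)
    then show "x \<in> ?K"
      by (auto simp: abs_square_le_1 abs_le_iff minus_le_iff)
  qed
  ultimately have "compact ?S"
    using compact_Int_closed[OF K, of ?S] by (simp only: Int_absorb1)
  then show ?thesis
    by (simp add: nsphere_eq_top_of_set compact_space_subtopology)
qed

lemma continuous_on_Max:
  fixes f :: "'i \<Rightarrow> 'a::topological_space \<Rightarrow> real"
  assumes "finite I" "I \<noteq> {}" "\<And>i. i \<in> I \<Longrightarrow> continuous_on S (f i)"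
  shows "continuous_on S (\<lambda>x. Max ((\<lambda>i. f i x) ` I))"
  using assms
proof (induction rule: finite_ne_induct)
  case (insert i I)
  then show ?case
    by (simp add: continuous_on_max)
qed simp

lemma Max_scale:
  fixes f :: "'i \<Rightarrow> real"
  assumes "finite I" "I \<noteq> {}" "0 \<le> k"
  shows "Max ((\<lambda>i. k * f i) ` I) = k * Max (f ` I)"
proof -
  have "mono ((*) k)"
    using assms by (auto intro: monoI mult_left_mono)
  then have "k * Max (f ` I) = Max ((*) k ` f ` I)"
    using assms by (intro mono_Max_commute) auto
  then show ?thesis
    by (simp add: image_image)
qed

section \<open>Cubes\<close>

text \<open>A face of the cube is encoded as an interval of subsets: its vertices are the indicators
  of the sets between \<open>A\<close> and \<open>B\<close>, its free coordinates are those in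
  \<open>B - A\<close>, and its faces are the subintervals.\<close>

definition cube_cell :: "'j set \<Rightarrow> 'j set \<Rightarrow> ('j \<Rightarrow> real) set" where
  "cube_cell A B =
     {x. (\<forall>i. 0 \<le> x i \<and> x i \<le> 1) \<and> (\<forall>i\<in>A. x i = 1) \<and> (\<forall>i. i \<notin> B \<longrightarrow> x i = 0)}"

definition cube_bd :: "'j set \<Rightarrow> 'j set \<Rightarrow> ('j \<Rightarrow> real) set" where
  "cube_bd A B = {x \<in> cube_cell A B. \<exists>i\<in>B - A. x i = 0 \<or> x i = 1}"

lemma closed_cube_cell: "closed (cube_cell A B)"
proof -
  have *: "cube_cell A B = (\<Inter>i. {x. 0 \<le> x i} \<inter> {x. x i \<le> 1}) \<inter> (\<Inter>i\<in>A. {x. x i = 1}) \<inter>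
      (\<Inter>i\<in>-B. {x. x i = 0})"
    by (auto simp: cube_cell_def)
  show ?thesis
    unfolding *
    by (intro closed_Int closed_INT ballI closed_Collect_le closed_Collect_eq continuous_intros
        continuous_on_coordinate)
qed

text \<open>A cube is the cone over its boundary: \<open>q\<close> maps the cylinder over the sphere
  onto the cell and collapses only the end \<open>t = 1\<close>, to the centre. A nullhomotopy is
  constant there, so it factors through the cell. \<open>\<psi>\<close> is the end
  \<open>t = 0\<close> of \<open>q\<close>.\<close>

lemma cube_fill:
  fixes A B :: "'j set"
  assumes "finite B" "A \<subseteq> B" "card (B - A) = Suc m"
  obtains \<psi> where "continuous_map (nsphere m) (top_of_set (cube_bd A B)) \<psi>"
    "\<psi> ` topspace (nsphere m) = cube_bd A B"
    "\<And>(f :: _ \<Rightarrow> 'e::topological_space) U c.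
       homotopic_with (\<lambda>_. True) (nsphere m) (top_of_set U) (f \<circ> \<psi>) (\<lambda>_. c) \<Longrightarrow>
       \<exists>g. continuous_on (cube_cell A B) g \<and> g ` cube_cell A B \<subseteq> U \<and> (\<forall>x\<in>cube_bd A B. g x = f x)"
proof -
  define S where "S = {x::nat \<Rightarrow> real. (\<Sum>i\<le>m. (x i)\<^sup>2) = 1 \<and> (\<forall>i>m. x i = 0)}"
  have "card {..m} = card (B - A)"
    using assms by simp
  then obtain \<beta> where \<beta>: "bij_betw \<beta> {..m} (B - A)"
    using assms by (metis finite_Diff finite_atMost finite_same_card_bij)
  define b' where "b' = inv_into {..m} \<beta>"
  have b': "b' (\<beta> i) = i" "\<beta> i \<in> B - A" if "i \<le> m" for i
    using \<beta> that by (auto simp: b'_def bij_betw_def)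
  have \<beta>b: "b' j \<le> m" "\<beta> (b' j) = j" if "j \<in> B - A" for j
    using \<beta> that by (auto simp: b'_def bij_betw_def f_inv_into_f) (metis Diff_iff atMost_iff inv_into_into)
  \<comment> \<open>In the centred coordinates \<open>w x\<close> the boundary of the cell is the
    unit sphere of the max norm \<open>M\<close>, whereas \<open>nsphere\<close> is round.
    \<open>q (t, u)\<close> is the point on the ray through \<open>u\<close> with max norm
    \<open>1 - t\<close>; off the centre its inverse sends \<open>x\<close> to
    \<open>(1 - M (w x), N x)\<close>, where \<open>N\<close> divides by the Euclidean norm
    \<open>L\<close>.\<close>
  define M where "M u = Max ((\<lambda>i. \<bar>u i :: real\<bar>) ` {..m})" for u :: "nat \<Rightarrow> real"
  define q where "q p = (\<lambda>j. if j \<in> B - A then (1 + (1 - fst p) * snd p (b' j) / M (snd p)) / 2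
       else if j \<in> A then 1 else 0)" for p :: "real \<times> (nat \<Rightarrow> real)"
  define w where "w x i = (if i \<le> m then 2 * x (\<beta> i) - 1 else 0)" for x :: "'j \<Rightarrow> real" and i
  define L where "L x = sqrt (\<Sum>i\<le>m. (w x i)\<^sup>2)" for x
  define N where "N x = (\<lambda>i. w x i / L x)" for x
  have Mle: "\<bar>u i\<bar> \<le> M u" if "i \<le> m" for u i
    using that by (simp add: M_def)
  have Mpos: "M u > 0" if "u \<in> S" for u
  proof -
    obtain i where "i \<le> m" "u i \<noteq> 0"
    proof (rule ccontr)
      assume "\<not> thesis"
      then have "\<And>i. i \<le> m \<Longrightarrow> u i = 0"
        using that by auto
      then have "(\<Sum>i\<le>m. (u i)\<^sup>2) = 0"
        by simp
      with \<open>u \<in> S\<close> show False by (simp add: S_def)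
    qed
    then show ?thesis
      using Mle[of i u] by linarith
  qed
  have contM: "continuous_on X M" for X
    unfolding M_def by (intro continuous_on_Max continuous_intros continuous_on_coordinate) auto
  have Mscale: "M (\<lambda>i. k * u i) = k * M u" if "k \<ge> 0" for k u
    using that Max_scale[of "{..m}" k "\<lambda>i. \<bar>u i\<bar>"] by (simp add: M_def abs_mult)
  have wq: "w (q (t, u)) = (\<lambda>i. ((1 - t) / M u) * u i)" if "u \<in> S" for t u
    using b' that by (auto simp: w_def q_def fun_eq_iff add_divide_distrib S_def)
  have Mwq: "M (w (q (t, u))) = 1 - t" if "u \<in> S" "t \<in> {0..1}" for t u
    using Mpos[OF that(1)] that Mscale[of "(1 - t) / M u" u] unfolding wq[OF that(1)] by simp
  have Lq: "L (q (t, u)) = (1 - t) / M u" if "u \<in> S" "t \<in> {0..1}" for t u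
    using Mpos[OF that(1)] that unfolding L_def wq[OF that(1)] power_mult_distrib sum_distrib_left[symmetric]
    by (simp add: S_def)
  have Nq: "N (q (t, u)) = u" if "u \<in> S" "t \<in> {0..<1}" for t u
    using Mpos[OF that(1)] that Lq[OF that(1), of t] by (simp add: N_def wq)
  have cell_w: "\<bar>w x i\<bar> \<le> 1" if "x \<in> cube_cell A B" for x i
    using that by (auto simp: cube_cell_def w_def abs_le_iff)
  have M0: "0 \<le> M x" for x
    using Mle[of 0 x] by simp
  have M1: "M (w x) \<le> 1" if "x \<in> cube_cell A B" for x
    using cell_w[OF that] unfolding M_def by (intro Max.boundedI) auto
  have Lpos: "L x > 0" if "M (w x) > 0" for x
  proof -
    have "M (w x) \<in> (\<lambda>i. \<bar>w x i\<bar>) ` {..m}"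
      unfolding M_def by (intro Max_in) auto
    then obtain i where i: "i \<le> m" "w x i \<noteq> 0"
      using \<open>M (w x) > 0\<close> by auto
    have "0 < (\<Sum>i\<le>m. (w x i)\<^sup>2)"
      by (rule sum_pos2[of _ i]) (use i in auto)
    then show ?thesis
      by (simp add: L_def)
  qed
  have NS: "N x \<in> S" if "M (w x) > 0" for x
  proof -
    have "(\<Sum>i\<le>m. (w x i)\<^sup>2) = (L x)\<^sup>2"
      unfolding L_def by (simp add: sum_nonneg)
    then have "(\<Sum>i\<le>m. (w x i / L x)\<^sup>2) = 1"
      using Lpos[OF that] by (simp add: power_divide flip: sum_divide_distrib)
    then show ?thesis
      by (auto simp: N_def w_def S_def)
  qed
  have MN: "M (N x) = M (w x) / L x" if "M (w x) > 0" for x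
    using Mscale[of "1 / L x" "w x"] Lpos[OF that] by (simp add: N_def)
  have qN: "q (1 - M (w x), N x) = x" if "M (w x) > 0" "x \<in> cube_cell A B" for x
  proof -
    have "M (w x) * N x (b' j) / M (N x) = w x (b' j)" for j
      unfolding MN[OF that(1)] using Lpos[OF that(1)] that(1) by (simp add: N_def)
    then show ?thesis
      using that(2) \<beta>b by (auto simp: q_def fun_eq_iff w_def cube_cell_def)
  qed
  have q_half: "q (1, u) = (\<lambda>j. if j \<in> B - A then 1 / 2 else if j \<in> A then 1 else 0)" for u
    by (auto simp: q_def fun_eq_iff)
  have q_center: "x = q (1, u)" if "M (w x) = 0" "x \<in> cube_cell A B" for x u
  proof -
    have "x j = 1 / 2" if "j \<in> B - A" for j
      using Mle[of "b' j" "w x"] \<beta>b[OF that] \<open>M (w x) = 0\<close> by (simp add: w_def)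
    then show ?thesis
      using that(2) unfolding q_half by (auto simp: fun_eq_iff cube_cell_def)
  qed
  have qcell: "q (t, u) \<in> cube_cell A B" if "u \<in> S" "t \<in> {0..1}" for t u
  proof -
    have h1: "\<bar>(1 - t) * u i / M u\<bar> \<le> 1" if "i \<le> m" for i
    proof -
      have "\<bar>1 - t\<bar> * \<bar>u i\<bar> \<le> 1 * M u"
        using Mle[OF that, of u] \<open>t \<in> {0..1}\<close> by (intro mult_mono) auto
      then show ?thesis
        using Mpos[OF \<open>u \<in> S\<close>] by (simp add: abs_mult)
    qed
    have "0 \<le> q (t, u) j \<and> q (t, u) j \<le> 1" for j
    proof (cases "j \<in> B - A")
      case True
      have "- 1 \<le> (1 - t) * u (b' j) / M u \<and> (1 - t) * u (b' j) / M u \<le> 1"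
        using h1[OF \<beta>b(1)[OF True]] by linarith
      with True show ?thesis
        by (simp add: q_def)
    qed (auto simp: q_def)
    moreover have "q (t, u) j = 1" if "j \<in> A" for j
      using that by (simp add: q_def)
    moreover have "q (t, u) j = 0" if "j \<notin> B" for j
      using that assms(2) by (auto simp: q_def)
    ultimately show ?thesis
      unfolding cube_cell_def by blast
  qed
  have bdM: "M (w x) = 1" if "x \<in> cube_bd A B" for x
  proof -
    obtain j where j: "j \<in> B - A" "x j = 0 \<or> x j = 1"
      using \<open>x \<in> cube_bd A B\<close> by (auto simp: cube_bd_def)
    then have "\<bar>w x (b' j)\<bar> = 1"
      using \<beta>b by (auto simp: w_def)
    then have "1 \<le> M (w x)"
      using Mle[of "b' j" "w x"] \<beta>b[OF j(1)] by simp
    then show ?thesis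
      using M1[of x] that by (simp add: cube_bd_def)
  qed
  have bdq: "q (0, u) \<in> cube_bd A B" if "u \<in> S" for u
  proof -
    have "M u \<in> (\<lambda>i. \<bar>u i\<bar>) ` {..m}"
      unfolding M_def by (intro Max_in) auto
    then obtain i where i: "i \<le> m" "M u = \<bar>u i\<bar>"
      by auto
    then have "u i / M u = 1 \<or> u i / M u = - 1"
      using Mpos[OF that] by (simp add: field_simps) linarith
    then have "q (0, u) (\<beta> i) = 0 \<or> q (0, u) (\<beta> i) = 1"
      using b'[OF i(1)] by (auto simp: q_def)
    moreover have "q (0, u) \<in> cube_cell A B"
      by (rule qcell[OF that]) simp
    ultimately show ?thesis
      using b'[OF i(1)] unfolding cube_bd_def by blast
  qed
  have contq: "continuous_on ({0..1} \<times> S) q"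
  proof (rule continuous_on_coordinatewise_then_product)
    fix j
    have 1: "continuous_on ({0..1} \<times> S) (\<lambda>p. M (snd p))"
      by (rule continuous_on_compose2[OF contM[of UNIV]]) (auto intro: continuous_intros)
    have 2: "continuous_on ({0..1} \<times> S) (\<lambda>p. snd p i)" for i
      by (rule continuous_on_compose2[OF continuous_on_coordinate[of UNIV]]) (auto intro: continuous_intros)
    have 3: "\<forall>p\<in>{0..1} \<times> S. M (snd p) \<noteq> 0"
      using Mpos by fastforce
    have "continuous_on ({0..1} \<times> S) (\<lambda>p. (1 + (1 - fst p) * snd p (b' j) / M (snd p)) / 2)"
      by (intro continuous_intros 1 2 3) simp
    then show "continuous_on ({0..1} \<times> S) (\<lambda>p. q p j)"
      by (cases "j \<in> B - A") (auto simp: q_def)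
  qed
  let ?P = "prod_topology (top_of_set {0..1::real}) (nsphere m)"
  have P_eq: "?P = top_of_set ({0..1} \<times> S)"
    by (simp add: nsphere_eq_top_of_set S_def)
  have "q ` ({0..1} \<times> S) = cube_cell A B"
  proof
    show "q ` ({0..1} \<times> S) \<subseteq> cube_cell A B"
      using qcell by (intro image_subsetI) (metis mem_Times_iff surjective_pairing)
    show "cube_cell A B \<subseteq> q ` ({0..1} \<times> S)"
    proof
      fix x assume x: "x \<in> cube_cell A B"
      have "topspace (nsphere m) = S"
        by (simp add: nsphere_eq_top_of_set S_def)
      then obtain u0 where u0: "u0 \<in> S"
        using in_topspace_nsphere[of m] by blast
      show "x \<in> q ` ({0..1} \<times> S)"
      proof (cases "M (w x) = 0")
        case True
        then show ?thesis
          using q_center[OF True x, of u0] u0 by (intro image_eqI[of _ _ "(1, u0)"]) simp_all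
      next
        case False
        then have "M (w x) > 0" using M0[of "w x"] by simp
        then show ?thesis
          using qN[OF _ x] NS[of x] M1[OF x]
          by (intro image_eqI[of _ _ "(1 - M (w x), N x)"]) simp_all
      qed
    qed
  qed
  \<comment> \<open>A continuous surjection from a compact to a Hausdorff space is a quotient map.
    This replaces a direct proof that \<open>g\<close> below is continuous at the centre.\<close>
  then have quot: "quotient_map ?P (top_of_set (cube_cell A B)) q"
  proof (intro continuous_imp_quotient_map)
    show "continuous_map ?P (top_of_set (cube_cell A B)) q"
      using contq \<open>q ` _ = _\<close> unfolding P_eq continuous_map_subtopology_eu by blast
    have "compact_space (top_of_set {0..1::real})"
      by (simp add: compact_space_subtopology)
    then show "compact_space ?P"
      by (simp add: compact_space_prod_topology compact_space_nsphere)
    have "Hausdorff_space (euclidean :: ('j \<Rightarrow> real) topology)"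
      by (metis Hausdorff_space_product_topology Hausdorff_space_euclidean euclidean_product_topology)
    then show "Hausdorff_space (top_of_set (cube_cell A B))"
      by (rule Hausdorff_space_subtopology)
    show "q ` topspace ?P = topspace (top_of_set (cube_cell A B))"
      using \<open>q ` _ = _\<close> by (simp only: P_eq topspace_euclidean_subtopology)
  qed
  have nS: "nsphere m = top_of_set S"
    by (simp add: nsphere_eq_top_of_set S_def)
  have cq0: "continuous_on S (\<lambda>u. q (0, u))"
    by (rule continuous_on_compose2[OF contq continuous_on_Pair[OF continuous_on_const continuous_on_id]])
      auto
  show thesis
  proof (rule that)
    show "continuous_map (nsphere m) (top_of_set (cube_bd A B)) (\<lambda>u. q (0, u))"
      using bdq cq0 unfolding nS continuous_map_subtopology_eu by blast
    have "x \<in> (\<lambda>u. q (0, u)) ` S" if "x \<in> cube_bd A B" for x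
      using bdM[OF that] qN[of x] NS[of x] that by (intro image_eqI[of _ _ "N x"]) (simp_all add: cube_bd_def)
    then show "(\<lambda>u. q (0, u)) ` topspace (nsphere m) = cube_bd A B"
      using bdq unfolding nS topspace_euclidean_subtopology by blast
  next
    fix f :: "('j \<Rightarrow> real) \<Rightarrow> 'e" and U c
    assume "homotopic_with (\<lambda>_. True) (nsphere m) (top_of_set U) (f \<circ> (\<lambda>u. q (0, u))) (\<lambda>_. c)"
    then obtain F where F: "continuous_map ?P (top_of_set U) F"
      and F0: "\<And>u. F (0, u) = f (q (0, u))" and F1: "\<And>u. F (1, u) = c"
      unfolding homotopic_with_def o_def by blast
    \<comment> \<open>At the centre the direction \<open>N x\<close> has no meaning;
      \<open>c\<close> is the value of \<open>F\<close> on the whole collapsed end.\<close>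
    define g where "g x = (if M (w x) = 0 then c else F (1 - M (w x), N x))" for x
    have gq: "(g \<circ> q) p = F p" if p: "p \<in> topspace ?P" for p
    proof -
      obtain t u where tu: "p = (t, u)" "t \<in> {0..1}" "u \<in> S"
        using p unfolding P_eq topspace_euclidean_subtopology by blast
      show ?thesis
      proof (cases "t = 1")
        case True
        then show ?thesis
          using Mwq[OF tu(3,2)] tu(1,2) F1 by (simp add: g_def)
      next
        case False
        then show ?thesis
          using Mwq[OF tu(3,2)] Nq[OF tu(3), of t] tu(1,2) by (simp add: g_def)
      qed
    qed
    then have "continuous_map ?P (top_of_set U) (g \<circ> q)"
      using continuous_map_eq[OF F, of "g \<circ> q"] by simp
    then have g: "continuous_map (top_of_set (cube_cell A B)) (top_of_set U) g"
      using quot continuous_compose_quotient_map by blast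
    moreover have "g x = f x" if "x \<in> cube_bd A B" for x
      using bdM[OF that] qN[of x] that F0 by (simp add: g_def cube_bd_def)
    ultimately show "\<exists>g. continuous_on (cube_cell A B) g \<and> g ` cube_cell A B \<subseteq> U \<and> (\<forall>x\<in>cube_bd A B. g x = f x)"
      unfolding continuous_map_subtopology_eu by blast
  qed
qed

section \<open>Extension over cubical complexes\<close>

text \<open>Sizes are measured against the values of \<open>f\<close> and not in balls around a
  chosen point, so the condition speaks of \<open>G\<close> alone, even for spheres that shrink
  towards limit points outside \<open>G\<close>.\<close>

definition uniformly_LC :: "nat \<Rightarrow> 'e::metric_space set \<Rightarrow> bool" where
  "uniformly_LC n G \<longleftrightarrow>
     (\<forall>\<epsilon>>0. \<exists>\<delta>>0. \<forall>m\<le>n. \<forall>f.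
        continuous_map (nsphere m) (top_of_set G) f \<and>
        (\<forall>u\<in>topspace (nsphere m). \<forall>v\<in>topspace (nsphere m). dist (f u) (f v) < \<delta>) \<longrightarrow>
        (\<exists>c. homotopic_with (\<lambda>_. True) (nsphere m)
               (top_of_set {y \<in> G. \<forall>v\<in>topspace (nsphere m). dist y (f v) < \<epsilon>}) f (\<lambda>_. c)))"

text \<open>The boundary of an \<open>(m + 1)\<close>-cell is an \<open>m\<close>-sphere, so
  connectivity up to \<open>n\<close> fills cells up to dimension \<open>n + 1\<close>. Vertices
  (\<open>A = B\<close>) have empty boundary and are excluded: nothing would tell where to send
  them.\<close>

lemma uniformly_LC_cube:
  fixes G :: "'e::metric_space set"
  assumes "uniformly_LC n G" "\<epsilon> > 0"
  obtains \<delta> where "\<delta> > 0"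
    "\<And>(A :: 'j set) B f. \<lbrakk>finite B; A \<subseteq> B; A \<noteq> B; card (B - A) \<le> Suc n; continuous_on (cube_bd A B) f;
        f ` cube_bd A B \<subseteq> G; \<And>x y. \<lbrakk>x \<in> cube_bd A B; y \<in> cube_bd A B\<rbrakk> \<Longrightarrow> dist (f x) (f y) < \<delta>\<rbrakk>
      \<Longrightarrow> \<exists>g. continuous_on (cube_cell A B) g \<and> g ` cube_cell A B \<subseteq> G \<and> (\<forall>x\<in>cube_bd A B. g x = f x) \<and>
            (\<forall>x\<in>cube_cell A B. \<forall>y\<in>cube_bd A B. dist (g x) (f y) < \<epsilon>)"
proof -
  obtain \<delta> where "\<delta> > 0" and \<delta>: "\<forall>m\<le>n. \<forall>f. continuous_map (nsphere m) (top_of_set G) f \<and>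
        (\<forall>u\<in>topspace (nsphere m). \<forall>v\<in>topspace (nsphere m). dist (f u) (f v) < \<delta>) \<longrightarrow>
        (\<exists>c. homotopic_with (\<lambda>_. True) (nsphere m)
               (top_of_set {y \<in> G. \<forall>v\<in>topspace (nsphere m). dist y (f v) < \<epsilon>}) f (\<lambda>_. c))"
    using assms(1)[unfolded uniformly_LC_def, THEN spec, THEN mp, OF assms(2)]
    by (elim exE conjE) (rule that)
  show thesis
  proof (rule that[OF \<open>\<delta> > 0\<close>])
    fix A B :: "'j set" and f :: "('j \<Rightarrow> real) \<Rightarrow> 'e"
    assume AB: "finite B" "A \<subseteq> B" "A \<noteq> B" "card (B - A) \<le> Suc n"
      and f: "continuous_on (cube_bd A B) f" "f ` cube_bd A B \<subseteq> G"
        "\<And>x y. \<lbrakk>x \<in> cube_bd A B; y \<in> cube_bd A B\<rbrakk> \<Longrightarrow> dist (f x) (f y) < \<delta>"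
    have "card (B - A) \<noteq> 0"
      using AB by auto
    then obtain m where m: "card (B - A) = Suc m"
      using not0_implies_Suc by blast
    have fill: thesis if "\<And>\<psi>. \<lbrakk>continuous_map (nsphere m) (top_of_set (cube_bd A B)) \<psi>;
       \<psi> ` topspace (nsphere m) = cube_bd A B;
       \<And>(f :: _ \<Rightarrow> 'e) U c. homotopic_with (\<lambda>_. True) (nsphere m) (top_of_set U) (f \<circ> \<psi>) (\<lambda>_. c) \<Longrightarrow>
       \<exists>g. continuous_on (cube_cell A B) g \<and> g ` cube_cell A B \<subseteq> U \<and> (\<forall>x\<in>cube_bd A B. g x = f x)\<rbrakk>
       \<Longrightarrow> thesis" for thesis
      by (rule cube_fill[where 'e = 'e, OF AB(1,2) m]) (rule that)
    obtain \<psi> where \<psi>: "continuous_map (nsphere m) (top_of_set (cube_bd A B)) \<psi>"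
       "\<psi> ` topspace (nsphere m) = cube_bd A B"
      and fill: "\<And>(f :: _ \<Rightarrow> 'e) U c. homotopic_with (\<lambda>_. True) (nsphere m) (top_of_set U) (f \<circ> \<psi>) (\<lambda>_. c) \<Longrightarrow>
       \<exists>g. continuous_on (cube_cell A B) g \<and> g ` cube_cell A B \<subseteq> U \<and> (\<forall>x\<in>cube_bd A B. g x = f x)"
      by (rule fill) blast
    have "continuous_map (top_of_set (cube_bd A B)) (top_of_set G) f"
      using f by auto
    then have f1: "continuous_map (nsphere m) (top_of_set G) (f \<circ> \<psi>)"
      using \<psi>(1) continuous_map_compose by blast
    have f2: "\<forall>u\<in>topspace (nsphere m). \<forall>v\<in>topspace (nsphere m). dist ((f \<circ> \<psi>) u) ((f \<circ> \<psi>) v) < \<delta>"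
      using f(3) \<psi>(2) by auto
    have "m \<le> n" using m AB(4) by simp
    from \<delta>[THEN spec, THEN mp, OF this, THEN spec, THEN mp, OF conjI[OF f1 f2]]
    obtain c where "homotopic_with (\<lambda>_. True) (nsphere m)
         (top_of_set {y \<in> G. \<forall>v\<in>topspace (nsphere m). dist y ((f \<circ> \<psi>) v) < \<epsilon>}) (f \<circ> \<psi>) (\<lambda>_. c)"
      by (elim exE) (rule that)
    from fill[OF this] obtain g where g: "continuous_on (cube_cell A B) g"
        "g ` cube_cell A B \<subseteq> {y \<in> G. \<forall>v\<in>topspace (nsphere m). dist y ((f \<circ> \<psi>) v) < \<epsilon>}"
        "\<forall>x\<in>cube_bd A B. g x = f x"
      by blast
    moreover have "dist (g x) (f y) < \<epsilon>" if "x \<in> cube_cell A B" "y \<in> cube_bd A B" for x y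
    proof -
      obtain v where "v \<in> topspace (nsphere m)" "y = \<psi> v"
        using \<psi>(2) \<open>y \<in> _\<close> by blast
      then show ?thesis
        using g(2) \<open>x \<in> _\<close> by fastforce
    qed
    ultimately show "\<exists>g. continuous_on (cube_cell A B) g \<and> g ` cube_cell A B \<subseteq> G \<and> (\<forall>x\<in>cube_bd A B. g x = f x) \<and>
            (\<forall>x\<in>cube_cell A B. \<forall>y\<in>cube_bd A B. dist (g x) (f y) < \<epsilon>)"
      by (intro exI[of _ g]) blast
  qed
qed

section \<open>Cubical complexes and extension of Lefschetz partial realizations\<close>

definition cells :: "('j set \<times> 'j set) set \<Rightarrow> ('j \<Rightarrow> real) set" where
  "cells C = (\<Union>(A, B)\<in>C. cube_cell A B)"

definition face_closed :: "('j set \<times> 'j set) set \<Rightarrow> bool" where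
  "face_closed C \<longleftrightarrow>
     (\<forall>A B A' B'. (A, B) \<in> C \<longrightarrow> A \<subseteq> A' \<longrightarrow> A' \<subseteq> B' \<longrightarrow> B' \<subseteq> B \<longrightarrow> (A', B') \<in> C)"

definition cubical_pair :: "('j set \<times> 'j set) set \<Rightarrow> ('j set \<times> 'j set) set \<Rightarrow> bool" where
  "cubical_pair C C0 \<longleftrightarrow> finite C \<and> (\<forall>A B. (A, B) \<in> C \<longrightarrow> finite B \<and> A \<subseteq> B) \<and>
     face_closed C \<and> face_closed C0 \<and> C0 \<subseteq> C"

text \<open>\<open>f\<close> is meant to be given on \<open>S\<close> only, yet its oscillation is
  measured over every cell of the larger complex \<open>C\<close>. With \<open>S\<close> the union
  of a subcomplex, this is the smallness condition for a partial realization.\<close>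

definition small_on_cells ::
  "('j set \<times> 'j set) set \<Rightarrow> ('j \<Rightarrow> real) set \<Rightarrow> (('j \<Rightarrow> real) \<Rightarrow> 'e::metric_space) \<Rightarrow> real \<Rightarrow> bool" where
  "small_on_cells C S f \<delta> \<longleftrightarrow>
     (\<forall>A B x y. (A, B) \<in> C \<longrightarrow> x \<in> cube_cell A B \<inter> S \<longrightarrow> y \<in> cube_cell A B \<inter> S \<longrightarrow> dist (f x) (f y) < \<delta>)"

lemma in_cells: "x \<in> cells C \<longleftrightarrow> (\<exists>A B. (A, B) \<in> C \<and> x \<in> cube_cell A B)"
  by (auto simp: cells_def)

lemma face_closedD:
  "face_closed C \<Longrightarrow> (A, B) \<in> C \<Longrightarrow> A \<subseteq> A' \<Longrightarrow> A' \<subseteq> B' \<Longrightarrow> B' \<subseteq> B \<Longrightarrow> (A', B') \<in> C"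
  unfolding face_closed_def by blast

text \<open>The coordinates equal to 1 and the nonzero coordinates of \<open>x\<close> form its
  carrier, the smallest cell through \<open>x\<close>, which is a face of every cell containing
  \<open>x\<close>.\<close>

lemma cube_cell_support:
  assumes "x \<in> cube_cell A B"
  shows "A \<subseteq> {i. x i = 1}" "{i. x i = 1} \<subseteq> {i. x i \<noteq> 0}" "{i. x i \<noteq> 0} \<subseteq> B"
    "x \<in> cube_cell {i. x i = 1} {i. x i \<noteq> 0}"
  using assms by (auto simp: cube_cell_def)

lemma cube_cell_interior:
  assumes "x \<in> cube_cell A B" "x \<notin> cube_bd A B" "A \<subseteq> B"
  shows "A = {i. x i = 1}" "B = {i. x i \<noteq> 0}"
  using assms by (auto simp: cube_cell_def cube_bd_def)

lemma cube_bd_support_card: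
  assumes "x \<in> cube_bd A B" "finite B"
  shows "card ({i. x i \<noteq> 0} - {i. x i = 1}) < card (B - A)"
proof (rule psubset_card_mono)
  show "{i. x i \<noteq> 0} - {i. x i = 1} \<subset> B - A"
    using assms by (auto simp: cube_bd_def cube_cell_def)
qed (use assms in auto)

text \<open>Cells outside \<open>C0\<close> have dimension at least \<open>k\<close>, so the
  boundary of a missing \<open>k\<close>-cell is carried by \<open>C0\<close>. The missing
  \<open>k\<close>-cells can therefore be filled independently of each other: two of them meet only
  where \<open>f\<close> is already given.\<close>

lemma complex_extension_step:
  fixes G :: "'e::metric_space set"
  assumes G: "uniformly_LC n G" and "1 \<le> k" "k \<le> n + 1" "\<epsilon> > 0"
  obtains \<delta> where "\<delta> > 0"
    "\<And>(C :: ('j set \<times> 'j set) set) C0 f.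
      \<lbrakk>cubical_pair C C0; \<And>A B. (A, B) \<in> C - C0 \<Longrightarrow> k \<le> card (B - A) \<and> card (B - A) \<le> n + 1;
       continuous_on (cells C0) f; f ` cells C0 \<subseteq> G; small_on_cells C (cells C0) f \<delta>\<rbrakk> \<Longrightarrow>
      \<exists>C1 g. cubical_pair C C1 \<and> C0 \<subseteq> C1 \<and>
        (\<forall>A B. (A, B) \<in> C - C1 \<longrightarrow> Suc k \<le> card (B - A) \<and> card (B - A) \<le> n + 1) \<and>
        continuous_on (cells C1) g \<and> g ` cells C1 \<subseteq> G \<and> (\<forall>x\<in>cells C0. g x = f x) \<and>
        small_on_cells C (cells C1) g \<epsilon>"
proof -
  \<comment> \<open>Two new values in a cell are compared through nearby values of \<open>f\<close>
    on \<open>cells C0\<close>: filling, \<open>f\<close>, filling, one third each.\<close>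
  have "\<epsilon> / 3 > 0" using \<open>\<epsilon> > 0\<close> by simp
  show thesis
  proof (rule uniformly_LC_cube[where 'j = 'j, OF G \<open>\<epsilon> / 3 > 0\<close>])
    fix \<delta>1 :: real
    assume "\<delta>1 > 0" and \<delta>1: "\<And>(A :: 'j set) B f. \<lbrakk>finite B; A \<subseteq> B; A \<noteq> B; card (B - A) \<le> Suc n;
        continuous_on (cube_bd A B) f; f ` cube_bd A B \<subseteq> G;
        \<And>x y. \<lbrakk>x \<in> cube_bd A B; y \<in> cube_bd A B\<rbrakk> \<Longrightarrow> dist (f x) (f y) < \<delta>1\<rbrakk>
      \<Longrightarrow> \<exists>g. continuous_on (cube_cell A B) g \<and> g ` cube_cell A B \<subseteq> G \<and> (\<forall>x\<in>cube_bd A B. g x = f x) \<and>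
            (\<forall>x\<in>cube_cell A B. \<forall>y\<in>cube_bd A B. dist (g x) (f y) < \<epsilon> / 3)"
    show thesis
    proof (rule that[of "min \<delta>1 (\<epsilon> / 3)"])
      show "min \<delta>1 (\<epsilon> / 3) > 0"
        using \<open>\<delta>1 > 0\<close> \<open>\<epsilon> > 0\<close> by simp
      fix C C0 :: "('j set \<times> 'j set) set" and f
      assume pair: "cubical_pair C C0"
        and dim: "\<And>A B. (A, B) \<in> C - C0 \<Longrightarrow> k \<le> card (B - A) \<and> card (B - A) \<le> n + 1"
        and contf: "continuous_on (cells C0) f" and fG: "f ` cells C0 \<subseteq> G"
        and small: "small_on_cells C (cells C0) f (min \<delta>1 (\<epsilon> / 3))"
      have fin: "finite C" and sub: "C0 \<subseteq> C"
        using pair by (simp_all add: cubical_pair_def)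
      have C: "finite B \<and> A \<subseteq> B" if "(A, B) \<in> C" for A B
        using pair that by (simp add: cubical_pair_def)
      have fcC: "face_closed C" and fcC0: "face_closed C0"
        using pair by (simp_all add: cubical_pair_def)
      note fC = face_closedD[OF fcC] and fC0 = face_closedD[OF fcC0]
      define D where "D = {(A, B). (A, B) \<in> C - C0 \<and> card (B - A) = k}"
      have D: "(A, B) \<in> C" "(A, B) \<notin> C0" "card (B - A) = k" "finite B" "A \<subseteq> B" "A \<noteq> B"
        if "(A, B) \<in> D" for A B
        using that C[of A B] \<open>1 \<le> k\<close> by (auto simp: D_def)
      have bd0: "cube_bd A B \<subseteq> cells C0" if "(A, B) \<in> D" for A B
      proof
        fix x assume x: "x \<in> cube_bd A B"
        then have xc: "x \<in> cube_cell A B" by (simp add: cube_bd_def)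
        have "({i. x i = 1}, {i. x i \<noteq> 0}) \<in> C"
          by (rule fC[OF D(1)[OF that] cube_cell_support(1-3)[OF xc]])
        moreover have "card ({i. x i \<noteq> 0} - {i. x i = 1}) < k"
          using cube_bd_support_card[OF x] D[OF that] by simp
        ultimately have "({i. x i = 1}, {i. x i \<noteq> 0}) \<in> C0"
          using dim[of "{i. x i = 1}" "{i. x i \<noteq> 0}"] by fastforce
        then show "x \<in> cells C0"
          using cube_cell_support(4)[OF xc] unfolding in_cells by blast
      qed
      define Q where "Q A B g \<longleftrightarrow> continuous_on (cube_cell A B) g \<and> g ` cube_cell A B \<subseteq> G \<and>
         (\<forall>x\<in>cube_bd A B. g x = f x) \<and> (\<forall>x\<in>cube_cell A B. \<forall>y\<in>cube_bd A B. dist (g x) (f y) < \<epsilon> / 3)" for A B g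
      have exQ: "\<exists>g. Q A B g" if "(A, B) \<in> D" for A B
        unfolding Q_def
      proof (rule \<delta>1)
        show "finite B" "A \<subseteq> B" "A \<noteq> B"
          using D[OF that] by auto
        show "card (B - A) \<le> Suc n"
          using D[OF that] \<open>k \<le> n + 1\<close> by auto
        show "continuous_on (cube_bd A B) f" "f ` cube_bd A B \<subseteq> G"
          using contf fG bd0[OF that] by (auto intro: continuous_on_subset)
        fix x y assume "x \<in> cube_bd A B" "y \<in> cube_bd A B"
        then have "x \<in> cube_cell A B \<inter> cells C0" "y \<in> cube_cell A B \<inter> cells C0"
          using bd0[OF that] by (auto simp: cube_bd_def)
        then show "dist (f x) (f y) < \<delta>1"
          using small D(1)[OF that] unfolding small_on_cells_def by fastforce
      qed
      define gg where "gg A B = (SOME g. Q A B g)" for A B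
      have Q: "Q A B (gg A B)" if "(A, B) \<in> D" for A B
        unfolding gg_def using exQ[OF that] by (rule someI_ex)
      have gg: "continuous_on (cube_cell A B) (gg A B)" "gg A B ` cube_cell A B \<subseteq> G"
        "x \<in> cube_bd A B \<Longrightarrow> gg A B x = f x"
        "x \<in> cube_cell A B \<Longrightarrow> y \<in> cube_bd A B \<Longrightarrow> dist (gg A B x) (f y) < \<epsilon> / 3"
        if "(A, B) \<in> D" for A B x y
        using Q[OF that] unfolding Q_def by blast+
      \<comment> \<open>A point of a cell in \<open>D\<close> that is not in \<open>cells C0\<close>
        is interior to that cell, so its carrier names the filling to use.\<close>
      define h where "h x = (if x \<in> cells C0 then f x else gg {i. x i = 1} {i. x i \<noteq> 0} x)" for x
      have int0: "x \<in> cube_bd A B" if "(A, B) \<in> D" "x \<in> cube_cell A B" "x \<in> cells C0" for A B x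
      proof (rule ccontr)
        assume "x \<notin> cube_bd A B"
        then have eq: "A = {i. x i = 1}" "B = {i. x i \<noteq> 0}"
          using cube_cell_interior[OF that(2)] D(5)[OF that(1)] by auto
        obtain A' B' where c': "(A', B') \<in> C0" "x \<in> cube_cell A' B'"
          using \<open>x \<in> cells C0\<close> unfolding in_cells by blast
        have "(A, B) \<in> C0"
          unfolding eq by (rule fC0[OF c'(1) cube_cell_support(1-3)[OF c'(2)]])
        then show False
          using D(2)[OF that(1)] by blast
      qed
      have h_D: "h x = gg A B x" if "(A, B) \<in> D" "x \<in> cube_cell A B" for A B x
      proof (cases "x \<in> cells C0")
        case True
        then show ?thesis
          using int0[OF that True] gg(3)[OF that(1)] by (simp add: h_def)
      next
        case False
        then have "x \<notin> cube_bd A B"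
          using bd0[OF that(1)] by blast
        from cube_cell_interior[OF that(2) this D(5)[OF that(1)]] False show ?thesis
          by (simp add: h_def)
      qed
      let ?C1 = "C0 \<union> D"
      have "continuous_on (cells ?C1) h"
        unfolding cells_def
      proof (rule continuous_on_closed_Union)
        show "finite ?C1"
          using fin sub by (auto intro: finite_subset[of _ C] simp: D_def)
        fix c assume c: "c \<in> ?C1"
        show "closed (case c of (A, B) \<Rightarrow> cube_cell A B)"
          by (auto simp: closed_cube_cell split: prod.split)
        obtain A B where AB: "c = (A, B)" by fastforce
        show "continuous_on (case c of (A, B) \<Rightarrow> cube_cell A B) h"
        proof (cases "c \<in> C0")
          case True
          then have sub0: "cube_cell A B \<subseteq> cells C0"
            unfolding cells_def AB by blast
          then have "continuous_on (cube_cell A B) f"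
            using contf continuous_on_subset by blast
          then have "continuous_on (cube_cell A B) h"
            by (rule continuous_on_eq) (use sub0 in \<open>simp add: h_def subset_iff\<close>)
          then show ?thesis by (simp add: AB)
        next
          case False
          then have "(A, B) \<in> D" using c AB by blast
          from continuous_on_eq[OF gg(1)[OF this], of h] h_D[OF this] show ?thesis
            by (simp add: AB)
        qed
      qed
      moreover have "h ` cells ?C1 \<subseteq> G"
      proof
        fix z assume "z \<in> h ` cells ?C1"
        then obtain x A B where x: "z = h x" "(A, B) \<in> ?C1" "x \<in> cube_cell A B"
          unfolding cells_def by blast
        show "z \<in> G"
        proof (cases "(A, B) \<in> D")
          case True
          then show ?thesis
            using h_D[OF True x(3)] gg(2)[OF True] x(1,3) by blast
        next
          case False
          then have "x \<in> cells C0" using x(2,3) unfolding in_cells by blast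
          then show ?thesis
            using fG x(1) by (simp add: h_def image_subset_iff)
        qed
      qed
      moreover have "\<forall>x\<in>cells C0. h x = f x"
        by (simp add: h_def)
      moreover have "face_closed ?C1"
        unfolding face_closed_def
      proof (intro allI impI)
        fix A B A' B' assume AB: "(A, B) \<in> ?C1" "A \<subseteq> A'" "A' \<subseteq> B'" "B' \<subseteq> B"
        show "(A', B') \<in> ?C1"
        proof (cases "(A, B) \<in> C0")
          case True
          then show ?thesis using fC0 AB by blast
        next
          case False
          then have "(A, B) \<in> D" using AB by blast
          then have "(A', B') \<in> C" using fC D(1) AB by blast
          moreover have "card (B' - A') \<le> k"
            using card_mono[of "B - A" "B' - A'"] D[OF \<open>(A, B) \<in> D\<close>] AB by auto
          ultimately show ?thesis
            using dim[of A' B'] by (cases "(A', B') \<in> C0") (auto simp: D_def)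
        qed
      qed
      then have "cubical_pair C ?C1"
        using pair by (auto simp: cubical_pair_def D_def)
      moreover have "\<forall>A B. (A, B) \<in> C - ?C1 \<longrightarrow> Suc k \<le> card (B - A) \<and> card (B - A) \<le> n + 1"
      proof (intro allI impI)
        fix A B assume AB: "(A, B) \<in> C - ?C1"
        then have "card (B - A) \<noteq> k" by (auto simp: D_def)
        with AB dim[of A B] show "Suc k \<le> card (B - A) \<and> card (B - A) \<le> n + 1" by auto
      qed
      moreover have "small_on_cells C (cells ?C1) h \<epsilon>"
        unfolding small_on_cells_def
      proof (intro allI impI)
        fix A B x y
        assume AB: "(A, B) \<in> C" and x: "x \<in> cube_cell A B \<inter> cells ?C1" and y: "y \<in> cube_cell A B \<inter> cells ?C1"
        have near: "\<exists>z\<in>cube_cell A B \<inter> cells C0. dist (h x) (f z) < \<epsilon> / 3"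
          if x: "x \<in> cube_cell A B \<inter> cells ?C1" for x
        proof (cases "x \<in> cells C0")
          case True
          then show ?thesis
            using x \<open>\<epsilon> > 0\<close> by (intro bexI[of _ x]) (simp_all add: h_def)
        next
          case False
          then obtain A' B' where D': "(A', B') \<in> D" "x \<in> cube_cell A' B'"
            using x unfolding cells_def by blast
          have "x \<notin> cube_bd A' B'"
            using bd0[OF D'(1)] False by blast
          from cube_cell_interior[OF D'(2) this D(5)[OF D'(1)]]
          have sub': "A \<subseteq> A'" "B' \<subseteq> B"
            using cube_cell_support[of x A B] x by auto
          \<comment> \<open>The lowest vertex of \<open>(A', B')\<close>: it lies on the boundary of
            that cell, where \<open>f\<close> is given, and also in \<open>(A, B)\<close>, of which
            the carrier \<open>(A', B')\<close> of \<open>x\<close> is a face.\<close>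
          define z :: "'j \<Rightarrow> real" where "z = indicator A'"
          have z: "z \<in> cube_bd A' B'"
            using D[OF D'(1)] by (auto simp: cube_bd_def cube_cell_def z_def indicator_def)
          moreover have "z \<in> cube_cell A B"
            using sub' D[OF D'(1)] by (auto simp: cube_cell_def z_def indicator_def)
          ultimately show ?thesis
            using bd0[OF D'(1)] gg(4)[OF D' z] h_D[OF D'] by (intro bexI[of _ z]) (simp, blast)
        qed
        obtain a b where ab: "a \<in> cube_cell A B \<inter> cells C0" "dist (h x) (f a) < \<epsilon> / 3"
          "b \<in> cube_cell A B \<inter> cells C0" "dist (h y) (f b) < \<epsilon> / 3"
          using near[OF x] near[OF y] by blast
        moreover have "dist (f a) (f b) < \<epsilon> / 3"
          using small AB ab(1,3) unfolding small_on_cells_def by fastforce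
        ultimately show "dist (h x) (h y) < \<epsilon>"
          using dist_triangle_third[of "h x" "f a" \<epsilon> "f b" "h y"] by (simp add: dist_commute)
      qed
      ultimately show "\<exists>C1 g. cubical_pair C C1 \<and> C0 \<subseteq> C1 \<and>
          (\<forall>A B. (A, B) \<in> C - C1 \<longrightarrow> Suc k \<le> card (B - A) \<and> card (B - A) \<le> n + 1) \<and>
          continuous_on (cells C1) g \<and> g ` cells C1 \<subseteq> G \<and> (\<forall>x\<in>cells C0. g x = f x) \<and>
          small_on_cells C (cells C1) g \<epsilon>"
        by (intro exI[of _ ?C1] exI[of _ h]) blast
    qed
  qed
qed

text \<open>The modulus for \<open>k\<close> is computed from the one for \<open>k + 1\<close> by a
  single extension step. There are at most \<open>n + 1\<close> steps, which is why
  \<open>\<delta>\<close> can be fixed before the complex is known.\<close>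

lemma complex_extension_from_dim:
  fixes G :: "'e::metric_space set"
  assumes G: "uniformly_LC n G" and "1 \<le> k" "k \<le> n + 2"
  shows "\<forall>\<epsilon>>0. \<exists>\<delta>>0. \<forall>(C :: ('j set \<times> 'j set) set) C0 f.
      cubical_pair C C0 \<and> (\<forall>A B. (A, B) \<in> C - C0 \<longrightarrow> k \<le> card (B - A) \<and> card (B - A) \<le> n + 1) \<and>
       continuous_on (cells C0) f \<and> f ` cells C0 \<subseteq> G \<and> small_on_cells C (cells C0) f \<delta> \<longrightarrow>
      (\<exists>g. continuous_on (cells C) g \<and> g ` cells C \<subseteq> G \<and> (\<forall>x\<in>cells C0. g x = f x) \<and>
        small_on_cells C (cells C) g \<epsilon>)"
  using \<open>k \<le> n + 2\<close> \<open>1 \<le> k\<close>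
proof (induction k rule: inc_induct)
  \<comment> \<open>For \<open>k = n + 2\<close> the two bounds on \<open>card (B - A)\<close>
    contradict each other, so no cell is left to fill.\<close>
  case base
  show ?case
  proof (intro allI impI)
    fix \<epsilon> :: real assume "\<epsilon> > 0"
    show "\<exists>\<delta>>0. \<forall>(C :: ('j set \<times> 'j set) set) C0 f.
      cubical_pair C C0 \<and> (\<forall>A B. (A, B) \<in> C - C0 \<longrightarrow> n + 2 \<le> card (B - A) \<and> card (B - A) \<le> n + 1) \<and>
       continuous_on (cells C0) f \<and> f ` cells C0 \<subseteq> G \<and> small_on_cells C (cells C0) f \<delta> \<longrightarrow>
      (\<exists>g. continuous_on (cells C) g \<and> g ` cells C \<subseteq> G \<and> (\<forall>x\<in>cells C0. g x = f x) \<and>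
        small_on_cells C (cells C) g \<epsilon>)"
    proof (intro exI[of _ \<epsilon>] conjI allI impI \<open>\<epsilon> > 0\<close>)
      fix C C0 :: "('j set \<times> 'j set) set" and f
      assume a: "cubical_pair C C0 \<and> (\<forall>A B. (A, B) \<in> C - C0 \<longrightarrow> n + 2 \<le> card (B - A) \<and> card (B - A) \<le> n + 1) \<and>
       continuous_on (cells C0) f \<and> f ` cells C0 \<subseteq> G \<and> small_on_cells C (cells C0) f \<epsilon>"
      then have "(A, B) \<notin> C - C0" for A B
        by fastforce
      then have "C0 = C"
        using a unfolding cubical_pair_def by auto
      with a show "\<exists>g. continuous_on (cells C) g \<and> g ` cells C \<subseteq> G \<and> (\<forall>x\<in>cells C0. g x = f x) \<and>
        small_on_cells C (cells C) g \<epsilon>"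
        by (intro exI[of _ f]) blast
    qed
  qed
next
  case (step k)
  show ?case
  proof (intro allI impI)
    fix \<epsilon> :: real assume "\<epsilon> > 0"
    have "1 \<le> Suc k" by simp
    from step(3)[OF this, THEN spec, THEN mp, OF \<open>\<epsilon> > 0\<close>]
    obtain \<delta>' where "\<delta>' > 0" and \<delta>': "\<forall>(C :: ('j set \<times> 'j set) set) C0 f.
      cubical_pair C C0 \<and> (\<forall>A B. (A, B) \<in> C - C0 \<longrightarrow> Suc k \<le> card (B - A) \<and> card (B - A) \<le> n + 1) \<and>
       continuous_on (cells C0) f \<and> f ` cells C0 \<subseteq> G \<and> small_on_cells C (cells C0) f \<delta>' \<longrightarrow>
      (\<exists>g. continuous_on (cells C) g \<and> g ` cells C \<subseteq> G \<and> (\<forall>x\<in>cells C0. g x = f x) \<and>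
        small_on_cells C (cells C) g \<epsilon>)"
      by (elim exE conjE) (rule that)
    show "\<exists>\<delta>>0. \<forall>(C :: ('j set \<times> 'j set) set) C0 f.
      cubical_pair C C0 \<and> (\<forall>A B. (A, B) \<in> C - C0 \<longrightarrow> k \<le> card (B - A) \<and> card (B - A) \<le> n + 1) \<and>
       continuous_on (cells C0) f \<and> f ` cells C0 \<subseteq> G \<and> small_on_cells C (cells C0) f \<delta> \<longrightarrow>
      (\<exists>g. continuous_on (cells C) g \<and> g ` cells C \<subseteq> G \<and> (\<forall>x\<in>cells C0. g x = f x) \<and>
        small_on_cells C (cells C) g \<epsilon>)"
    proof (rule complex_extension_step[where 'j = 'j, OF G _ _ \<open>\<delta>' > 0\<close>, of k])
      fix \<delta> :: real
      assume "\<delta> > 0" and \<delta>: "\<And>(C :: ('j set \<times> 'j set) set) C0 f.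
      \<lbrakk>cubical_pair C C0; \<And>A B. (A, B) \<in> C - C0 \<Longrightarrow> k \<le> card (B - A) \<and> card (B - A) \<le> n + 1;
       continuous_on (cells C0) f; f ` cells C0 \<subseteq> G; small_on_cells C (cells C0) f \<delta>\<rbrakk> \<Longrightarrow>
      \<exists>C1 g. cubical_pair C C1 \<and> C0 \<subseteq> C1 \<and>
        (\<forall>A B. (A, B) \<in> C - C1 \<longrightarrow> Suc k \<le> card (B - A) \<and> card (B - A) \<le> n + 1) \<and>
        continuous_on (cells C1) g \<and> g ` cells C1 \<subseteq> G \<and> (\<forall>x\<in>cells C0. g x = f x) \<and>
        small_on_cells C (cells C1) g \<delta>'"
      show ?thesis
      proof (intro exI[of _ \<delta>] conjI allI impI \<open>\<delta> > 0\<close>)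
        fix C C0 :: "('j set \<times> 'j set) set" and f
        assume a: "cubical_pair C C0 \<and> (\<forall>A B. (A, B) \<in> C - C0 \<longrightarrow> k \<le> card (B - A) \<and> card (B - A) \<le> n + 1) \<and>
          continuous_on (cells C0) f \<and> f ` cells C0 \<subseteq> G \<and> small_on_cells C (cells C0) f \<delta>"
        have "\<exists>C1 g. cubical_pair C C1 \<and> C0 \<subseteq> C1 \<and>
          (\<forall>A B. (A, B) \<in> C - C1 \<longrightarrow> Suc k \<le> card (B - A) \<and> card (B - A) \<le> n + 1) \<and>
          continuous_on (cells C1) g \<and> g ` cells C1 \<subseteq> G \<and> (\<forall>x\<in>cells C0. g x = f x) \<and>
          small_on_cells C (cells C1) g \<delta>'"
          by (rule \<delta>) (use a in \<open>simp_all only:\<close>)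
        then obtain C1 g where C1: "cubical_pair C C1" "C0 \<subseteq> C1"
          "\<forall>A B. (A, B) \<in> C - C1 \<longrightarrow> Suc k \<le> card (B - A) \<and> card (B - A) \<le> n + 1"
          "continuous_on (cells C1) g" "g ` cells C1 \<subseteq> G" "\<forall>x\<in>cells C0. g x = f x"
          "small_on_cells C (cells C1) g \<delta>'"
          by (elim exE conjE) (rule that)
        from \<delta>'[THEN spec, THEN spec, THEN spec, THEN mp,
            OF conjI[OF C1(1) conjI[OF C1(3) conjI[OF C1(4) conjI[OF C1(5) C1(7)]]]]]
        obtain g' where g': "continuous_on (cells C) g'" "g' ` cells C \<subseteq> G" "\<forall>x\<in>cells C1. g' x = g x"
          "small_on_cells C (cells C) g' \<epsilon>"
          by (elim exE conjE) (rule that)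
        have "cells C0 \<subseteq> cells C1"
          using C1(2) by (auto simp: cells_def)
        then have "\<forall>x\<in>cells C0. g' x = f x"
          using g'(3) C1(6) by auto
        with g' show "\<exists>g. continuous_on (cells C) g \<and> g ` cells C \<subseteq> G \<and> (\<forall>x\<in>cells C0. g x = f x) \<and>
            small_on_cells C (cells C) g \<epsilon>"
          by blast
      qed
    qed (use step in auto)
  qed
qed

text \<open>The lower bound 1 says that \<open>C0\<close> contains every vertex of \<open>C\<close>,
  which is where the extension has to start.\<close>

lemma complex_extension:
  fixes G :: "'e::metric_space set"
  assumes "uniformly_LC n G" "\<epsilon> > 0"
  obtains \<delta> where "\<delta> > 0"
    "\<And>(C :: ('j set \<times> 'j set) set) C0 f.
      \<lbrakk>cubical_pair C C0; \<And>A B. (A, B) \<in> C - C0 \<Longrightarrow> 1 \<le> card (B - A) \<and> card (B - A) \<le> n + 1;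
       continuous_on (cells C0) f; f ` cells C0 \<subseteq> G; small_on_cells C (cells C0) f \<delta>\<rbrakk> \<Longrightarrow>
      \<exists>g. continuous_on (cells C) g \<and> g ` cells C \<subseteq> G \<and> (\<forall>x\<in>cells C0. g x = f x) \<and>
        small_on_cells C (cells C) g \<epsilon>"
proof -
  have "1 \<le> n + 2" by simp
  note ext = complex_extension_from_dim[where 'j = 'j, OF assms(1) le_refl[of 1] this]
  from ext[THEN spec, THEN mp, OF \<open>\<epsilon> > 0\<close>]
  obtain \<delta> where "\<delta> > 0" and \<delta>: "\<forall>(C :: ('j set \<times> 'j set) set) C0 f.
      cubical_pair C C0 \<and> (\<forall>A B. (A, B) \<in> C - C0 \<longrightarrow> 1 \<le> card (B - A) \<and> card (B - A) \<le> n + 1) \<and>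
       continuous_on (cells C0) f \<and> f ` cells C0 \<subseteq> G \<and> small_on_cells C (cells C0) f \<delta> \<longrightarrow>
      (\<exists>g. continuous_on (cells C) g \<and> g ` cells C \<subseteq> G \<and> (\<forall>x\<in>cells C0. g x = f x) \<and>
        small_on_cells C (cells C) g \<epsilon>)"
    by (elim exE conjE) (rule that)
  show thesis
  proof (rule that[OF \<open>\<delta> > 0\<close>])
    fix C C0 :: "('j set \<times> 'j set) set" and f
    assume "cubical_pair C C0"
      "\<And>A B. (A, B) \<in> C - C0 \<Longrightarrow> 1 \<le> card (B - A) \<and> card (B - A) \<le> n + 1"
      "continuous_on (cells C0) f" "f ` cells C0 \<subseteq> G" "small_on_cells C (cells C0) f \<delta>"
    then show "\<exists>g. continuous_on (cells C) g \<and> g ` cells C \<subseteq> G \<and> (\<forall>x\<in>cells C0. g x = f x) \<and>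
        small_on_cells C (cells C) g \<epsilon>"
      using \<delta> by blast
  qed
qed

section \<open>Nerves of covers\<close>

text \<open>The sets are open in the ambient space and the order is bounded at all of its points,
  because the nerve will be evaluated off \<open>X\<close>. That each member meets \<open>X\<close>
  puts points of \<open>G\<close> into it and lets a small mesh force refinement.\<close>

definition fine_cover :: "nat \<Rightarrow> 'e::metric_space set \<Rightarrow> real \<Rightarrow> 'e set set \<Rightarrow> bool" where
  "fine_cover n X \<mu> W \<longleftrightarrow> finite W \<and> X \<subseteq> \<Union>W \<and>
     (\<forall>V\<in>W. open V \<and> V \<inter> X \<noteq> {} \<and> (\<forall>x\<in>V. \<forall>y\<in>V. dist x y < \<mu>)) \<and>
     (\<forall>y. card {V \<in> W. y \<in> V} \<le> n + 1)"

text \<open>Barycentric coordinates are normalised to have maximum 1 instead of sum 1, which turns the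
  realisation of the nerve into a cubical complex.\<close>

definition nerve :: "'e set set \<Rightarrow> ('e set \<Rightarrow> real) set" where
  "nerve W = {x. (\<forall>V. 0 \<le> x V \<and> x V \<le> 1) \<and> (\<exists>V. x V = 1) \<and> (\<exists>y. \<forall>V. x V \<noteq> 0 \<longrightarrow> V \<in> W \<and> y \<in> V)}"

text \<open>The bound holds for every common point of the members carrying \<open>x\<close>. If the
  nonzero coordinates of \<open>\<phi> y\<close> belong to members containing \<open>y\<close>, then
  \<open>g (\<phi> y)\<close> is within \<open>a\<close> of \<open>y\<close>: this is how
  approximate retractions arise.\<close>

definition nerve_map :: "'e set set \<Rightarrow> 'e::metric_space set \<Rightarrow> (('e set \<Rightarrow> real) \<Rightarrow> 'e) \<Rightarrow> real \<Rightarrow> bool" where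
  "nerve_map W G g a \<longleftrightarrow> continuous_on (nerve W) g \<and> g ` nerve W \<subseteq> G \<and>
     (\<forall>x\<in>nerve W. \<forall>y. (\<forall>V. x V \<noteq> 0 \<longrightarrow> y \<in> V) \<longrightarrow> dist (g x) y < a)"

lemma nerve_map_mono: "nerve_map W G g a \<Longrightarrow> a \<le> b \<Longrightarrow> nerve_map W G g b"
  unfolding nerve_map_def by force

text \<open>\<open>A \<noteq> {}\<close> expresses that the largest coordinate is 1. It uses up one
  coordinate, so a cover of order \<open>n + 1\<close> has cells of dimension at most
  \<open>n\<close>.\<close>

definition nerve_cells :: "'e set set \<Rightarrow> ('e set set \<times> 'e set set) set" where
  "nerve_cells W = {(A, B). A \<noteq> {} \<and> A \<subseteq> B \<and> B \<subseteq> W \<and> (\<exists>y. \<forall>V\<in>B. y \<in> V)}"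

lemma cells_nerve_cells: "cells (nerve_cells W) = nerve W"
proof
  show "cells (nerve_cells W) \<subseteq> nerve W"
  proof
    fix x assume "x \<in> cells (nerve_cells W)"
    then obtain A B where AB: "(A, B) \<in> nerve_cells W" and x: "x \<in> cube_cell A B"
      unfolding in_cells by blast
    obtain y V where y: "\<forall>V\<in>B. y \<in> V" and "V \<in> A" "B \<subseteq> W"
      using AB unfolding nerve_cells_def by blast
    then have "x V = 1" "\<forall>V. x V \<noteq> 0 \<longrightarrow> V \<in> W \<and> y \<in> V"
      using x unfolding cube_cell_def by blast+
    then show "x \<in> nerve W"
      using x unfolding nerve_def cube_cell_def by blast
  qed
  show "nerve W \<subseteq> cells (nerve_cells W)"
  proof
    fix x assume x: "x \<in> nerve W"
    then obtain V y where V: "x V = 1" and y: "\<forall>V. x V \<noteq> 0 \<longrightarrow> V \<in> W \<and> y \<in> V"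
      unfolding nerve_def by blast
    have "x \<in> cube_cell {V. x V = 1} {V. x V \<noteq> 0}"
      using x by (simp add: nerve_def cube_cell_def)
    moreover have "({V. x V = 1}, {V. x V \<noteq> 0}) \<in> nerve_cells W"
      using V y unfolding nerve_cells_def by force
    ultimately show "x \<in> cells (nerve_cells W)"
      unfolding in_cells by blast
  qed
qed

lemma nerve_supp_in_cells:
  assumes x: "x \<in> nerve W" and y: "\<And>V. x V \<noteq> 0 \<Longrightarrow> y \<in> V"
  shows "({V. x V = 1}, {V. x V \<noteq> 0}) \<in> nerve_cells W" "x \<in> cube_cell {V. x V = 1} {V. x V \<noteq> 0}"
    "{V. x V = 1} \<noteq> {}" "{V. x V \<noteq> 0} \<subseteq> W"
proof -
  show *: "{V. x V = 1} \<noteq> {}" "{V. x V \<noteq> 0} \<subseteq> W"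
    using x unfolding nerve_def by blast+
  show "({V. x V = 1}, {V. x V \<noteq> 0}) \<in> nerve_cells W"
    using * y unfolding nerve_cells_def by force
  show "x \<in> cube_cell {V. x V = 1} {V. x V \<noteq> 0}"
    using x by (simp add: nerve_def cube_cell_def)
qed

lemma cube_cell_vertex: "cube_cell A A = {indicator A}"
proof -
  have "x = indicator A" if "x \<in> cube_cell A A" for x :: "'a \<Rightarrow> real"
  proof
    fix i show "x i = indicator A i"
      using that by (cases "i \<in> A") (auto simp: cube_cell_def)
  qed
  moreover have "indicator A \<in> cube_cell A A"
    by (auto simp: cube_cell_def indicator_def)
  ultimately show ?thesis by blast
qed

text \<open>Vertices go to points of \<open>G\<close> inside the corresponding members, which exist
  because the members are open and meet the closure of \<open>G\<close>; the rest is extension over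
  cells.\<close>

lemma exists_nerve_map:
  fixes G :: "'e::metric_space set"
  assumes G: "uniformly_LC n G" and X: "X \<subseteq> closure G" and "a > 0"
  obtains \<mu> where "\<mu> > 0" "\<And>W. fine_cover n X \<mu> W \<Longrightarrow> \<exists>g. nerve_map W G g a"
proof -
  have "a / 2 > 0" using \<open>a > 0\<close> by simp
  show thesis
  proof (rule complex_extension[where 'j = "'e set", OF G \<open>a / 2 > 0\<close>])
    fix \<delta> :: real
    assume "\<delta> > 0" and \<delta>: "\<And>(C :: ('e set set \<times> 'e set set) set) C0 f.
      \<lbrakk>cubical_pair C C0; \<And>A B. (A, B) \<in> C - C0 \<Longrightarrow> 1 \<le> card (B - A) \<and> card (B - A) \<le> n + 1;
       continuous_on (cells C0) f; f ` cells C0 \<subseteq> G; small_on_cells C (cells C0) f \<delta>\<rbrakk> \<Longrightarrow>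
      \<exists>g. continuous_on (cells C) g \<and> g ` cells C \<subseteq> G \<and> (\<forall>x\<in>cells C0. g x = f x) \<and>
        small_on_cells C (cells C) g (a / 2)"
    \<comment> \<open>\<open>\<delta> / 2\<close>, because the images of two vertices of a cell are
      both compared with a common point of its members; \<open>a / 2\<close>, because the extension
      accounts for the other half of the error.\<close>
    define \<mu> where "\<mu> = min (a / 2) (\<delta> / 2)"
    have "\<mu> > 0" using \<open>\<delta> > 0\<close> \<open>a > 0\<close> by (simp add: \<mu>_def)
    have "\<exists>g. nerve_map W G g a" if W: "fine_cover n X \<mu> W" for W
    proof -
      have finW: "finite W"
        and W_mesh: "\<And>V x y. V \<in> W \<Longrightarrow> x \<in> V \<Longrightarrow> y \<in> V \<Longrightarrow> dist x y < \<mu>"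
        and W_ord: "\<And>y. card {V \<in> W. y \<in> V} \<le> n + 1"
        using W unfolding fine_cover_def by blast+
      have "\<exists>p. p \<in> V \<inter> G" if "V \<in> W" for V
      proof -
        have "open V" "V \<inter> X \<noteq> {}"
          using W that unfolding fine_cover_def by blast+
        then show ?thesis
          using X open_Int_closure_eq_empty[of V G] by blast
      qed
      then obtain p where p: "\<And>V. V \<in> W \<Longrightarrow> p V \<in> V" "\<And>V. V \<in> W \<Longrightarrow> p V \<in> G"
        by (metis Int_iff)
      \<comment> \<open>A vertex of the cubical complex is the indicator of a whole set of members
        with a common point, so any one of them may supply the image.\<close>
      define f where "f x = p (SOME V. x V = (1 :: real))" for x :: "'e set \<Rightarrow> real"
      let ?C = "nerve_cells W"
      let ?Verts = "{(A, B). (A, B) \<in> ?C \<and> A = B}"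
      have ft: "\<exists>V\<in>A. f x = p V" if "x \<in> cube_cell A A" "A \<noteq> {}" for x A
      proof -
        have "\<exists>V. x V = 1"
          using that by (auto simp: cube_cell_def)
        then have "x (SOME V. x V = 1) = 1"
          by (rule someI_ex)
        then have "(SOME V. x V = 1) \<in> A"
          using that by (force simp: cube_cell_def)
        then show ?thesis by (auto simp: f_def)
      qed
      have C: "A \<noteq> {}" "A \<subseteq> B" "B \<subseteq> W" "\<exists>y. \<forall>V\<in>B. y \<in> V" if "(A, B) \<in> ?C" for A B
        using that by (auto simp: nerve_cells_def)
      have finC: "finite ?C"
      proof (rule finite_subset)
        show "?C \<subseteq> Pow W \<times> Pow W"
          unfolding nerve_cells_def by auto
      qed (use finW in simp)
      have "\<exists>g. continuous_on (cells ?C) g \<and> g ` cells ?C \<subseteq> G \<and> (\<forall>x\<in>cells ?Verts. g x = f x) \<and>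
        small_on_cells ?C (cells ?C) g (a / 2)"
      proof (rule \<delta>)
        have fc: "face_closed ?C"
          unfolding face_closed_def
        proof (intro allI impI)
          fix A B A' B' assume AB: "(A, B) \<in> ?C" and s: "A \<subseteq> A'" "A' \<subseteq> B'" "B' \<subseteq> B"
          have "A' \<noteq> {}" "B' \<subseteq> W"
            using C(1,3)[OF AB] s by auto
          moreover have "\<exists>y. \<forall>V\<in>B'. y \<in> V"
            using C(4)[OF AB] s(3) by (meson subsetD)
          ultimately show "(A', B') \<in> ?C" using s unfolding nerve_cells_def by simp
        qed
        have "face_closed ?Verts"
          unfolding face_closed_def
        proof (intro allI impI)
          fix A B A' B' assume AB: "(A, B) \<in> ?Verts" and s: "A \<subseteq> A'" "A' \<subseteq> B'" "B' \<subseteq> B"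
          then have "A' = B'" "(A', B') \<in> ?C"
            using face_closedD[OF fc, of A B A' B'] by auto
          then show "(A', B') \<in> ?Verts" by simp
        qed
        moreover note fc
        moreover have "finite B \<and> A \<subseteq> B" if "(A, B) \<in> ?C" for A B
          using C[OF that] finite_subset finW by blast
        ultimately show "cubical_pair ?C ?Verts"
          using finC unfolding cubical_pair_def by blast
      next
        fix A B assume AB: "(A, B) \<in> ?C - ?Verts"
        then have AB': "(A, B) \<in> ?C" and "A \<noteq> B" by auto
        obtain y where y: "\<forall>V\<in>B. y \<in> V" using C(4)[OF AB'] by blast
        have finB: "finite B" using C(3)[OF AB'] finW finite_subset by blast
        have "B - A \<noteq> {}" using \<open>A \<noteq> B\<close> C[OF AB'] by blast
        then have "1 \<le> card (B - A)"
          using finB by (simp add: Suc_leI card_gt_0_iff)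
        moreover have "card (B - A) \<le> card {V \<in> W. y \<in> V}"
          by (rule card_mono) (use y C(3)[OF AB'] finW in auto)
        ultimately show "1 \<le> card (B - A) \<and> card (B - A) \<le> n + 1"
          using W_ord[of y] by simp
      next
        have "finite ?Verts"
          by (rule finite_subset[OF _ finC]) auto
        then show "continuous_on (cells ?Verts) f"
          unfolding cells_def
        proof (rule continuous_on_closed_Union)
          fix c assume "c \<in> ?Verts"
          then obtain A where c: "c = (A, A)" by auto
          show "closed (case c of (A, B) \<Rightarrow> cube_cell A B)"
            by (simp add: c closed_cube_cell)
          show "continuous_on (case c of (A, B) \<Rightarrow> cube_cell A B) f"
            by (simp add: c cube_cell_vertex)
        qed
        show "f ` cells ?Verts \<subseteq> G"
        proof
          fix z assume "z \<in> f ` cells ?Verts"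
          then obtain x A where xA: "z = f x" "(A, A) \<in> ?C" "x \<in> cube_cell A A"
            unfolding cells_def by blast
          then show "z \<in> G"
            using ft[OF xA(3) C(1)[OF xA(2)]] C(3)[OF xA(2)] p(2) by auto
        qed
        show "small_on_cells ?C (cells ?Verts) f \<delta>"
          unfolding small_on_cells_def
        proof (intro allI impI)
          fix A B x y
          assume AB: "(A, B) \<in> ?C" and x: "x \<in> cube_cell A B \<inter> cells ?Verts" and y: "y \<in> cube_cell A B \<inter> cells ?Verts"
          obtain u where u: "\<forall>V\<in>B. u \<in> V" using C(4)[OF AB] by blast
          have near: "dist (f x) u < \<mu>" if x: "x \<in> cube_cell A B \<inter> cells ?Verts" for x
          proof -
            obtain A' where A': "(A', A') \<in> ?C" "x \<in> cube_cell A' A'"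
              using x unfolding cells_def by blast
            obtain V where V: "V \<in> A'" "f x = p V"
              using ft[OF A'(2) C(1)[OF A'(1)]] by blast
            have "x V \<noteq> 0"
              using A'(2) V(1) by (auto simp: cube_cell_def)
            then have "V \<in> B"
              using x by (auto simp: cube_cell_def)
            then show ?thesis
              using W_mesh[of V "p V" u] p(1)[of V] u V(2) C(3)[OF AB] by auto
          qed
          have "dist (f x) (f y) \<le> dist (f x) u + dist (f y) u"
            by (rule dist_triangle2)
          also have "\<dots> < \<mu> + \<mu>"
            using near[OF x] near[OF y] by simp
          also have "\<dots> \<le> \<delta>" by (simp add: \<mu>_def)
          finally show "dist (f x) (f y) < \<delta>" .
        qed
      qed
      then obtain g where g: "continuous_on (nerve W) g" "g ` nerve W \<subseteq> G" "\<forall>x\<in>cells ?Verts. g x = f x"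
        "small_on_cells ?C (nerve W) g (a / 2)"
        unfolding cells_nerve_cells by (elim exE conjE) (rule that)
      have "dist (g x) y < a" if x: "x \<in> nerve W" and y: "\<And>V. x V \<noteq> 0 \<Longrightarrow> y \<in> V" for x y
      proof -
        let ?A = "{V. x V = 1}" and ?B = "{V. x V \<noteq> 0}"
        note AB = nerve_supp_in_cells[OF x y]
        \<comment> \<open>The top vertex of the carrier of \<open>x\<close>: it shares a cell with
          \<open>x\<close>, and there \<open>g\<close> takes one of the chosen values
          \<open>p V\<close>.\<close>
        define v :: "'e set \<Rightarrow> real" where "v = indicator ?B"
        have BB: "(?B, ?B) \<in> ?C"
          using AB(1) by (auto simp: nerve_cells_def)
        have vBB: "v \<in> cube_cell ?B ?B"
          by (simp add: v_def cube_cell_vertex)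
        have v0: "v \<in> cells ?Verts"
          using BB vBB unfolding cells_def by blast
        have "v \<in> cube_cell ?A ?B"
          by (auto simp: v_def cube_cell_def indicator_def)
        moreover have "v \<in> nerve W"
          using BB vBB unfolding cells_nerve_cells[symmetric] in_cells by blast
        ultimately have "dist (g x) (g v) < a / 2"
          using g(4) AB(1,2) x unfolding small_on_cells_def by blast
        moreover obtain V where V: "V \<in> ?B" "f v = p V"
          using ft[OF vBB C(1)[OF BB]] by blast
        then have "dist (f v) y < \<mu>"
          using W_mesh[of V "p V" y] p(1)[of V] y[of V] AB(4) by auto
        then have "dist (g v) y < a / 2"
          using g(3) v0 by (simp add: \<mu>_def)
        ultimately show ?thesis
          using dist_triangle_half_l[of "g x" "g v" a y] by (simp add: dist_commute dist_triangle_half_r)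
      qed
      then have "nerve_map W G g a"
        using g(1,2) unfolding nerve_map_def by blast
      then show ?thesis by blast
    qed
    with \<open>\<mu> > 0\<close> show thesis
      by (rule that)
  qed
qed

section \<open>Projections and homotopies between nerves\<close>

text \<open>The map of nerves induced by a refinement projection \<open>p\<close>. Truncation at 1
  takes the place of normalising: the fibre that contains a coordinate equal to 1 has sum at least
  1.\<close>

definition push :: "('e set \<Rightarrow> 'e set) \<Rightarrow> 'e set set \<Rightarrow> ('e set \<Rightarrow> real) \<Rightarrow> 'e set \<Rightarrow> real" where
  "push p W x V = min 1 (\<Sum>U\<in>{U \<in> W. p U = V}. x U)"

lemma push_support:
  assumes "x \<in> nerve W'" "push p W' x V \<noteq> 0"
  shows "\<exists>U\<in>W'. p U = V \<and> x U \<noteq> 0"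
proof (rule ccontr)
  assume "\<not> ?thesis"
  then have "(\<Sum>U\<in>{U \<in> W'. p U = V}. x U) = 0"
    by (intro sum.neutral) auto
  with assms(2) show False by (simp add: push_def)
qed

lemma push_in_nerve:
  assumes x: "x \<in> nerve W'" and fin: "finite W'" and p: "\<And>U. U \<in> W' \<Longrightarrow> p U \<in> W \<and> U \<subseteq> p U"
  shows "push p W' x \<in> nerve W"
proof -
  obtain V y where V: "x V = 1" and y: "\<And>V. x V \<noteq> 0 \<Longrightarrow> V \<in> W' \<and> y \<in> V" and x0: "\<And>V. 0 \<le> x V"
    using x unfolding nerve_def by blast
  have "V \<in> W'" using y[of V] V by simp
  have "x V \<le> (\<Sum>U\<in>{U \<in> W'. p U = p V}. x U)"
    by (rule member_le_sum) (use \<open>V \<in> W'\<close> fin x0 in auto)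
  then have "push p W' x (p V) = 1"
    using V by (simp add: push_def)
  moreover have "0 \<le> push p W' x V \<and> push p W' x V \<le> 1" for V
    using x0 by (simp add: push_def sum_nonneg)
  moreover have "V \<in> W \<and> y \<in> V" if "push p W' x V \<noteq> 0" for V
    using push_support[OF x that] p y by blast
  ultimately show ?thesis
    unfolding nerve_def by blast
qed

lemma continuous_on_push: "continuous_on S (push p W)"
proof (rule continuous_on_coordinatewise_then_product)
  fix V
  show "continuous_on S (\<lambda>x. push p W x V)"
    unfolding push_def by (intro continuous_intros continuous_on_coordinate)
qed

text \<open>The nerve of \<open>W'\<close> times the unit interval is a cubical complex over
  \<open>'e set option\<close>, with \<open>None\<close> as the time coordinate. The maps prescribed
  on the two ends form a partial realization of it.\<close>

lemma exists_nerve_homotopy: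
  fixes G :: "'e::metric_space set"
  assumes G: "uniformly_LC n G" and "\<epsilon> > 0"
  obtains a where "a > 0" "\<And>W W' p g g'. \<lbrakk>finite W'; \<And>y. card {V \<in> W'. y \<in> V} \<le> n + 1;
      \<And>U. U \<in> W' \<Longrightarrow> p U \<in> W \<and> U \<subseteq> p U; nerve_map W G g a; nerve_map W' G g' a\<rbrakk> \<Longrightarrow>
      \<exists>h. continuous_on (nerve W' \<times> {0..1}) h \<and> h ` (nerve W' \<times> {0..1}) \<subseteq> G \<and>
        (\<forall>x\<in>nerve W'. h (x, 0) = g (push p W' x) \<and> h (x, 1) = g' x) \<and>
        (\<forall>x\<in>nerve W'. \<forall>t\<in>{0..1::real}. \<forall>y. (\<forall>V. x V \<noteq> 0 \<longrightarrow> y \<in> V) \<longrightarrow> dist (h (x, t)) y < \<epsilon>)"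
proof -
  have "\<epsilon> / 2 > 0" using \<open>\<epsilon> > 0\<close> by simp
  show thesis
  proof (rule complex_extension[where 'j = "'e set option", OF G \<open>\<epsilon> / 2 > 0\<close>])
    fix \<delta> :: real
    assume "\<delta> > 0" and \<delta>: "\<And>(C :: ('e set option set \<times> 'e set option set) set) C0 f.
      \<lbrakk>cubical_pair C C0; \<And>A B. (A, B) \<in> C - C0 \<Longrightarrow> 1 \<le> card (B - A) \<and> card (B - A) \<le> n + 1;
       continuous_on (cells C0) f; f ` cells C0 \<subseteq> G; small_on_cells C (cells C0) f \<delta>\<rbrakk> \<Longrightarrow>
      \<exists>g. continuous_on (cells C) g \<and> g ` cells C \<subseteq> G \<and> (\<forall>x\<in>cells C0. g x = f x) \<and>
        small_on_cells C (cells C) g (\<epsilon> / 2)"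
    \<comment> \<open>Half of \<open>\<delta>\<close> for comparing two prescribed values through a
      common point, half of \<open>\<epsilon>\<close> for the distance from the start of a path to
      \<open>y\<close>.\<close>
    define a where "a = min (\<epsilon> / 2) (\<delta> / 2)"
    have "a > 0" using \<open>\<delta> > 0\<close> \<open>\<epsilon> > 0\<close> by (simp add: a_def)
    have "\<exists>h. continuous_on (nerve W' \<times> {0..1}) h \<and> h ` (nerve W' \<times> {0..1}) \<subseteq> G \<and>
        (\<forall>x\<in>nerve W'. h (x, 0) = g (push p W' x) \<and> h (x, 1) = g' x) \<and>
        (\<forall>x\<in>nerve W'. \<forall>t\<in>{0..1::real}. \<forall>y. (\<forall>V. x V \<noteq> 0 \<longrightarrow> y \<in> V) \<longrightarrow> dist (h (x, t)) y < \<epsilon>)"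
      if fin: "finite W'" and ord: "\<And>y. card {V \<in> W'. y \<in> V} \<le> n + 1"
        and p: "\<And>U. U \<in> W' \<Longrightarrow> p U \<in> W \<and> U \<subseteq> p U"
        and g: "nerve_map W G g a" and g': "nerve_map W' G g' a" for W W' p g g'
    proof -
      define C where "C = {(A, B). A \<subseteq> B \<and> Some -` A \<noteq> {} \<and> Some -` B \<subseteq> W' \<and> (\<exists>y. \<forall>V. Some V \<in> B \<longrightarrow> y \<in> V)}"
      \<comment> \<open>In these cells time is not free but constantly 0 or constantly 1: they make
        up the two ends.\<close>
      define C0 where "C0 = {(A, B). (A, B) \<in> C \<and> (None \<in> B \<longrightarrow> None \<in> A)}"
      define r where "r x = (\<lambda>V. x (Some V) :: real)" for x :: "'e set option \<Rightarrow> real"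
      \<comment> \<open>Any threshold strictly between 0 and 1 would do, since only these two times
        occur on \<open>C0\<close>.\<close>
      define f where "f x = (if x None \<le> 1 / 2 then g (push p W' (r x)) else g' (r x))" for x
      have C: "A \<subseteq> B" "Some -` A \<noteq> {}" "Some -` B \<subseteq> W'" "\<exists>y. \<forall>V. Some V \<in> B \<longrightarrow> y \<in> V"
        "B \<subseteq> insert None (Some ` W')" if "(A, B) \<in> C" for A B
      proof -
        show "A \<subseteq> B" "Some -` A \<noteq> {}" "Some -` B \<subseteq> W'" "\<exists>y. \<forall>V. Some V \<in> B \<longrightarrow> y \<in> V"
          using that unfolding C_def by blast+
        then have "o' \<in> insert None (Some ` W')" if "o' \<in> B" for o'
          using that by (cases o') auto
        then show "B \<subseteq> insert None (Some ` W')"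
          by blast
      qed
      have finS: "finite (insert None (Some ` W'))" using fin by simp
      have finC: "finite C"
      proof (rule finite_subset)
        show "C \<subseteq> Pow (insert None (Some ` W')) \<times> Pow (insert None (Some ` W'))"
        proof
          fix c assume "c \<in> C"
          then show "c \<in> Pow (insert None (Some ` W')) \<times> Pow (insert None (Some ` W'))"
            using C(1,5)[of "fst c" "snd c"] by (cases c) auto
        qed
      qed (use finS in blast)
      have r_nerve: "r x \<in> nerve W'" if x: "x \<in> cube_cell A B" and AB: "(A, B) \<in> C" for x A B
      proof -
        obtain V where "Some V \<in> A" using C(2)[OF AB] by blast
        then have "r x V = 1" using x by (simp add: r_def cube_cell_def)
        moreover obtain y where "\<forall>V. Some V \<in> B \<longrightarrow> y \<in> V" using C(4)[OF AB] by blast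
        then have "\<forall>V. r x V \<noteq> 0 \<longrightarrow> V \<in> W' \<and> y \<in> V"
          using x C(3)[OF AB] unfolding r_def cube_cell_def by blast
        moreover have "\<forall>V. 0 \<le> r x V \<and> r x V \<le> 1"
          using x by (simp add: r_def cube_cell_def)
        ultimately show ?thesis
          unfolding nerve_def by blast
      qed
      have contr: "continuous_on S r" for S
        unfolding r_def by (intro continuous_on_coordinatewise_then_product continuous_on_coordinate)
      \<comment> \<open>At the lower end the members \<open>p U\<close> replace the members
        \<open>U\<close> that they contain, so a common point \<open>y\<close> remains common after
        the projection.\<close>
      have f_near: "dist (f x) y < a" if "r x \<in> nerve W'" "\<And>V. r x V \<noteq> 0 \<Longrightarrow> y \<in> V" for x y
      proof (cases "x None \<le> 1 / 2")
        case True
        have "y \<in> V" if "push p W' (r x) V \<noteq> 0" for V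
          using push_support[OF \<open>r x \<in> nerve W'\<close> that] p \<open>\<And>V. r x V \<noteq> 0 \<Longrightarrow> y \<in> V\<close> by blast
        then show ?thesis
          using g push_in_nerve[OF that(1) fin p] True unfolding nerve_map_def f_def by simp
      next
        case False
        then show ?thesis
          using g' that unfolding nerve_map_def f_def by simp
      qed
      have "\<exists>g. continuous_on (cells C) g \<and> g ` cells C \<subseteq> G \<and> (\<forall>x\<in>cells C0. g x = f x) \<and>
        small_on_cells C (cells C) g (\<epsilon> / 2)"
      proof (rule \<delta>)
        have fcC: "face_closed C"
          unfolding face_closed_def
        proof (intro allI impI)
          fix A B A' B' assume AB: "(A, B) \<in> C" and s: "A \<subseteq> A'" "A' \<subseteq> B'" "B' \<subseteq> B"
          have "Some -` A' \<noteq> {}" "Some -` B' \<subseteq> W'"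
            using C(2,3)[OF AB] s by blast+
          moreover have "\<exists>y. \<forall>V. Some V \<in> B' \<longrightarrow> y \<in> V"
            using C(4)[OF AB] s(3) by (meson subsetD)
          ultimately show "(A', B') \<in> C" using s unfolding C_def by simp
        qed
        have "face_closed C0"
          unfolding face_closed_def
        proof (intro allI impI)
          fix A B A' B' assume AB: "(A, B) \<in> C0" and s: "A \<subseteq> A'" "A' \<subseteq> B'" "B' \<subseteq> B"
          then have "(A', B') \<in> C" "None \<in> B' \<longrightarrow> None \<in> A'"
            using face_closedD[OF fcC, of A B A' B'] by (auto simp: C0_def)
          then show "(A', B') \<in> C0" by (simp add: C0_def)
        qed
        moreover have "finite B \<and> A \<subseteq> B" if "(A, B) \<in> C" for A B
          using C(1,5)[OF that] finite_subset[OF _ finS] by blast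
        moreover have "C0 \<subseteq> C"
          by (auto simp: C0_def)
        ultimately show "cubical_pair C C0"
          using finC fcC unfolding cubical_pair_def by blast
      next
        fix A B assume "(A, B) \<in> C - C0"
        then have AB: "(A, B) \<in> C" and N: "None \<in> B - A" by (auto simp: C0_def)
        have finB: "finite B"
          using C(5)[OF AB] finS finite_subset by blast
        obtain y where y: "\<forall>V. Some V \<in> B \<longrightarrow> y \<in> V" using C(4)[OF AB] by blast
        obtain V0 where V0: "Some V0 \<in> A" using C(2)[OF AB] by blast
        let ?T = "{V \<in> W'. y \<in> V}"
        \<comment> \<open>The critical count: \<open>None\<close> adds a free coordinate and
          \<open>V0 \<in> A\<close> takes one away, which keeps the dimension within
          \<open>n + 1\<close>.\<close>
        have "B - A \<subseteq> insert None (Some ` (?T - {V0}))"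
        proof
          fix o' assume o': "o' \<in> B - A"
          show "o' \<in> insert None (Some ` (?T - {V0}))"
            using o' V0 y C(3)[OF AB] by (cases o') auto
        qed
        then have "card (B - A) \<le> card (insert None (Some ` (?T - {V0})))"
          using fin by (intro card_mono) auto
        also have "\<dots> \<le> Suc (card (?T - {V0}))"
          using fin by (simp add: card_image)
        also have "card (?T - {V0}) = card ?T - 1"
          using fin V0 y C(1,3)[OF AB] by (intro card_Diff_singleton) auto
        finally have "card (B - A) \<le> Suc (card ?T - 1)" .
        moreover have "0 < card (B - A)"
          using N finB by (auto simp: card_gt_0_iff)
        ultimately show "1 \<le> card (B - A) \<and> card (B - A) \<le> n + 1"
          using ord[of y] by simp
      next
        have r0: "r x \<in> nerve W'" if "x \<in> cells C0" for x
          using that r_nerve unfolding cells_def C0_def by blast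
        show "continuous_on (cells C0) f"
          unfolding f_def
        proof (rule continuous_on_cases_le)
          have *: "continuous_on S (\<lambda>x. g (push p W' (r x)))" if "S \<subseteq> cells C0" for S
          proof (rule continuous_on_compose2[of "nerve W" g])
            show "continuous_on (nerve W) g" using g by (simp add: nerve_map_def)
            show "continuous_on S (\<lambda>x. push p W' (r x))"
              by (rule continuous_on_compose2[OF continuous_on_push contr subset_UNIV])
            show "(\<lambda>x. push p W' (r x)) ` S \<subseteq> nerve W"
              using push_in_nerve[OF r0 fin p] that by blast
          qed
          show "continuous_on {x \<in> cells C0. x None \<le> 1 / 2} (\<lambda>x. g (push p W' (r x)))"
            by (rule *) blast
          show "continuous_on {x \<in> cells C0. 1 / 2 \<le> x None} (\<lambda>x. g' (r x))"
          proof (rule continuous_on_compose2[OF _ contr])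
            show "continuous_on (nerve W') g'" using g' by (simp add: nerve_map_def)
          qed (use r0 in blast)
          show "continuous_on (cells C0) (\<lambda>x. x None)"
            by (rule continuous_on_coordinate)
          fix x assume x: "x \<in> cells C0" "x None = 1 / 2"
          then obtain A B where "(A, B) \<in> C" "None \<in> B \<longrightarrow> None \<in> A" "x \<in> cube_cell A B"
            unfolding cells_def C0_def by blast
          then have "x None = 0 \<or> x None = 1"
            by (auto simp: cube_cell_def)
          with x show "g (push p W' (r x)) = g' (r x)" by simp
        qed
        show "f ` cells C0 \<subseteq> G"
        proof
          fix z assume "z \<in> f ` cells C0"
          then obtain x where x: "z = f x" "r x \<in> nerve W'" using r0 by blast
          then show "z \<in> G"
            using g g' push_in_nerve[OF x(2) fin p] by (auto simp: f_def nerve_map_def)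
        qed
        show "small_on_cells C (cells C0) f \<delta>"
          unfolding small_on_cells_def
        proof (intro allI impI)
          fix A B x y
          assume AB: "(A, B) \<in> C" and x: "x \<in> cube_cell A B \<inter> cells C0" and y: "y \<in> cube_cell A B \<inter> cells C0"
          obtain u where u: "\<forall>V. Some V \<in> B \<longrightarrow> u \<in> V" using C(4)[OF AB] by blast
          have near: "dist (f x) u < a" if x: "x \<in> cube_cell A B" for x
          proof (rule f_near[OF r_nerve[OF x AB]])
            fix V assume "r x V \<noteq> 0"
            then show "u \<in> V" using u x by (auto simp: r_def cube_cell_def)
          qed
          have "dist (f x) (f y) \<le> dist (f x) u + dist (f y) u"
            by (rule dist_triangle2)
          also have "\<dots> < a + a"
            using near[of x] near[of y] x y by (intro add_strict_mono) blast+
          also have "\<dots> \<le> \<delta>" by (simp add: a_def)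
          finally show "dist (f x) (f y) < \<delta>" .
        qed
      qed
      then obtain g2 where g2: "continuous_on (cells C) g2" "g2 ` cells C \<subseteq> G" "\<forall>x\<in>cells C0. g2 x = f x"
        "small_on_cells C (cells C) g2 (\<epsilon> / 2)"
        by (elim exE conjE) (rule that)
      define j where "j q = (\<lambda>o'. case o' of None \<Rightarrow> snd q | Some V \<Rightarrow> fst q V)" for q :: "('e set \<Rightarrow> real) \<times> real"
      have rj: "r (j (x, t)) = x" and jN: "j (x, t) None = t" for x t
        by (simp_all add: r_def j_def)
      \<comment> \<open>\<open>(A x, B x)\<close> is the product of the carrier of \<open>x\<close>
        with the time interval. It contains the whole segment above \<open>x\<close>, so smallness
        on cells controls the entire path.\<close>
      define A where "A x = Some ` {V. x V = (1 :: real)}" for x :: "'e set \<Rightarrow> real"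
      define B where "B x = insert None (Some ` {V. x V \<noteq> (0 :: real)})" for x :: "'e set \<Rightarrow> real"
      have AB: "(A x, B x) \<in> C" if x: "x \<in> nerve W'" for x
      proof -
        obtain V y where "x V = 1" "\<forall>V. x V \<noteq> 0 \<longrightarrow> V \<in> W' \<and> y \<in> V"
          using x unfolding nerve_def by blast
        then have "Some -` A x \<noteq> {}" "Some -` B x \<subseteq> W'" "\<forall>V. Some V \<in> B x \<longrightarrow> y \<in> V" "A x \<subseteq> B x"
          by (auto simp: A_def B_def)
        then show ?thesis unfolding C_def by blast
      qed
      have jc: "j (x, t) \<in> cube_cell (A x) (B x)" if "x \<in> nerve W'" "t \<in> {0..1}" for x t
      proof -
        have "0 \<le> j (x, t) o' \<and> j (x, t) o' \<le> 1" for o'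
          using that by (cases o') (auto simp: j_def nerve_def)
        moreover have "j (x, t) o' = 0" if "o' \<notin> B x" for o'
          using that by (cases o') (auto simp: j_def B_def)
        moreover have "j (x, t) o' = 1" if "o' \<in> A x" for o'
          using that by (auto simp: j_def A_def)
        ultimately show ?thesis
          unfolding cube_cell_def by blast
      qed
      have jcells: "j (x, t) \<in> cells C" if "x \<in> nerve W'" "t \<in> {0..1}" for x t
        using jc[OF that] AB[OF that(1)] unfolding in_cells by blast
      have j_end: "j (x, t) \<in> cells C0" if x: "x \<in> nerve W'" and t: "t = 0 \<or> t = 1" for x t
      proof -
        let ?x = "j (x, t)"
        have "t \<in> {0..1}" using t by auto
        have "({i. ?x i = 1}, {i. ?x i \<noteq> 0}) \<in> C"
        proof -
          obtain V y where "x V = 1" "\<forall>V. x V \<noteq> 0 \<longrightarrow> V \<in> W' \<and> y \<in> V"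
            using x unfolding nerve_def by blast
          then have "Some -` {i. ?x i = 1} \<noteq> {}" "Some -` {i. ?x i \<noteq> 0} \<subseteq> W'"
            "\<forall>V. Some V \<in> {i. ?x i \<noteq> 0} \<longrightarrow> y \<in> V" "{i. ?x i = 1} \<subseteq> {i. ?x i \<noteq> 0}"
            by (auto simp: j_def)
          then show ?thesis unfolding C_def by blast
        qed
        then have "({i. ?x i = 1}, {i. ?x i \<noteq> 0}) \<in> C0"
          using t by (auto simp: C0_def jN)
        then show ?thesis
          using cube_cell_support(4)[OF jc[OF x \<open>t \<in> {0..1}\<close>]] unfolding in_cells by blast
      qed
      have contj: "continuous_on S j" for S
      proof (rule continuous_on_coordinatewise_then_product)
        fix o'
        show "continuous_on S (\<lambda>q. j q o')"
        proof (cases o')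
          case None
          then show ?thesis by (simp add: j_def continuous_on_snd)
        next
          case (Some V)
          have "continuous_on S (\<lambda>q. fst q V)"
            by (rule continuous_on_compose2[OF continuous_on_coordinate[of UNIV V] continuous_on_fst[OF continuous_on_id]])
              auto
          then show ?thesis by (simp add: j_def Some)
        qed
      qed
      let ?h = "\<lambda>q. g2 (j q)"
      have "continuous_on (nerve W' \<times> {0..1}) ?h"
        by (rule continuous_on_compose2[OF g2(1) contj]) (use jcells in auto)
      moreover have "?h ` (nerve W' \<times> {0..1}) \<subseteq> G"
        using g2(2) jcells by auto
      moreover have h0: "?h (x, 0) = g (push p W' x)" if "x \<in> nerve W'" for x
        using g2(3) j_end[OF that, of 0] by (simp add: f_def rj jN)
      moreover have "?h (x, 1) = g' x" if "x \<in> nerve W'" for x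
        using g2(3) j_end[OF that, of 1] by (simp add: f_def rj jN)
      moreover have "dist (?h (x, t)) y < \<epsilon>"
        if x: "x \<in> nerve W'" and t: "t \<in> {0..1}" and y: "\<forall>V. x V \<noteq> 0 \<longrightarrow> y \<in> V" for x t y
      proof -
        have z: "(0 :: real) \<in> {0..1}" by simp
        have "dist (?h (x, t)) (?h (x, 0)) < \<epsilon> / 2"
          using g2(4) AB[OF x] jc[OF x t] jc[OF x z] jcells[OF x t] jcells[OF x z]
          unfolding small_on_cells_def by blast
        moreover have "dist (f (j (x, 0))) y < a"
          using f_near[of "j (x, 0)" y] x y by (simp add: rj)
        then have "dist (?h (x, 0)) y < \<epsilon> / 2"
          using g2(3) j_end[OF x, of 0] by (simp add: a_def)
        ultimately show ?thesis
          using dist_triangle_half_r[of "?h (x, 0)" "?h (x, t)" \<epsilon> y] by (simp add: dist_commute)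
      qed
      ultimately show ?thesis
        by (intro exI[of _ ?h]) blast
    qed
    with \<open>a > 0\<close> show thesis
      by (rule that)
  qed
qed

section \<open>Retracting a neighbourhood\<close>

lemma infdist_less_obtains:
  assumes "X \<noteq> {}" "infdist y X < e"
  obtains x where "x \<in> X" "dist y x < e"
  using assms cInf_lessD[of "dist y ` X" e] by (auto simp: infdist_notempty)

lemma le_infdist:
  assumes "A \<noteq> {}" "\<And>a. a \<in> A \<Longrightarrow> d \<le> dist y a"
  shows "d \<le> infdist y A"
  using assms by (simp add: infdist_notempty cINF_greatest)

lemma fine_cover_Lebesgue:
  assumes "fine_cover n X \<mu> W" "compact X" "X \<noteq> {}"
  obtains \<rho> where "\<rho> > 0" "\<And>x. x \<in> X \<Longrightarrow> \<exists>V\<in>W. ball x \<rho> \<subseteq> V"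
proof -
  have W: "X \<subseteq> \<Union>W" "\<forall>V\<in>W. open V"
    using assms(1) unfolding fine_cover_def by blast+
  have "W \<noteq> {}" using W assms(3) by blast
  then show thesis
    using Heine_Borel_lemma[OF assms(2) W(1)] W(2) that by blast
qed

text \<open>Distances to the complements, rescaled and cut off at 1. If \<open>\<rho>\<close> is a
  Lebesgue number, then within \<open>\<rho> / 2\<close> of \<open>X\<close> some member has its
  complement at distance at least \<open>\<rho> / 2\<close>. Its coordinate is therefore 1, and no
  division by a sum or a maximum is required.\<close>

lemma nerve_coordinates:
  fixes X :: "'e::metric_space set"
  assumes W: "fine_cover n X \<mu> W" and X: "compact X" "X \<noteq> {}"
  obtains \<tau> \<phi> where "\<tau> > 0" "continuous_on UNIV \<phi>"
    "\<And>y. infdist y X < \<tau> \<Longrightarrow> \<phi> y \<in> nerve W"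
    "\<And>y V. \<phi> y V \<noteq> 0 \<Longrightarrow> y \<in> V"
proof -
  obtain \<rho> where "\<rho> > 0" and \<rho>: "\<And>x. x \<in> X \<Longrightarrow> \<exists>V\<in>W. ball x \<rho> \<subseteq> V"
    by (rule fine_cover_Lebesgue[OF W X]) blast
  \<comment> \<open>\<open>infdist\<close> to the empty set is 0, so the member \<open>UNIV\<close>
    gets instead a constant large enough to make its coordinate 1.\<close>
  define u where "u V y = (if V = UNIV then \<rho> else infdist y (- V))" for V and y :: 'e
  define \<phi> where "\<phi> y V = (if V \<in> W then min 1 (2 / \<rho> * u V y) else 0)" for y V
  have u0: "0 \<le> u V y" for V y
    using \<open>\<rho> > 0\<close> by (simp add: u_def infdist_nonneg)
  have u_out: "u V y = 0" if "y \<notin> V" for V y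
    using that by (auto simp: u_def)
  have contu: "continuous_on UNIV (u V)" for V
    unfolding u_def by (cases "V = UNIV") (simp_all add: continuous_on_infdist[OF continuous_on_id])
  show thesis
  proof (rule that)
    show "\<rho> / 2 > 0" using \<open>\<rho> > 0\<close> by simp
    show "continuous_on UNIV \<phi>"
    proof (rule continuous_on_coordinatewise_then_product)
      fix V
      show "continuous_on UNIV (\<lambda>y. \<phi> y V)"
        unfolding \<phi>_def using contu \<open>\<rho> > 0\<close> by (cases "V \<in> W") (auto intro!: continuous_intros)
    qed
    show supp: "y \<in> V" if "\<phi> y V \<noteq> 0" for y V
    proof (rule ccontr)
      assume "y \<notin> V"
      then have "\<phi> y V = 0"
        using u_out[of y V] by (simp add: \<phi>_def)
      with that show False by contradiction
    qed
    fix y assume "infdist y X < \<rho> / 2"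
    then obtain x where x: "x \<in> X" "dist y x < \<rho> / 2"
      by (rule infdist_less_obtains[OF X(2)])
    obtain V where V: "V \<in> W" "ball x \<rho> \<subseteq> V"
      using \<rho>[OF x(1)] by blast
    have "\<rho> / 2 \<le> u V y"
    proof (cases "V = UNIV")
      case True
      then show ?thesis using \<open>\<rho> > 0\<close> by (simp add: u_def)
    next
      case False
      have "\<rho> / 2 \<le> dist y a" if "a \<in> - V" for a
      proof -
        have "\<rho> \<le> dist x a" using V(2) that by (force simp: not_less)
        then show ?thesis
          using dist_triangle[of x a y] x(2) by (simp add: dist_commute)
      qed
      then have "\<rho> / 2 \<le> infdist y (- V)"
        using False by (intro le_infdist) auto
      then show ?thesis using False by (simp add: u_def)
    qed
    then have "2 / \<rho> * u V y \<ge> 1"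
      using \<open>\<rho> > 0\<close> by (simp add: field_simps)
    then have "\<phi> y V = 1" using V(1) by (simp add: \<phi>_def)
    moreover have "0 \<le> \<phi> y V \<and> \<phi> y V \<le> 1" for V
      using u0[of V y] \<open>\<rho> > 0\<close> by (simp add: \<phi>_def)
    moreover have "V \<in> W \<and> y \<in> V" if "\<phi> y V \<noteq> 0" for V
      using supp[OF that] that by (auto simp: \<phi>_def split: if_splits)
    ultimately show "\<phi> y \<in> nerve W"
      unfolding nerve_def by blast
  qed
qed

text \<open>A straight segment would leave the set where the maximum is 1. Here one of the two
  factors is always 1: the coordinates of \<open>z\<close> are raised while \<open>x\<close> stays
  at full height, then those of \<open>x\<close> are lowered.\<close>

definition blend :: "('v \<Rightarrow> real) \<Rightarrow> ('v \<Rightarrow> real) \<Rightarrow> real \<Rightarrow> 'v \<Rightarrow> real" where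
  "blend x z s V = max (min 1 (2 - 2 * s) * x V) (min 1 (2 * s) * z V)"

lemma blend_in_nerve:
  assumes x: "x \<in> nerve W" and z: "z \<in> nerve W" and s: "s \<in> {0..1}"
    and y: "\<And>V. x V \<noteq> 0 \<Longrightarrow> y \<in> V" "\<And>V. z V \<noteq> 0 \<Longrightarrow> y \<in> V"
  shows "blend x z s \<in> nerve W" "blend x z s V \<noteq> 0 \<Longrightarrow> y \<in> V"
proof -
  have x': "\<And>V. 0 \<le> x V \<and> x V \<le> 1" "\<exists>V. x V = 1" "\<And>V. x V \<noteq> 0 \<Longrightarrow> V \<in> W"
    and z': "\<And>V. 0 \<le> z V \<and> z V \<le> 1" "\<exists>V. z V = 1" "\<And>V. z V \<noteq> 0 \<Longrightarrow> V \<in> W"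
    using x z unfolding nerve_def by blast+
  have b01: "0 \<le> blend x z s V \<and> blend x z s V \<le> 1" for V
  proof -
    have "0 \<le> min 1 (2 - 2 * s) * x V" "min 1 (2 - 2 * s) * x V \<le> 1 * 1"
      "0 \<le> min 1 (2 * s) * z V" "min 1 (2 * s) * z V \<le> 1 * 1"
      using x'(1)[of V] z'(1)[of V] s by (intro mult_nonneg_nonneg mult_mono; simp)+
    then show ?thesis by (simp add: blend_def)
  qed
  have supp: "V \<in> W \<and> y \<in> V" if "blend x z s V \<noteq> 0" for V
  proof -
    have "x V \<noteq> 0 \<or> z V \<noteq> 0"
      using that by (auto simp: blend_def)
    then show ?thesis using x'(3) z'(3) y by blast
  qed
  then show "blend x z s V \<noteq> 0 \<Longrightarrow> y \<in> V" by blast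
  have "\<exists>V. blend x z s V = 1"
  proof (cases "s \<le> 1 / 2")
    case True
    obtain V where "x V = 1" using x'(2) by blast
    with True have "1 \<le> blend x z s V" by (simp add: blend_def)
    with b01[of V] show ?thesis by (intro exI[of _ V]) simp
  next
    case False
    obtain V where "z V = 1" using z'(2) by blast
    with False have "1 \<le> blend x z s V" by (simp add: blend_def)
    with b01[of V] show ?thesis by (intro exI[of _ V]) simp
  qed
  then show "blend x z s \<in> nerve W"
    using b01 supp unfolding nerve_def by blast
qed

text \<open>The values \<open>\<phi> y\<close> and \<open>push p W' (\<phi>' y)\<close> differ in
  general, but both are carried by members containing \<open>y\<close>, so \<open>blend\<close>
  joins them inside the nerve of \<open>W\<close>. After that \<open>h\<close> takes over. Both
  halves stay close to \<open>y\<close> because \<open>y\<close> is a common point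
  throughout.\<close>

lemma nerve_map_transition:
  fixes D G :: "'e::metric_space set"
  assumes \<phi>: "continuous_on D \<phi>" "\<And>y. y \<in> D \<Longrightarrow> \<phi> y \<in> nerve W" "\<And>y V. y \<in> D \<Longrightarrow> \<phi> y V \<noteq> 0 \<Longrightarrow> y \<in> V"
    and \<phi>': "continuous_on D \<phi>'" "\<And>y. y \<in> D \<Longrightarrow> \<phi>' y \<in> nerve W'" "\<And>y V. y \<in> D \<Longrightarrow> \<phi>' y V \<noteq> 0 \<Longrightarrow> y \<in> V"
    and fin: "finite W'" and p: "\<And>U. U \<in> W' \<Longrightarrow> p U \<in> W \<and> U \<subseteq> p U"
    and g: "nerve_map W G g \<epsilon>"
    and h: "continuous_on (nerve W' \<times> {0..1}) h" "h ` (nerve W' \<times> {0..1}) \<subseteq> G"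
      "\<And>x. x \<in> nerve W' \<Longrightarrow> h (x, 0) = g (push p W' x) \<and> h (x, 1) = g' x"
      "\<And>x t y. \<lbrakk>x \<in> nerve W'; t \<in> {0..1}; \<And>V. x V \<noteq> 0 \<Longrightarrow> y \<in> V\<rbrakk> \<Longrightarrow> dist (h (x, t :: real)) y < \<epsilon>"
  obtains R where "continuous_on (D \<times> {0..1}) R" "R ` (D \<times> {0..1}) \<subseteq> G"
    "\<And>y. y \<in> D \<Longrightarrow> R (y, 0) = g (\<phi> y) \<and> R (y, 1) = g' (\<phi>' y)"
    "\<And>y t. y \<in> D \<Longrightarrow> t \<in> {0..1::real} \<Longrightarrow> dist (R (y, t)) y < \<epsilon>"
proof -
  \<comment> \<open>At double speed the blending arrives at \<open>push p W' (\<phi>' y)\<close> at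
    time 1/2, exactly where \<open>h\<close> starts.\<close>
  define b where "b q = blend (\<phi> (fst q)) (push p W' (\<phi>' (fst q))) (2 * snd q)" for q :: "'e \<times> real"
  define R where "R q = (if snd q \<le> 1 / 2 then g (b q) else h (\<phi>' (fst q), 2 * snd q - 1))" for q :: "'e \<times> real"
  have push_supp: "y \<in> V" if "y \<in> D" "push p W' (\<phi>' y) V \<noteq> 0" for y V
    using push_support[OF \<phi>'(2)[OF that(1)] that(2)] p \<phi>'(3)[OF that(1)] by blast
  have push_nerve: "push p W' (\<phi>' y) \<in> nerve W" if "y \<in> D" for y
    by (rule push_in_nerve[OF \<phi>'(2)[OF that] fin p])
  have b: "b (y, t) \<in> nerve W" "\<And>V. b (y, t) V \<noteq> 0 \<Longrightarrow> y \<in> V" if "y \<in> D" "t \<in> {0..1/2}" for y t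
  proof -
    have t: "2 * t \<in> {0..1}" using that(2) by simp
    note * = blend_in_nerve[OF \<phi>(2)[OF that(1)] push_nerve[OF that(1)] t \<phi>(3)[OF that(1)] push_supp[OF that(1)]]
    show "b (y, t) \<in> nerve W" using *(1) by (simp add: b_def)
    show "\<And>V. b (y, t) V \<noteq> 0 \<Longrightarrow> y \<in> V" using *(2) by (simp add: b_def)
  qed
  have R1: "R (y, t) \<in> G \<and> dist (R (y, t)) y < \<epsilon>" if "y \<in> D" "t \<in> {0..1}" for y t
  proof (cases "t \<le> 1 / 2")
    case True
    then have t: "t \<in> {0..1/2}" using that(2) by simp
    then show ?thesis
      using b[OF that(1) t] g True by (auto simp: R_def nerve_map_def)
  next
    case False
    then have t: "2 * t - 1 \<in> {0..1}" using that(2) by simp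
    have "h (\<phi>' y, 2 * t - 1) \<in> G"
      using h(2) \<phi>'(2)[OF that(1)] t by blast
    moreover have "dist (h (\<phi>' y, 2 * t - 1)) y < \<epsilon>"
      using h(4)[OF \<phi>'(2)[OF that(1)] t \<phi>'(3)[OF that(1)]] by blast
    ultimately show ?thesis using False by (simp add: R_def)
  qed
  show thesis
  proof (rule that[of R])
    show "continuous_on (D \<times> {0..1}) R"
      unfolding R_def
    proof (rule continuous_on_cases_le)
      let ?S = "{q \<in> D \<times> {0..1}. snd q \<le> (1 / 2 :: real)}"
      have "?S \<subseteq> D \<times> UNIV" by auto
      then have cf: "continuous_on ?S (\<lambda>q. \<phi> (fst q))" "continuous_on ?S (\<lambda>q. \<phi>' (fst q))"
        by (auto intro!: continuous_on_compose2[OF \<phi>(1)] continuous_on_compose2[OF \<phi>'(1)] continuous_on_fst continuous_on_id)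
      have cp: "continuous_on ?S (\<lambda>q. push p W' (\<phi>' (fst q)))"
        by (rule continuous_on_compose2[OF continuous_on_push cf(2) subset_UNIV])
      have "continuous_on ?S b"
      proof (rule continuous_on_coordinatewise_then_product)
        fix V
        have "continuous_on ?S (\<lambda>q. \<phi> (fst q) V)" "continuous_on ?S (\<lambda>q. push p W' (\<phi>' (fst q)) V)"
          using continuous_on_compose2[OF continuous_on_coordinate[of UNIV V] cf(1) subset_UNIV]
            continuous_on_compose2[OF continuous_on_coordinate[of UNIV V] cp subset_UNIV] by simp_all
        then show "continuous_on ?S (\<lambda>q. b q V)"
          unfolding b_def blend_def by (intro continuous_intros)
      qed
      then show "continuous_on ?S (\<lambda>q. g (b q))"
      proof (rule continuous_on_compose2[rotated])
        show "continuous_on (nerve W) g" using g by (simp add: nerve_map_def)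
      qed (use b in auto)
      let ?T = "{q \<in> D \<times> {0..1}. (1 / 2 :: real) \<le> snd q}"
      have "?T \<subseteq> D \<times> UNIV" by auto
      then have "continuous_on ?T (\<lambda>q. \<phi>' (fst q))"
        by (auto intro!: continuous_on_compose2[OF \<phi>'(1)] continuous_on_fst continuous_on_id)
      then have "continuous_on ?T (\<lambda>q. (\<phi>' (fst q), 2 * snd q - 1))"
        by (rule continuous_on_Pair) (intro continuous_intros)
      then show "continuous_on ?T (\<lambda>q. h (\<phi>' (fst q), 2 * snd q - 1))"
        by (rule continuous_on_compose2[OF h(1)]) (use \<phi>'(2) in auto)
      show "continuous_on (D \<times> {0..1}) (\<lambda>q. snd q)"
        by (intro continuous_intros)
      fix q assume q: "q \<in> D \<times> {0..1::real}" "snd q = 1 / 2"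
      then have "2 * snd q = 1" "fst q \<in> D" by auto
      then have "b q = push p W' (\<phi>' (fst q))"
        using push_nerve[of "fst q"] by (auto simp: b_def blend_def fun_eq_iff nerve_def)
      moreover have "2 * snd q - 1 = 0"
        using q(2) by simp
      ultimately show "g (b q) = h (\<phi>' (fst q), 2 * snd q - 1)"
        using h(3)[OF \<phi>'(2)[OF \<open>fst q \<in> D\<close>]] by simp
    qed
    show "R ` (D \<times> {0..1}) \<subseteq> G" using R1 by auto
    show "dist (R (y, t)) y < \<epsilon>" if "y \<in> D" "t \<in> {0..1}" for y t
      using R1[OF that] by blast
    show "R (y, 0) = g (\<phi> y) \<and> R (y, 1) = g' (\<phi>' y)" if "y \<in> D" for y
    proof -
      have "b (y, 0) = \<phi> y"
        using \<phi>(2)[OF that] by (auto simp: b_def blend_def fun_eq_iff nerve_def)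
      then show ?thesis
        using h(3)[OF \<phi>'(2)[OF that]] by (simp add: R_def)
    qed
  qed
qed

section \<open>Approximate retractions and their limit\<close>

text \<open>A mesh below a Lebesgue number \<open>\<rho>\<close> of the previous cover forces
  refinement: each new member meets \<open>X\<close> and hence lies in a \<open>\<rho>\<close>-ball
  around a point of \<open>X\<close>.\<close>

lemma refining_covers:
  fixes X :: "'e::metric_space set"
  assumes X: "compact X" "X \<noteq> {}" and cov: "\<And>\<mu>. \<mu> > 0 \<Longrightarrow> \<exists>W. fine_cover n X \<mu> W"
    and \<mu>: "\<And>k. \<mu> k > 0"
  obtains W p where "\<And>k. fine_cover n X (\<mu> k) (W k)"
    "\<And>k U. U \<in> W (Suc k) \<Longrightarrow> p k U \<in> W k \<and> U \<subseteq> p k U"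
proof -
  have "\<exists>W. \<forall>k. fine_cover n X (\<mu> k) (W k) \<and> (\<forall>U\<in>W (Suc k). \<exists>V\<in>W k. U \<subseteq> V)"
  proof (rule dependent_nat_choice)
    show "\<exists>W. fine_cover n X (\<mu> 0) W" using cov \<mu> by blast
    fix W k assume "fine_cover n X (\<mu> k) W"
    then obtain \<rho> where "\<rho> > 0" and \<rho>: "\<And>x. x \<in> X \<Longrightarrow> \<exists>V\<in>W. ball x \<rho> \<subseteq> V"
      by (rule fine_cover_Lebesgue[OF _ X]) blast
    then obtain W' where W': "fine_cover n X (min (\<mu> (Suc k)) \<rho>) W'"
      using cov[of "min (\<mu> (Suc k)) \<rho>"] \<mu> by auto
    have "fine_cover n X (\<mu> (Suc k)) W'"
      using W' unfolding fine_cover_def by simp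
    moreover have "\<exists>V\<in>W. U \<subseteq> V" if "U \<in> W'" for U
    proof -
      obtain x where x: "x \<in> U" "x \<in> X"
        using W' \<open>U \<in> W'\<close> unfolding fine_cover_def by blast
      have "U \<subseteq> ball x \<rho>"
        using W' \<open>U \<in> W'\<close> x(1) unfolding fine_cover_def by auto
      then show ?thesis
        using \<rho>[OF x(2)] by blast
    qed
    ultimately show "\<exists>W'. fine_cover n X (\<mu> (Suc k)) W' \<and> (\<forall>U\<in>W'. \<exists>V\<in>W. U \<subseteq> V)"
      by blast
  qed
  then obtain W where W: "\<And>k. fine_cover n X (\<mu> k) (W k)" "\<And>k U. U \<in> W (Suc k) \<Longrightarrow> \<exists>V\<in>W k. U \<subseteq> V"
    by blast
  define p where "p k U = (SOME V. V \<in> W k \<and> U \<subseteq> V)" for k U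
  have "p k U \<in> W k \<and> U \<subseteq> p k U" if "U \<in> W (Suc k)" for k U
    unfolding p_def by (rule someI_ex) (use W(2)[OF that] in blast)
  with W(1) show thesis by (rule that)
qed

text \<open>\<open>R k\<close> moves the approximate retraction through the nerve of stage
  \<open>k\<close> to that of stage \<open>k + 1\<close>. The last property lets consecutive
  homotopies be concatenated; the shrinking distance bound will give continuity at
  \<open>X\<close>.\<close>

lemma approximate_retraction_sequence:
  fixes X G :: "'e::metric_space set"
  assumes X: "compact X" "X \<noteq> {}" and G: "uniformly_LC n G" and XG: "X \<subseteq> closure G"
    and cov: "\<And>\<mu>. \<mu> > 0 \<Longrightarrow> \<exists>W. fine_cover n X \<mu> W"
  obtains \<tau> R where "\<And>k. \<tau> k > 0"
    "\<And>k. continuous_on ({y. infdist y X < \<tau> k} \<times> {0..1}) (R k)"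
    "\<And>k. R k ` ({y. infdist y X < \<tau> k} \<times> {0..1}) \<subseteq> G"
    "\<And>k y t. infdist y X < \<tau> k \<Longrightarrow> t \<in> {0..1::real} \<Longrightarrow> dist (R k (y, t)) y < 1 / real (Suc k)"
    "\<And>k y. infdist y X < \<tau> k \<Longrightarrow> infdist y X < \<tau> (Suc k) \<Longrightarrow> R k (y, 1) = R (Suc k) (y, 0)"
proof -
  define good where "good k a \<longleftrightarrow> a > 0 \<and> (\<forall>W W' p g g'. finite W' \<longrightarrow> (\<forall>y. card {V \<in> W'. y \<in> V} \<le> n + 1) \<longrightarrow>
      (\<forall>U. U \<in> W' \<longrightarrow> p U \<in> W \<and> U \<subseteq> p U) \<longrightarrow> nerve_map W G g a \<longrightarrow> nerve_map W' G g' a \<longrightarrow>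
      (\<exists>h. continuous_on (nerve W' \<times> {0..1}) h \<and> h ` (nerve W' \<times> {0..1}) \<subseteq> G \<and>
        (\<forall>x\<in>nerve W'. h (x, 0) = g (push p W' x) \<and> h (x, 1) = g' x) \<and>
        (\<forall>x\<in>nerve W'. \<forall>t\<in>{0..1::real}. \<forall>y. (\<forall>V. x V \<noteq> 0 \<longrightarrow> y \<in> V) \<longrightarrow> dist (h (x, t)) y < 1 / real (Suc k))))"
    for k a
  have "\<exists>a. good k a" for k
  proof -
    have "1 / real (Suc k) > 0" by simp
    then show ?thesis
    proof (rule exists_nerve_homotopy[OF G])
      fix a :: real
      assume "a > 0" and a: "\<And>W W' p g g'. \<lbrakk>finite W'; \<And>y. card {V \<in> W'. y \<in> V} \<le> n + 1;
        \<And>U. U \<in> W' \<Longrightarrow> p U \<in> W \<and> U \<subseteq> p U; nerve_map W G g a; nerve_map W' G g' a\<rbrakk> \<Longrightarrow>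
        \<exists>h. continuous_on (nerve W' \<times> {0..1}) h \<and> h ` (nerve W' \<times> {0..1}) \<subseteq> G \<and>
        (\<forall>x\<in>nerve W'. h (x, 0) = g (push p W' x) \<and> h (x, 1) = g' x) \<and>
        (\<forall>x\<in>nerve W'. \<forall>t\<in>{0..1::real}. \<forall>y. (\<forall>V. x V \<noteq> 0 \<longrightarrow> y \<in> V) \<longrightarrow> dist (h (x, t)) y < 1 / real (Suc k))"
      have "good k a"
        unfolding good_def
      proof (intro conjI allI impI \<open>a > 0\<close>, goal_cases)
        case (1 W W' p g g')
        show ?case
          by (rule a[of W' p W g g']) (use 1 in blast)+
      qed
      then show ?thesis by blast
    qed
  qed
  then obtain \<alpha> where \<alpha>: "\<And>k. good k (\<alpha> k)" by metis
  have \<alpha>0: "\<alpha> k > 0" for k using \<alpha>[of k] by (simp add: good_def)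
  \<comment> \<open>The nerve map of stage \<open>k\<close> is an end of the homotopies number
    \<open>k - 1\<close> and \<open>k\<close> and must meet both tolerances \<open>\<alpha>\<close>.
    The bound \<open>1 / real (Suc k)\<close> serves the blending half of the transition, which
    takes place under \<open>g k\<close> alone.\<close>
  define b where "b k = min (1 / real (Suc k)) (Min (\<alpha> ` {..k}))" for k
  have b0: "b k > 0" for k
    using \<alpha>0 by (simp add: b_def)
  have b\<alpha>: "b k \<le> \<alpha> k" "b (Suc k) \<le> \<alpha> k" "b k \<le> 1 / real (Suc k)" for k
    by (auto simp: b_def min.coboundedI2)
  have "\<exists>\<mu>>0. \<forall>W. fine_cover n X \<mu> W \<longrightarrow> (\<exists>g. nerve_map W G g (b k))" for k
    by (rule exists_nerve_map[OF G XG b0[of k]]) blast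
  then obtain \<mu> where \<mu>: "\<And>k. \<mu> k > 0" "\<And>k W. fine_cover n X (\<mu> k) W \<Longrightarrow> \<exists>g. nerve_map W G g (b k)"
    by metis
  have "\<exists>W p. (\<forall>k. fine_cover n X (\<mu> k) (W k)) \<and> (\<forall>k. \<forall>U\<in>W (Suc k). p k U \<in> W k \<and> U \<subseteq> p k U)"
    by (rule refining_covers[where \<mu> = \<mu>, OF X cov \<mu>(1)]) blast+
  then obtain W p where W: "\<And>k. fine_cover n X (\<mu> k) (W k)"
    and p: "\<And>k U. U \<in> W (Suc k) \<Longrightarrow> p k U \<in> W k \<and> U \<subseteq> p k U"
    by blast
  have finW: "finite (W k)" and ordW: "card {V \<in> W k. y \<in> V} \<le> n + 1" for k y
    using W[of k] unfolding fine_cover_def by blast+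
  have "\<exists>g. nerve_map (W k) G g (b k)" for k
    using \<mu>(2) W by blast
  then obtain g where g: "\<And>k. nerve_map (W k) G (g k) (b k)"
    by metis
  define cs where "cs k \<tau> \<phi> \<longleftrightarrow> \<tau> > 0 \<and> continuous_on UNIV \<phi> \<and> (\<forall>y. infdist y X < \<tau> \<longrightarrow> \<phi> y \<in> nerve (W k)) \<and>
     (\<forall>y V. \<phi> y V \<noteq> 0 \<longrightarrow> y \<in> V)" for k \<tau> \<phi>
  have "\<exists>\<tau> \<phi>. cs k \<tau> \<phi>" for k
    unfolding cs_def by (rule nerve_coordinates[OF W[of k] X]) blast
  then obtain \<sigma> \<phi> where cs: "\<And>k. cs k (\<sigma> k) (\<phi> k)" by metis
  have \<sigma>0: "\<sigma> k > 0" and cont\<phi>: "continuous_on UNIV (\<phi> k)"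
    and \<phi>n: "infdist y X < \<sigma> k \<Longrightarrow> \<phi> k y \<in> nerve (W k)" and \<phi>s: "\<phi> k y V \<noteq> 0 \<Longrightarrow> y \<in> V" for k y V
    using cs[of k] unfolding cs_def by blast+
  \<comment> \<open>On the domain of \<open>R k\<close> the coordinate maps of both stages,
    \<open>k\<close> and \<open>k + 1\<close>, must take values in their nerves.\<close>
  define \<tau> where "\<tau> k = min (\<sigma> k) (\<sigma> (Suc k))" for k
  have step: "\<exists>R. continuous_on ({y. infdist y X < \<tau> k} \<times> {0..1}) R \<and> R ` ({y. infdist y X < \<tau> k} \<times> {0..1}) \<subseteq> G \<and>
      (\<forall>y. infdist y X < \<tau> k \<longrightarrow> R (y, 0) = g k (\<phi> k y) \<and> R (y, 1) = g (Suc k) (\<phi> (Suc k) y)) \<and>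
      (\<forall>y t. infdist y X < \<tau> k \<longrightarrow> t \<in> {0..1::real} \<longrightarrow> dist (R (y, t)) y < 1 / real (Suc k))" for k
  proof -
    let ?D = "{y. infdist y X < \<tau> k}"
    have gk: "nerve_map (W k) G (g k) (\<alpha> k)" "nerve_map (W (Suc k)) G (g (Suc k)) (\<alpha> k)"
      using nerve_map_mono[OF g] b\<alpha> by blast+
    have "\<forall>U. U \<in> W (Suc k) \<longrightarrow> p k U \<in> W k \<and> U \<subseteq> p k U"
      using p by blast
    from \<alpha>[of k, unfolded good_def, THEN conjunct2, THEN spec, THEN spec, THEN spec, THEN spec, THEN spec,
        THEN mp, OF finW[of "Suc k"], THEN mp, OF allI[OF ordW], THEN mp, OF this, THEN mp, OF gk(1), THEN mp, OF gk(2)]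
    obtain h where h: "continuous_on (nerve (W (Suc k)) \<times> {0..1}) h" "h ` (nerve (W (Suc k)) \<times> {0..1}) \<subseteq> G"
      "\<forall>x\<in>nerve (W (Suc k)). h (x, 0) = g k (push (p k) (W (Suc k)) x) \<and> h (x, 1) = g (Suc k) x"
      "\<forall>x\<in>nerve (W (Suc k)). \<forall>t\<in>{0..1::real}. \<forall>y. (\<forall>V. x V \<noteq> 0 \<longrightarrow> y \<in> V) \<longrightarrow> dist (h (x, t)) y < 1 / real (Suc k)"
      by (elim exE conjE) (rule that)
    have gk': "nerve_map (W k) G (g k) (1 / real (Suc k))"
      using nerve_map_mono[OF g b\<alpha>(3)] .
    have c1: "continuous_on ?D (\<phi> k)" and c2: "continuous_on ?D (\<phi> (Suc k))"
      using cont\<phi> continuous_on_subset by blast+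
    have n1: "\<phi> k y \<in> nerve (W k)" and n2: "\<phi> (Suc k) y \<in> nerve (W (Suc k))" if "y \<in> ?D" for y
      using that \<phi>n by (auto simp: \<tau>_def)
    have h3: "h (x, 0) = g k (push (p k) (W (Suc k)) x) \<and> h (x, 1) = g (Suc k) x" if "x \<in> nerve (W (Suc k))" for x
      using h(3) that by blast
    have h4: "dist (h (x, t)) y < 1 / real (Suc k)"
      if "x \<in> nerve (W (Suc k))" "t \<in> {0..1}" "\<And>V. x V \<noteq> 0 \<Longrightarrow> y \<in> V" for x t y
      using h(4) that by blast
    have "\<exists>R. continuous_on (?D \<times> {0..1}) R \<and> R ` (?D \<times> {0..1}) \<subseteq> G \<and>
      (\<forall>y\<in>?D. R (y, 0) = g k (\<phi> k y) \<and> R (y, 1) = g (Suc k) (\<phi> (Suc k) y)) \<and>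
      (\<forall>y\<in>?D. \<forall>t\<in>{0..1::real}. dist (R (y, t)) y < 1 / real (Suc k))"
      by (rule nerve_map_transition[OF c1 n1 \<phi>s c2 n2 \<phi>s finW p gk' h(1,2) h3 h4]) blast+
    then show ?thesis by blast
  qed
  then obtain R where R: "\<And>k. continuous_on ({y. infdist y X < \<tau> k} \<times> {0..1}) (R k)"
      "\<And>k. R k ` ({y. infdist y X < \<tau> k} \<times> {0..1}) \<subseteq> G"
      "\<And>k y. infdist y X < \<tau> k \<Longrightarrow> R k (y, 0) = g k (\<phi> k y) \<and> R k (y, 1) = g (Suc k) (\<phi> (Suc k) y)"
      "\<And>k y t. infdist y X < \<tau> k \<Longrightarrow> t \<in> {0..1::real} \<Longrightarrow> dist (R k (y, t)) y < 1 / real (Suc k)"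
    by metis
  show thesis
  proof (rule that[of \<tau> R])
    show "\<tau> k > 0" for k using \<sigma>0 by (simp add: \<tau>_def)
    show "R k (y, 1) = R (Suc k) (y, 0)" if "infdist y X < \<tau> k" "infdist y X < \<tau> (Suc k)" for k y
      using R(3)[OF that(1)] R(3)[OF that(2)] by simp
  qed (fact R)+
qed

text \<open>Distance to \<open>X\<close> plays the role of time: \<open>R k\<close> is run on the
  shell between the distances \<open>s k\<close> and \<open>s (Suc k)\<close>. Infinitely many
  shells accumulate at \<open>X\<close>, so continuity there needs an estimate in place of
  pasting.\<close>

lemma neighbourhood_retraction:
  fixes X G :: "'e::metric_space set"
  assumes X: "compact X" "X \<noteq> {}" and GX: "G \<subseteq> X" and G: "uniformly_LC n G" and XG: "X \<subseteq> closure G"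
    and cov: "\<And>\<mu>. \<mu> > 0 \<Longrightarrow> \<exists>W. fine_cover n X \<mu> W"
  obtains N r where "open N" "X \<subseteq> N" "continuous_on N r" "r ` N \<subseteq> X" "\<And>x. x \<in> X \<Longrightarrow> r x = x"
    "r ` (N - X) \<subseteq> G"
proof (rule approximate_retraction_sequence[OF X G XG cov])
  fix \<tau> :: "nat \<Rightarrow> real" and R
  assume \<tau>: "\<And>k. \<tau> k > 0"
    and contR: "\<And>k. continuous_on ({y. infdist y X < \<tau> k} \<times> {0..1}) (R k)"
    and RG: "\<And>k. R k ` ({y. infdist y X < \<tau> k} \<times> {0..1}) \<subseteq> G"
    and Rnear: "\<And>k y t. infdist y X < \<tau> k \<Longrightarrow> t \<in> {0..1::real} \<Longrightarrow> dist (R k (y, t)) y < 1 / real (Suc k)"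
    and Rmatch: "\<And>k y. infdist y X < \<tau> k \<Longrightarrow> infdist y X < \<tau> (Suc k) \<Longrightarrow> R k (y, 1) = R (Suc k) (y, 0)"
  \<comment> \<open>The minimum puts \<open>s k\<close> below all earlier \<open>\<tau>\<close>, and
    the growing divisor makes \<open>s\<close> strictly decreasing with limit 0. Since the divisor
    is at least 2, \<open>s k < \<tau> k\<close> is strict even for \<open>k = 0\<close>, and the
    closed shells stay in the domains of the \<open>R k\<close>.\<close>
  define s where "s k = Min (\<tau> ` {..k}) / real (k + 2)" for k
  have Min0: "Min (\<tau> ` {..k}) > 0" and Min_le: "Min (\<tau> ` {..k}) \<le> \<tau> i" if "i \<le> k" for k i
    using \<tau> that by auto
  have s0: "s k > 0" for k
    using Min0[of k k] by (simp add: s_def)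
  have s_\<tau>: "s k < \<tau> k" for k
  proof -
    have "x / real (k + 2) < x" if "x > 0" for x :: real
      using that by (simp add: field_simps add_pos_nonneg)
    from this[OF Min0[of k k]] have "s k < Min (\<tau> ` {..k})"
      by (simp only: s_def)
    then show ?thesis using Min_le[of k k] by simp
  qed
  have s_Suc: "s (Suc k) < s k" for k
  proof -
    have "Min (\<tau> ` {..Suc k}) \<le> Min (\<tau> ` {..k})"
      by (intro Min_antimono) auto
    then have "s (Suc k) \<le> Min (\<tau> ` {..k}) / real (Suc k + 2)"
      unfolding s_def by (intro divide_right_mono) auto
    also have "\<dots> < s k"
      using Min0[of k k] unfolding s_def by (intro divide_strict_left_mono) auto
    finally show ?thesis .
  qed
  have s_mono: "s l \<le> s k" if "k \<le> l" for k l
    using that by (rule lift_Suc_antimono_le[of s, rotated]) (use s_Suc in \<open>auto intro: less_imp_le\<close>)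
  have s_lim: "\<exists>m. s m < e" if "e > 0" for e
  proof -
    obtain m where m: "\<tau> 0 / e < real m"
      using reals_Archimedean2 by blast
    have "s m \<le> \<tau> 0 / real (m + 2)"
      unfolding s_def using Min_le[of 0 m] by (intro divide_right_mono) auto
    also have "\<dots> < e"
      using m \<open>e > 0\<close> by (simp add: field_simps)
    finally show ?thesis by blast
  qed
  have clX: "closed X" using X(1) by (rule compact_imp_closed)
  have pos: "infdist y X > 0" if "y \<notin> X" for y
    using infdist_pos_not_in_closed[OF clX X(2) that] .
  \<comment> \<open>\<open>K y\<close> numbers the shell of \<open>y\<close>, choosing the outer one
    on a common boundary. \<open>T\<close> runs from 0 on the outer boundary of a shell to 1 on the
    inner one.\<close>
  define K where "K y = (LEAST k. s (Suc k) \<le> infdist y X)" for y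
  define T where "T k y = (s k - infdist y X) / (s k - s (Suc k))" for k y
  define r where "r y = (if y \<in> X then y else R (K y) (y, T (K y) y))" for y
  have T01: "T k y \<in> {0..1}" if "s (Suc k) \<le> infdist y X" "infdist y X \<le> s k" for k y
    using that s_Suc[of k] by (simp add: T_def)
  have K_eq: "K y = k" if "s (Suc k) \<le> infdist y X" "infdist y X < s k" for k y
    unfolding K_def
  proof (rule Least_equality)
    fix l assume "s (Suc l) \<le> infdist y X"
    then have "s (Suc l) < s k" using that(2) by simp
    then show "k \<le> l"
      using s_mono[of "Suc l" k] by (meson not_le not_less_eq_eq)
  qed (fact that(1))
  \<comment> \<open>If \<open>infdist y X = s k\<close> with \<open>k > 0\<close>, then
    \<open>K\<close> selects the preceding shell; \<open>Rmatch\<close> makes the two formulas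
    agree.\<close>
  have r_eq: "r y = R k (y, T k y)" if y: "s (Suc k) \<le> infdist y X" "infdist y X \<le> s k" for k y
  proof -
    have "y \<notin> X"
      using y(1) s0[of "Suc k"] by (metis infdist_zero not_le)
    show ?thesis
    proof (cases "infdist y X = s k")
      case False
      then show ?thesis using K_eq[of k y] y \<open>y \<notin> X\<close> by (simp add: r_def)
    next
      case True
      show ?thesis
      proof (cases k)
        case 0
        have "K y = 0"
          unfolding K_def using y(1) 0 by (intro Least_equality) auto
        then show ?thesis using 0 \<open>y \<notin> X\<close> by (simp add: r_def)
      next
        case (Suc l)
        have "K y = l"
          using True Suc s_Suc[of l] by (intro K_eq) auto
        moreover have "T l y = 1" "T k y = 0"
          using True Suc s_Suc[of l] by (simp_all add: T_def)
        moreover have "R l (y, 1) = R k (y, 0)"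
          using True Suc s_Suc[of l] s_\<tau>[of l] s_\<tau>[of k] Rmatch[of y l] by simp
        ultimately show ?thesis using \<open>y \<notin> X\<close> by (simp add: r_def)
      qed
    qed
  qed
  have K_ex: "\<exists>k. s (Suc k) \<le> infdist y X \<and> infdist y X \<le> s k" if y: "y \<notin> X" "infdist y X < s 0" for y
  proof -
    obtain m where "s m < infdist y X"
      using s_lim[OF pos[OF y(1)]] by blast
    then have "s (Suc m) \<le> infdist y X" using s_Suc[of m] by simp
    then have K: "s (Suc (K y)) \<le> infdist y X"
      unfolding K_def by (rule LeastI)
    moreover have "infdist y X \<le> s (K y)"
    proof (cases "K y")
      case 0
      then show ?thesis using y(2) by simp
    next
      case (Suc l)
      then have "\<not> s (Suc l) \<le> infdist y X"
        unfolding K_def by (intro not_less_Least) simp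
      then show ?thesis using Suc by simp
    qed
    ultimately show ?thesis by blast
  qed
  have contT: "continuous_on S (T k)" for S k
    unfolding T_def using s_Suc[of k]
    by (intro continuous_intros continuous_on_infdist continuous_on_id) auto
  have cont_E: "continuous_on {y. s (Suc k) \<le> infdist y X \<and> infdist y X \<le> s k} r" (is "continuous_on ?E r") for k
  proof -
    have "continuous_on ?E (\<lambda>y. R k (y, T k y))"
    proof (rule continuous_on_compose2[OF contR[of k]])
      show "continuous_on ?E (\<lambda>y. (y, T k y))"
        by (intro continuous_on_Pair continuous_on_id contT)
      show "(\<lambda>y. (y, T k y)) ` ?E \<subseteq> {y. infdist y X < \<tau> k} \<times> {0..1}"
      proof
        fix z assume "z \<in> (\<lambda>y. (y, T k y)) ` ?E"
        then obtain y where "z = (y, T k y)" "s (Suc k) \<le> infdist y X" "infdist y X \<le> s k"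
          by blast
        then show "z \<in> {y. infdist y X < \<tau> k} \<times> {0..1}"
          using T01[of k y] s_\<tau>[of k] by simp
      qed
    qed
    then show ?thesis
      by (rule continuous_on_eq) (use r_eq in auto)
  qed
  define N where "N = {y. infdist y X < s 0}"
  have r_near: "r y \<in> G \<and> dist (r y) y < 1 / real (Suc m)" if y: "y \<notin> X" "infdist y X < s m" for y m
  proof -
    have "infdist y X < s 0" using y(2) s_mono[of 0 m] by simp
    then obtain k where k: "s (Suc k) \<le> infdist y X" "infdist y X \<le> s k"
      using K_ex[OF y(1)] by blast
    have "s (Suc k) < s m" using k(1) y(2) by simp
    then have "m \<le> k"
      using s_mono[of "Suc k" m] by (meson not_le not_less_eq_eq)
    have \<tau>k: "infdist y X < \<tau> k" using k(2) s_\<tau>[of k] by simp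
    have "dist (r y) y < 1 / real (Suc k)"
      using Rnear[OF \<tau>k T01[OF k]] r_eq[OF k] by simp
    also have "\<dots> \<le> 1 / real (Suc m)"
      using \<open>m \<le> k\<close> by (simp add: field_simps)
    finally have "dist (r y) y < 1 / real (Suc m)" .
    moreover have "r y \<in> G"
      using RG[of k] \<tau>k T01[OF k] r_eq[OF k] by (simp add: image_subset_iff)
    ultimately show ?thesis by blast
  qed
  have rX: "r x = x" if "x \<in> X" for x using that by (simp add: r_def)
  show thesis
  proof (rule that[of N r])
    show "open N"
      unfolding N_def by (intro open_Collect_less continuous_intros continuous_on_infdist continuous_on_id)
    show "X \<subseteq> N" using s0 by (auto simp: N_def)
    show rG: "r ` (N - X) \<subseteq> G"
      using r_near[of _ 0] by (auto simp: N_def)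
    show "r ` N \<subseteq> X"
      using rG GX rX by (auto simp: image_subset_iff)
    show "\<And>x. x \<in> X \<Longrightarrow> r x = x" by (rule rX)
    have "isCont r y" if "y \<in> N" for y
    proof (cases "y \<in> X")
      case False
      obtain m where m: "s m < infdist y X"
        using s_lim[OF pos[OF False]] by blast
      let ?O = "{y. s m < infdist y X} \<inter> N"
      have "open {y. s m < infdist y X}"
        by (intro open_Collect_less continuous_intros continuous_on_infdist continuous_on_id)
      then have "open ?O" using \<open>open N\<close> by blast
      \<comment> \<open>Away from \<open>X\<close> only finitely many closed shells are involved, so
        they can be pasted.\<close>
      have "continuous_on (\<Union>k\<in>{..m}. {y. s (Suc k) \<le> infdist y X \<and> infdist y X \<le> s k}) r"
      proof (rule continuous_on_closed_Union)
        fix k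
        show "closed {y. s (Suc k) \<le> infdist y X \<and> infdist y X \<le> s k}"
          by (intro closed_Collect_conj closed_Collect_le continuous_intros continuous_on_infdist continuous_on_id)
      qed (use cont_E in auto)
      moreover have "?O \<subseteq> (\<Union>k\<in>{..m}. {y. s (Suc k) \<le> infdist y X \<and> infdist y X \<le> s k})"
      proof
        fix z assume z: "z \<in> ?O"
        then have "z \<notin> X" using s0[of m] by auto
        then obtain k where k: "s (Suc k) \<le> infdist z X" "infdist z X \<le> s k"
          using K_ex[of z] z by (auto simp: N_def)
        then have "s m < s k" using z by simp
        then have "k \<le> m" using s_mono[of m k] by (meson not_le nat_le_linear)
        with k show "z \<in> (\<Union>k\<in>{..m}. {y. s (Suc k) \<le> infdist y X \<and> infdist y X \<le> s k})" by blast
      qed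
      ultimately have "continuous_on ?O r"
        using continuous_on_subset by blast
      then show ?thesis
        using \<open>open ?O\<close> m \<open>y \<in> N\<close> by (simp add: continuous_on_eq_continuous_at)
    next
      case True
      show ?thesis
        unfolding continuous_at_eps_delta
      proof (intro allI impI)
        fix e :: real assume "e > 0"
        obtain m where m: "1 / real (Suc m) < e / 2"
          using reals_Archimedean[of "e / 2"] \<open>e > 0\<close> by (auto simp: inverse_eq_divide)
        show "\<exists>d>0. \<forall>z. dist z y < d \<longrightarrow> dist (r z) (r y) < e"
        proof (intro exI[of _ "min (e / 2) (s m)"] conjI allI impI)
          show "0 < min (e / 2) (s m)" using \<open>e > 0\<close> s0 by simp
          fix z assume z: "dist z y < min (e / 2) (s m)"
          show "dist (r z) (r y) < e"
          proof (cases "z \<in> X")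
            case True
            then show ?thesis using z \<open>y \<in> X\<close> \<open>e > 0\<close> by (simp add: rX)
          next
            case False
            have "infdist z X < s m"
              using infdist_le[OF \<open>y \<in> X\<close>, of z] z by simp
            then have "dist (r z) z < e / 2"
              using r_near[OF False] m by fastforce
            then show ?thesis
              using dist_triangle[of "r z" y z] z rX[OF \<open>y \<in> X\<close>] by simp
          qed
        qed
      qed
    qed
    then show "continuous_on N r"
      by (simp add: continuous_at_imp_continuous_on)
  qed
qed

section \<open>Ambient covers and uniform local connectivity\<close>

text \<open>Covering dimension yields sets that are open in \<open>S\<close> only. The points
  strictly nearer to \<open>S\<close> than to \<open>S - V\<close> form the classical extension of
  \<open>V\<close> to an open set of the ambient metric space; cutting down to a thin neighbourhood
  of \<open>S\<close> controls the mesh.\<close>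

lemma fine_cover_of_relative_cover:
  fixes S :: "'e::metric_space set"
  assumes S: "compact S" "S \<noteq> {}" and "\<mu> > 0" and fin: "finite \<V>"
    and op: "\<And>V. V \<in> \<V> \<Longrightarrow> openin (top_of_set S) V" and ne: "\<And>V. V \<in> \<V> \<Longrightarrow> V \<noteq> {}"
    and cov: "S \<subseteq> \<Union>\<V>" and mesh: "\<And>V x y. V \<in> \<V> \<Longrightarrow> x \<in> V \<Longrightarrow> y \<in> V \<Longrightarrow> dist x y < \<mu> / 2"
    and ord: "\<And>x. x \<in> S \<Longrightarrow> card {V \<in> \<V>. x \<in> V} \<le> n + 1"
  shows "\<exists>W. fine_cover n S \<mu> W"
proof -
  \<comment> \<open>The case \<open>S \<subseteq> V\<close> is separate because
    \<open>infdist\<close> to the empty set is 0. Two projections to \<open>S\<close>, each shorter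
    than \<open>\<mu> / 4\<close>, and the relative mesh \<open>\<mu> / 2\<close> add up to
    \<open>\<mu>\<close>.\<close>
  define E where "E V = {y. (S \<subseteq> V \<or> infdist y S < infdist y (S - V)) \<and> infdist y S < \<mu> / 4}" for V
  have sub: "V \<subseteq> S" if "V \<in> \<V>" for V
    using openin_subset[OF op[OF that]] by simp
  have "\<exists>x\<in>S. \<forall>x'\<in>S. dist y x \<le> dist y x'" for y
    by (rule continuous_attains_inf[OF S continuous_on_dist[OF continuous_on_const continuous_on_id]])
  then obtain q where q: "\<And>y. q y \<in> S" "\<And>y x. x \<in> S \<Longrightarrow> dist y (q y) \<le> dist y x"
    by metis
  have q_le: "dist y (q y) \<le> infdist y S" for y
    using q S(2) by (intro le_infdist) auto
  text \<open>Every nearest point of \<open>y\<close> in \<open>S\<close> lies in all members \<open>V\<close> with \<open>y \<in> E V\<close>, so \<open>E\<close>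
    does not increase the order of the cover.\<close>
  have qV: "q y \<in> V" if "y \<in> E V" for y V
  proof (rule ccontr)
    assume "q y \<notin> V"
    then have "infdist y (S - V) \<le> dist y (q y)" "\<not> S \<subseteq> V"
      using q(1)[of y] by (auto intro: infdist_le)
    then show False
      using that q_le[of y] by (auto simp: E_def)
  qed
  have VE: "V \<subseteq> E V" if "V \<in> \<V>" for V
  proof
    fix x assume x: "x \<in> V"
    then have "x \<in> S" using sub[OF that] by blast
    moreover have "0 < infdist x (S - V)" if "\<not> S \<subseteq> V"
    proof (rule infdist_pos_not_in_closed)
      have "closedin (top_of_set S) (S - V)"
        using op[OF \<open>V \<in> \<V>\<close>] by (simp add: closedin_diff)
      then show "closed (S - V)"
        using closedin_closed_trans compact_imp_closed[OF S(1)] by blast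
    qed (use that x in auto)
    ultimately show "x \<in> E V"
      using \<open>\<mu> > 0\<close> by (auto simp: E_def)
  qed
  have "open (E V)" for V
  proof -
    have "open {y. infdist y S < infdist y (S - V)}" "open {y. infdist y S < \<mu> / 4}"
      by (intro open_Collect_less continuous_intros continuous_on_infdist continuous_on_id)+
    moreover have "E V = (if S \<subseteq> V then UNIV else {y. infdist y S < infdist y (S - V)}) \<inter> {y. infdist y S < \<mu> / 4}"
      by (auto simp: E_def)
    ultimately show ?thesis by auto
  qed
  moreover have "dist x y < \<mu>" if "V \<in> \<V>" "x \<in> E V" "y \<in> E V" for V x y
  proof -
    have "dist (q x) (q y) < \<mu> / 2"
      using mesh[OF that(1)] qV that by blast
    moreover have "dist x (q x) < \<mu> / 4" "dist y (q y) < \<mu> / 4"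
      using q_le[of x] q_le[of y] that by (auto simp: E_def)
    moreover have "dist x y \<le> dist x (q x) + dist (q x) (q y) + dist y (q y)"
      using dist_triangle[of x y "q x"] dist_triangle[of "q x" y "q y"] by (simp add: dist_commute)
    ultimately show ?thesis by linarith
  qed
  moreover have "card {w \<in> E ` \<V>. y \<in> w} \<le> n + 1" for y
  proof -
    have "{w \<in> E ` \<V>. y \<in> w} \<subseteq> E ` {V \<in> \<V>. q y \<in> V}"
      using qV by blast
    then have "card {w \<in> E ` \<V>. y \<in> w} \<le> card (E ` {V \<in> \<V>. q y \<in> V})"
      using fin by (intro card_mono) auto
    also have "\<dots> \<le> card {V \<in> \<V>. q y \<in> V}"
      using fin by (intro card_image_le) auto
    also have "\<dots> \<le> n + 1" by (rule ord[OF q(1)])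
    finally show ?thesis .
  qed
  moreover have "S \<subseteq> \<Union>(E ` \<V>)"
    using cov VE by blast
  moreover have "E V \<inter> S \<noteq> {}" if "V \<in> \<V>" for V
    using VE[OF that] ne[OF that] sub[OF that] by blast
  ultimately have "fine_cover n S \<mu> (E ` \<V>)"
    using fin unfolding fine_cover_def by auto
  then show ?thesis by blast
qed

text \<open>A Lebesgue number argument. The local condition is demanded at all points of the compact
  set \<open>S\<close>, also at those outside \<open>G\<close>, because small spheres in
  \<open>G\<close> may accumulate there.\<close>

lemma uniformly_LC_from_local:
  fixes S G :: "'e::metric_space set"
  assumes S: "compact S" "G \<subseteq> S"
    and loc: "\<And>x \<epsilon>. x \<in> S \<Longrightarrow> \<epsilon> > 0 \<Longrightarrow> \<exists>\<delta>>0. \<forall>m\<le>n. \<forall>f.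
       continuous_map (nsphere m) (top_of_set (G \<inter> ball x \<delta>)) f \<longrightarrow>
       (\<exists>c. homotopic_with (\<lambda>_. True) (nsphere m) (top_of_set (G \<inter> ball x \<epsilon>)) f (\<lambda>_. c))"
  shows "uniformly_LC n G"
  unfolding uniformly_LC_def
proof (intro allI impI)
  fix \<epsilon> :: real assume "\<epsilon> > 0"
  then have "\<epsilon> / 2 > 0" by simp
  define P where "P x \<delta> \<longleftrightarrow> \<delta> > 0 \<and> (\<forall>m\<le>n. \<forall>f.
       continuous_map (nsphere m) (top_of_set (G \<inter> ball x \<delta>)) f \<longrightarrow>
       (\<exists>c. homotopic_with (\<lambda>_. True) (nsphere m) (top_of_set (G \<inter> ball x (\<epsilon> / 2))) f (\<lambda>_. c)))" for x \<delta>
  have "\<exists>\<delta>. P x \<delta>" if "x \<in> S" for x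
    using loc[OF that \<open>\<epsilon> / 2 > 0\<close>] unfolding P_def by blast
  then obtain \<delta> where \<delta>: "\<And>x. x \<in> S \<Longrightarrow> P x (\<delta> x)" by metis
  \<comment> \<open>\<open>\<delta> x\<close> makes the nullhomotopy available;
    \<open>\<epsilon> / 2\<close> keeps the values of \<open>f\<close> within
    \<open>\<epsilon>\<close> of everything in \<open>ball x (\<epsilon> / 2)\<close>, where the
    nullhomotopy takes place.\<close>
  let ?B = "(\<lambda>x. ball x (min (\<delta> x) (\<epsilon> / 2))) ` S"
  have "x \<in> \<Union>?B" if "x \<in> S" for x
  proof (rule UnionI)
    show "ball x (min (\<delta> x) (\<epsilon> / 2)) \<in> ?B" using that by blast
    show "x \<in> ball x (min (\<delta> x) (\<epsilon> / 2))"
      using \<delta>[OF that] \<open>\<epsilon> > 0\<close> by (simp add: P_def)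
  qed
  then have cov: "S \<subseteq> \<Union>?B" by blast
  have op: "open b" if "b \<in> ?B" for b using that by auto
  obtain \<rho> where "\<rho> > 0" and \<rho>: "\<And>x. x \<in> S \<Longrightarrow> \<exists>b\<in>?B. ball x \<rho> \<subseteq> b"
    by (rule Heine_Borel_lemma[OF S(1) cov op]) blast+
  show "\<exists>\<delta>>0. \<forall>m\<le>n. \<forall>f.
        continuous_map (nsphere m) (top_of_set G) f \<and>
        (\<forall>u\<in>topspace (nsphere m). \<forall>v\<in>topspace (nsphere m). dist (f u) (f v) < \<delta>) \<longrightarrow>
        (\<exists>c. homotopic_with (\<lambda>_. True) (nsphere m)
               (top_of_set {y \<in> G. \<forall>v\<in>topspace (nsphere m). dist y (f v) < \<epsilon>}) f (\<lambda>_. c))"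
  proof (intro exI[of _ \<rho>] conjI allI impI \<open>\<rho> > 0\<close>, elim conjE)
    fix m f assume "m \<le> n" and f: "continuous_map (nsphere m) (top_of_set G) f"
      and small: "\<forall>u\<in>topspace (nsphere m). \<forall>v\<in>topspace (nsphere m). dist (f u) (f v) < \<rho>"
    obtain u0 where u0: "u0 \<in> topspace (nsphere m)" using in_topspace_nsphere by blast
    have fG: "f u \<in> G" if "u \<in> topspace (nsphere m)" for u
      using f that by (auto simp: continuous_map_in_subtopology)
    then have "f u0 \<in> S" using u0 S(2) by blast
    then obtain x where x: "x \<in> S" "ball (f u0) \<rho> \<subseteq> ball x (min (\<delta> x) (\<epsilon> / 2))"
      using \<rho> by blast
    have fb: "f u \<in> ball x (min (\<delta> x) (\<epsilon> / 2))" if "u \<in> topspace (nsphere m)" for u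
      using small u0 that x(2) by (metis mem_ball subsetD)
    then have "continuous_map (nsphere m) (top_of_set (G \<inter> ball x (\<delta> x))) f"
      using f fG by (auto simp: continuous_map_in_subtopology)
    then obtain c where c: "homotopic_with (\<lambda>_. True) (nsphere m) (top_of_set (G \<inter> ball x (\<epsilon> / 2))) f (\<lambda>_. c)"
      using \<delta>[OF x(1)] \<open>m \<le> n\<close> unfolding P_def by blast
    have "dist y (f v) < \<epsilon>" if "y \<in> ball x (\<epsilon> / 2)" "v \<in> topspace (nsphere m)" for y v
      using fb[OF that(2)] that(1) dist_triangle_half_r[of x y \<epsilon> "f v"] by simp
    then have "continuous_map (top_of_set (G \<inter> ball x (\<epsilon> / 2)))
        (top_of_set {y \<in> G. \<forall>v\<in>topspace (nsphere m). dist y (f v) < \<epsilon>}) id"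
      by auto
    from homotopic_with_compose_continuous_map_left[OF c this, of "\<lambda>_. True"]
    have "homotopic_with (\<lambda>_. True) (nsphere m)
        (top_of_set {y \<in> G. \<forall>v\<in>topspace (nsphere m). dist y (f v) < \<epsilon>}) f (\<lambda>_. c)"
      by (simp add: o_def)
    then show "\<exists>c. homotopic_with (\<lambda>_. True) (nsphere m)
               (top_of_set {y \<in> G. \<forall>v\<in>topspace (nsphere m). dist y (f v) < \<epsilon>}) f (\<lambda>_. c)"
      by blast
  qed
qed

section \<open>Compact metrizable spaces\<close>

text \<open>Distances to a countable dense set separate points. Coordinate 0 is left vacant, so that
  changing it moves any point off the image; \<open>Z_set_of_retraction\<close> relies on
  this.\<close>

lemma compact_metrizable_embedding:
  fixes X :: "'a topology"
  assumes "compact_space X" "metrizable_space X"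
  obtains j :: "'a \<Rightarrow> nat \<Rightarrow> real" where "continuous_map X euclidean j" "inj_on j (topspace X)" "\<And>x. j x 0 = 0"
proof -
  obtain M d where "Metric_space M d" and X: "X = Metric_space.mtopology M d"
    using assms(2) by (auto simp: metrizable_space_def)
  interpret Metric_space M d by fact
  have top: "topspace X = M" by (simp add: X)
  show thesis
  proof (cases "M = {}")
    case True
    then show thesis
      using that[of "\<lambda>_ _. 0"] by (simp add: top)
  next
    case False
    have "mtotally_bounded M"
      using assms(1) by (intro compactin_imp_mtotally_bounded) (simp add: compact_space_def X)
    then have "\<exists>K. finite K \<and> K \<subseteq> M \<and> M \<subseteq> (\<Union>x\<in>K. mball x (1 / real (Suc k)))" for k
      unfolding mtotally_bounded_def by (elim allE[of _ "1 / real (Suc k)"]) simp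
    then obtain K where K: "\<And>k. finite (K k)" "\<And>k. K k \<subseteq> M" "\<And>k. M \<subseteq> (\<Union>x\<in>K k. mball x (1 / real (Suc k)))"
      by metis
    define C where "C = (\<Union>k. K k)"
    have "countable C" using K(1) by (auto simp: C_def intro: countable_finite)
    have "C \<noteq> {}" using K(3)[of 0] False by (auto simp: C_def)
    define c where "c = from_nat_into C"
    have cM: "c i \<in> M" for i
      using from_nat_into[OF \<open>C \<noteq> {}\<close>, of i] K(2) by (auto simp: c_def C_def)
    define j where "j x = (\<lambda>i. if i = 0 then 0 else d (c (i - 1)) x)" for x
    have contd: "continuous_map X euclideanreal (d a)" if "a \<in> M" for a
      using continuous_on_mdist[of a "metric (M, d)"] that by (simp add: mtopology_of_def X)
    show thesis
    proof (rule that)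
      have "continuous_map X euclideanreal (\<lambda>x. j x i)" for i
        using contd[OF cM, of "i - 1"] by (cases "i = 0") (simp_all add: j_def)
      then show "continuous_map X euclidean j"
        by (simp add: continuous_map_componentwise_UNIV flip: euclidean_product_topology)
      show "inj_on j (topspace X)"
        unfolding top
      proof (rule inj_onI, rule ccontr)
        fix x y assume xy: "x \<in> M" "y \<in> M" "j x = j y" "x \<noteq> y"
        then have "d x y / 2 > 0" by simp
        then obtain k where k: "1 / real (Suc k) < d x y / 2"
          using reals_Archimedean[of "d x y / 2"] by (auto simp: inverse_eq_divide)
        obtain a where a: "a \<in> K k" "d a x < 1 / real (Suc k)"
          using K(3)[of k] xy(1) by (auto simp: in_mball)
        then have "a \<in> C" by (auto simp: C_def)
        then obtain i where i: "c i = a"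
          using from_nat_into_surj[OF \<open>countable C\<close>] by (auto simp: c_def)
        have "d a x = d a y"
          using fun_cong[OF xy(3), of "Suc i"] i by (simp add: j_def)
        moreover have "d x y \<le> d x a + d a y"
          using xy a(1) K(2)[of k] by (intro triangle) auto
        ultimately show False
          using k a(2) by (simp add: commute)
      qed
      show "\<And>x. j x 0 = 0" by (simp add: j_def)
    qed
  qed
qed

text \<open>Dimension and local connectivity enter the argument only here. Everything after it is
  drawn from \<open>r\<close> and from the fact that \<open>r\<close> sends the points of
  \<open>N\<close> outside the image of \<open>X\<close> into \<open>X - Z\<close>.\<close>

lemma neighbourhood_retraction_off_Z:
  fixes X :: "'a topology" and Z :: "'a set" and n :: nat
  assumes cX: "compact_space X" and mX: "metrizable_space X" and dimX: "covering_dim_le X n"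
    and clZ: "closedin X Z" and ndZ: "nowhere_dense_in X Z"
    and LCC: "LCC n X Z" and LC: "LC n (subtopology X (topspace X - Z))"
  obtains j :: "'a \<Rightarrow> nat \<Rightarrow> real" and N r where
    "continuous_map X euclidean j" "\<And>x. j x 0 = 0" "open N" "j ` topspace X \<subseteq> N"
    "continuous_map (top_of_set N) X r" "\<And>x. x \<in> topspace X \<Longrightarrow> r (j x) = x"
    "\<And>y. y \<in> N - j ` topspace X \<Longrightarrow> r y \<in> topspace X - Z"
proof -
  obtain j :: "'a \<Rightarrow> nat \<Rightarrow> real" where contj: "continuous_map X euclidean j"
    and injj: "inj_on j (topspace X)" and j0: "\<And>x. j x 0 = 0"
    by (rule compact_metrizable_embedding[OF cX mX]) blast
  let ?M = "topspace X"
  define S where "S = j ` ?M"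
  define G where "G = j ` (?M - Z)"
  show thesis
  proof (cases "?M = {}")
    case True
    \<comment> \<open>A nonempty neighbourhood cannot be mapped into an empty \<open>X\<close>, so
      \<open>N\<close> is empty too.\<close>
    have "continuous_map (top_of_set {}) X (\<lambda>_ :: nat \<Rightarrow> real. undefined)"
      by simp
    then show thesis
      using contj j0 by (intro that[of j "{}"]) (simp_all add: True)
  next
    case False
    have compS: "compact S"
      using image_compactin[OF _ contj, of ?M] cX by (simp add: S_def compact_space_def)
    have "S \<noteq> {}" using False by (simp add: S_def)
    have contjS: "continuous_map X (top_of_set S) j"
      using contj by (auto simp: continuous_map_in_subtopology S_def)
    have homj: "homeomorphic_map X (top_of_set S) j"
      using contjS cX injj by (intro continuous_imp_homeomorphic_map) (simp_all add: Hausdorff_space_subtopology S_def)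
    then obtain k where "homeomorphic_maps X (top_of_set S) j k"
      using homeomorphic_map_maps by blast
    then have contk: "continuous_map (top_of_set S) X k" and kj: "\<And>x. x \<in> ?M \<Longrightarrow> k (j x) = x"
      and jk: "\<And>y. y \<in> S \<Longrightarrow> j (k y) = y"
      by (simp_all add: homeomorphic_maps_def)
    have opS: "openin (top_of_set S) (j ` V)" if "openin X V" for V
      using homeomorphic_imp_open_map[OF homj] that by (simp add: open_map_def)
    have GS: "G \<subseteq> S" by (auto simp: G_def S_def)
    \<comment> \<open>Nowhere density makes \<open>X - Z\<close> dense, which later puts points of
      \<open>G\<close> into all members of the covers.\<close>
    have "X closure_of (?M - Z) = ?M"
      using ndZ clZ by (simp add: nowhere_dense_in_def closure_of_complement closure_of_closedin)
    then have SG: "S \<subseteq> closure G"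
      using continuous_map_image_closure_subset[OF contj, of "?M - Z"] by (simp add: S_def G_def)
    have cov: "\<exists>W. fine_cover n S \<mu> W" if "\<mu> > 0" for \<mu>
    proof -
      have "S \<subseteq> (\<Union>s\<in>S. ball s (\<mu> / 4))"
        using \<open>\<mu> > 0\<close> by force
      then obtain F where F: "F \<subseteq> S" "finite F" "S \<subseteq> (\<Union>s\<in>F. ball s (\<mu> / 4))"
        by (rule compactE_image[OF compS open_ball])
      \<comment> \<open>Radius \<open>\<mu> / 4\<close> gives mesh below \<open>\<mu> / 2\<close>;
        the rest of \<open>\<mu>\<close> is spent on passing to ambient open sets. The refinement
        may contain the empty set, which meets nothing and is discarded below.\<close>
      define \<U> where "\<U> = (\<lambda>s. {x \<in> ?M. j x \<in> ball s (\<mu> / 4)}) ` F"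
      have "openin X U" if "U \<in> \<U>" for U
        using that openin_continuous_map_preimage[OF contj, of "ball _ (\<mu> / 4)"]
        unfolding \<U>_def by (auto simp del: mem_ball)
      moreover have "\<Union>\<U> = ?M"
        using F(3) by (fastforce simp: \<U>_def S_def)
      moreover have "finite \<U>" using F(2) by (simp add: \<U>_def)
      ultimately have "finite \<U> \<and> (\<forall>U\<in>\<U>. openin X U) \<and> \<Union>\<U> = ?M" by blast
      from dimX[unfolded covering_dim_le_def, THEN spec, THEN mp, OF this]
      obtain \<V> where \<V>: "finite \<V>" "\<forall>V\<in>\<V>. openin X V" "\<Union>\<V> = ?M" "\<forall>V\<in>\<V>. \<exists>U\<in>\<U>. V \<subseteq> U"
        "\<forall>x\<in>?M. card {V \<in> \<V>. x \<in> V} \<le> n + 1"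
        by (elim exE conjE) (rule that)
      have VM: "V \<subseteq> ?M" if "V \<in> \<V>" for V using \<V>(3) that by blast
      show ?thesis
      proof (rule fine_cover_of_relative_cover[OF compS \<open>S \<noteq> {}\<close> \<open>\<mu> > 0\<close>, of "(`) j ` (\<V> - {{}})"])
        show "finite ((`) j ` (\<V> - {{}}))" using \<V>(1) by simp
        show "S \<subseteq> \<Union>((`) j ` (\<V> - {{}}))"
        proof
          fix y assume "y \<in> S"
          then obtain x where "y = j x" "x \<in> \<Union>\<V>"
            unfolding S_def \<V>(3) by blast
          then show "y \<in> \<Union>((`) j ` (\<V> - {{}}))" by blast
        qed
        show "card {V \<in> (`) j ` (\<V> - {{}}). y \<in> V} \<le> n + 1" if "y \<in> S" for y
        proof -
          obtain x where x: "x \<in> ?M" "y = j x" using \<open>y \<in> S\<close> by (auto simp: S_def)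
          have "{V \<in> (`) j ` (\<V> - {{}}). y \<in> V} \<subseteq> (`) j ` {V \<in> \<V>. x \<in> V}"
          proof
            fix w assume "w \<in> {V \<in> (`) j ` (\<V> - {{}}). y \<in> V}"
            then have "\<exists>V. w = j ` V \<and> V \<in> \<V>" "y \<in> w" by auto
            then obtain V where V: "w = j ` V" "V \<in> \<V>"
              by (elim exE conjE) (rule that)
            have "j x \<in> j ` V" using \<open>y \<in> w\<close> x(2) V(1) by simp
            then have "x \<in> V"
              using inj_on_image_mem_iff[OF injj x(1) VM[OF V(2)]] by blast
            with V show "w \<in> (`) j ` {V \<in> \<V>. x \<in> V}" by (intro image_eqI[of _ _ V]) simp_all
          qed
          then have "card {V \<in> (`) j ` (\<V> - {{}}). y \<in> V} \<le> card ((`) j ` {V \<in> \<V>. x \<in> V})"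
            using \<V>(1) by (intro card_mono) auto
          also have "\<dots> \<le> card {V \<in> \<V>. x \<in> V}"
            using \<V>(1) by (intro card_image_le) auto
          also have "\<dots> \<le> n + 1" using \<V>(5) x(1) by blast
          finally show ?thesis .
        qed
        fix V' assume "V' \<in> (`) j ` (\<V> - {{}})"
        then obtain V where V: "V' = j ` V" "V \<in> \<V>" "V \<noteq> {}" by blast
        then show "openin (top_of_set S) V'" "V' \<noteq> {}" using opS \<V>(2) by auto
        fix x y assume "x \<in> V'" "y \<in> V'"
        moreover obtain s where "V' \<subseteq> ball s (\<mu> / 4)"
          using \<V>(4) V by (fastforce simp: \<U>_def)
        ultimately have "dist s x < \<mu> / 4" "dist s y < \<mu> / 4" by auto
        then show "dist x y < \<mu> / 2"
          using dist_triangle3[of x y s] by simp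
      qed
    qed
    \<comment> \<open>Both local hypotheses in one form, valid at every point of \<open>X\<close>:
      at points of \<open>Z\<close> it is \<open>LCC\<close>; at the others the neighbourhood is
      first shrunk into the open set \<open>X - Z\<close>, where \<open>LC\<close> applies.\<close>
    have loc: "\<exists>V. openin X V \<and> x \<in> V \<and> V \<subseteq> U \<and> inclusion_pi_trivial n X (V - Z) (U - Z)"
      if "x \<in> ?M" "openin X U" "x \<in> U" for x U
    proof (cases "x \<in> Z")
      case True
      then show ?thesis using LCC that unfolding LCC_def by blast
    next
      case False
      let ?Y = "subtopology X (?M - Z)"
      have opM: "openin X (?M - Z)" using clZ by (simp add: openin_diff)
      have "openin ?Y (U - Z)"
        using that(2) openin_subset[OF that(2)] by (auto simp: openin_subtopology intro!: exI[of _ U])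
      moreover have "x \<in> topspace ?Y" "x \<in> U - Z" using that False by auto
      ultimately obtain V where V: "openin ?Y V" "x \<in> V" "V \<subseteq> U - Z" "inclusion_pi_trivial n ?Y V (U - Z)"
        using LC unfolding LC_def by blast
      have "openin X V" using openin_trans_full[OF V(1) opM] .
      moreover have "V - Z = V" "(?M - Z) \<inter> V = V" "(?M - Z) \<inter> (U - Z) = U - Z"
        using V(3) openin_subset[OF V(1)] openin_subset[OF that(2)] by auto
      then have "inclusion_pi_trivial n X (V - Z) (U - Z)"
        using V(4) by (simp add: inclusion_pi_trivial_def subtopology_subtopology)
      ultimately show ?thesis using V by blast
    qed
    have ULC: "uniformly_LC n G"
    proof (rule uniformly_LC_from_local[OF compS GS])
      fix y and \<epsilon> :: real assume "y \<in> S" "\<epsilon> > 0"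
      then obtain x where x: "x \<in> ?M" "y = j x" by (auto simp: S_def)
      define U where "U = {x' \<in> ?M. j x' \<in> ball y \<epsilon>}"
      have "openin X U"
        unfolding U_def by (rule openin_continuous_map_preimage[OF contj]) simp
      moreover have "x \<in> U" using x \<open>\<epsilon> > 0\<close> by (simp add: U_def)
      ultimately obtain V where V: "openin X V" "x \<in> V" "V \<subseteq> U" "inclusion_pi_trivial n X (V - Z) (U - Z)"
        using loc[OF x(1)] by blast
      obtain O' where O': "open O'" "j ` V = S \<inter> O'"
        using opS[OF V(1)] by (auto simp: openin_open)
      then have "y \<in> O'" using x V(2) by blast
      then obtain \<delta> where "\<delta> > 0" "ball y \<delta> \<subseteq> O'"
        using O'(1) open_contains_ball by blast
      show "\<exists>\<delta>>0. \<forall>m\<le>n. \<forall>f.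
       continuous_map (nsphere m) (top_of_set (G \<inter> ball y \<delta>)) f \<longrightarrow>
       (\<exists>c. homotopic_with (\<lambda>_. True) (nsphere m) (top_of_set (G \<inter> ball y \<epsilon>)) f (\<lambda>_. c))"
      proof (intro exI[of _ \<delta>] conjI allI impI \<open>\<delta> > 0\<close>)
        fix m f assume "m \<le> n" and f: "continuous_map (nsphere m) (top_of_set (G \<inter> ball y \<delta>)) f"
        have fim: "f u \<in> G \<inter> ball y \<delta>" if "u \<in> topspace (nsphere m)" for u
          using f that by (auto simp: continuous_map_in_subtopology)
        have kf: "k (f u) \<in> V - Z" if "u \<in> topspace (nsphere m)" for u
        proof -
          have fu: "f u \<in> G" "f u \<in> S \<inter> O'"
            using fim[OF that] GS \<open>ball y \<delta> \<subseteq> O'\<close> by auto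
          obtain a where "f u = j a" "a \<in> ?M - Z"
            using fu(1) unfolding G_def by blast
          moreover obtain b where "f u = j b" "b \<in> V"
            using fu(2) unfolding O'(2)[symmetric] by blast
          ultimately show ?thesis
            using kj openin_subset[OF V(1)] by (metis DiffD1 DiffD2 DiffI subsetD)
        qed
        have fS: "continuous_map (nsphere m) (top_of_set S) f"
          using f fim GS by (auto simp: continuous_map_in_subtopology)
        then have "continuous_map (nsphere m) X (k \<circ> f)"
          using contk continuous_map_compose by blast
        then have "continuous_map (nsphere m) (subtopology X (V - Z)) (k \<circ> f)"
          using kf by (auto simp: continuous_map_in_subtopology)
        then obtain c where c: "homotopic_with (\<lambda>_. True) (nsphere m) (subtopology X (U - Z)) (k \<circ> f) (\<lambda>_. c)"
          using V(4) \<open>m \<le> n\<close> unfolding inclusion_pi_trivial_def by blast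
        have "continuous_map (subtopology X (U - Z)) (top_of_set (G \<inter> ball y \<epsilon>)) j"
          using contj by (auto simp: continuous_map_in_subtopology continuous_map_from_subtopology U_def G_def)
        from homotopic_with_compose_continuous_map_left[OF c this, of "\<lambda>_. True"]
        have h: "homotopic_with (\<lambda>_. True) (nsphere m) (top_of_set (G \<inter> ball y \<epsilon>)) (j \<circ> (k \<circ> f)) (\<lambda>_. j c)"
          by (simp add: o_def)
        have "homotopic_with (\<lambda>_. True) (nsphere m) (top_of_set (G \<inter> ball y \<epsilon>)) (j \<circ> (k \<circ> f)) f"
          by (rule homotopic_with_equal)
            (use homotopic_with_imp_continuous_maps[OF h] jk fim GS in auto)
        then show "\<exists>c. homotopic_with (\<lambda>_. True) (nsphere m) (top_of_set (G \<inter> ball y \<epsilon>)) f (\<lambda>_. c)"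
          using h homotopic_with_trans homotopic_with_symD by blast
      qed
    qed
    show thesis
    proof (rule neighbourhood_retraction[OF compS \<open>S \<noteq> {}\<close> GS ULC SG cov])
      fix N r assume N: "open N" "S \<subseteq> N" and r: "continuous_on N r" "r ` N \<subseteq> S"
        "\<And>y. y \<in> S \<Longrightarrow> r y = y" "r ` (N - S) \<subseteq> G"
      show thesis
      proof (rule that[of j N "k \<circ> r"])
        show "j ` ?M \<subseteq> N" using N(2) by (simp add: S_def)
        have "continuous_map (top_of_set N) (top_of_set S) r"
          using r(1,2) by auto
        then show "continuous_map (top_of_set N) X (k \<circ> r)"
          using contk continuous_map_compose by blast
        show "(k \<circ> r) (j x) = x" if "x \<in> ?M" for x
          using r(3)[of "j x"] kj[OF that] that by (simp add: S_def)
        show "(k \<circ> r) y \<in> ?M - Z" if "y \<in> N - j ` ?M" for y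
        proof -
          have "r y \<in> G" using r(4) that by (auto simp: S_def)
          then obtain x where "r y = j x" "x \<in> ?M - Z" by (auto simp: G_def)
          then show ?thesis using kj by simp
        qed
      qed (use contj j0 N(1) in auto)
    qed
  qed
qed

section \<open>Extension of maps, Z-sets and contractibility\<close>

text \<open>The target of \<open>j\<close> is a product of lines, so Tietze's theorem applies
  coordinate by coordinate and extends \<open>j \<circ> f\<close> to all of \<open>Y\<close>. Where
  the extension takes values in \<open>N\<close>, \<open>r\<close> brings it back to
  \<open>X\<close>.\<close>

lemma neighbourhood_extension:
  fixes X :: "'a topology" and j :: "'a \<Rightarrow> nat \<Rightarrow> real" and Y :: "'b topology"
  assumes j: "continuous_map X euclidean j" and N: "open N" "j ` topspace X \<subseteq> N"
    and r: "continuous_map (top_of_set N) X r" "\<And>x. x \<in> topspace X \<Longrightarrow> r (j x) = x"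
    and Y: "metrizable_space Y" "closedin Y A" and f: "continuous_map (subtopology Y A) X f"
  obtains O' F where "openin Y O'" "A \<subseteq> O'" "continuous_map (subtopology Y O') X F" "\<And>y. y \<in> A \<Longrightarrow> F y = f y"
proof -
  have AY: "A \<subseteq> topspace Y" using Y(2) closedin_subset by blast
  have "\<exists>g. continuous_map Y euclideanreal g \<and> (\<forall>y\<in>A. g y = j (f y) i)" for i
  proof -
    have "continuous_map X euclideanreal (\<lambda>x. j x i)"
      using j by (simp add: continuous_map_componentwise_UNIV flip: euclidean_product_topology)
    then have "continuous_map (subtopology Y A) euclideanreal (\<lambda>y. j (f y) i)"
      using continuous_map_compose[OF f] by (simp add: o_def)
    from Tietze_extension_realinterval[OF metrizable_imp_normal_space[OF Y(1)] Y(2) is_interval_univ _ this]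
    show ?thesis by (metis UNIV_not_empty subset_UNIV)
  qed
  then obtain g where g: "\<And>i. continuous_map Y euclideanreal (g i)" "\<And>i y. y \<in> A \<Longrightarrow> g i y = j (f y) i"
    by metis
  define \<phi> where "\<phi> y = (\<lambda>i. g i y)" for y
  have \<phi>: "continuous_map Y euclidean \<phi>"
    unfolding \<phi>_def using g(1) by (simp add: continuous_map_componentwise_UNIV flip: euclidean_product_topology)
  have \<phi>A: "\<phi> y = j (f y)" if "y \<in> A" for y
    using g(2)[OF that] by (simp add: \<phi>_def)
  have fA: "f y \<in> topspace X" if "y \<in> A" for y
    using continuous_map_image_subset_topspace[OF f] AY that by auto
  let ?O = "{y \<in> topspace Y. \<phi> y \<in> N}"
  show thesis
  proof (rule that[of ?O "r \<circ> \<phi>"])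
    show "openin Y ?O"
      by (rule openin_continuous_map_preimage[OF \<phi>]) (use N(1) in simp)
    show "A \<subseteq> ?O" using AY \<phi>A fA N(2) by auto
    have "continuous_map (subtopology Y ?O) (top_of_set N) \<phi>"
      using \<phi> by (auto simp: continuous_map_in_subtopology continuous_map_from_subtopology)
    then show "continuous_map (subtopology Y ?O) X (r \<circ> \<phi>)"
      using r(1) continuous_map_compose by blast
    show "(r \<circ> \<phi>) y = f y" if "y \<in> A" for y
      using \<phi>A[OF that] r(2)[OF fA[OF that]] by simp
  qed
qed

text \<open>A contraction turns an extension over a neighbourhood into a global one: as
  \<open>l\<close> grows from its value 0 on \<open>A\<close>, the point \<open>F y\<close> slides
  to the constant \<open>a\<close>.\<close>

lemma contractible_extension:
  fixes Y :: "'b topology"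
  assumes contr: "contractible_space X" "topspace X \<noteq> {}"
    and Y: "metrizable_space Y" "closedin Y A" and O': "openin Y O'" "A \<subseteq> O'"
    and F: "continuous_map (subtopology Y O') X F"
  obtains F' where "continuous_map Y X F'" "\<And>y. y \<in> A \<Longrightarrow> F' y = F y"
proof -
  obtain a where "homotopic_with (\<lambda>_. True) X X id (\<lambda>_. a)"
    using contr(1) unfolding contractible_space_def by blast
  then obtain K where K: "continuous_map (prod_topology (top_of_set {0..1::real}) X) X K"
    and K0: "\<And>x. K (0, x) = x" and K1: "\<And>x. K (1, x) = a"
    unfolding homotopic_with_def by auto
  have aX: "a \<in> topspace X"
  proof -
    obtain x where "x \<in> topspace X" using contr(2) by blast
    then have "K (1, x) \<in> topspace X"
      using continuous_map_image_subset_topspace[OF K] by auto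
    then show ?thesis by (simp add: K1)
  qed
  have "disjnt A (topspace Y - O')" using O'(2) by (auto simp: disjnt_def)
  moreover have "closedin Y (topspace Y - O')" using O'(1) by (simp add: closedin_diff)
  ultimately obtain l where l: "continuous_map Y (top_of_set {0..1::real}) l" "l ` A \<subseteq> {0}" "l ` (topspace Y - O') \<subseteq> {1}"
    using Urysohn_lemma[OF metrizable_imp_normal_space[OF Y(1)] Y(2), of "topspace Y - O'" 0 1] by auto
  have lr: "continuous_map Y euclideanreal l" and l01: "\<And>y. y \<in> topspace Y \<Longrightarrow> l y \<in> {0..1}"
    using l(1) by (auto simp: continuous_map_in_subtopology)
  \<comment> \<open>The contraction is complete at \<open>l = 1/2\<close> rather than at 1. The
    closed set \<open>?C\<close> then lies inside \<open>O'\<close>, and beyond it, where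
    \<open>F\<close> may be meaningless, the constant takes over.\<close>
  let ?C = "{y. y \<in> topspace Y \<and> l y \<le> 1 / 2}"
  have CO: "?C \<subseteq> O'" using l(3) by force
  have c1: "continuous_map (subtopology Y ?C) X (\<lambda>y. K (2 * l y, F y))"
  proof -
    have "continuous_map (subtopology Y ?C) euclideanreal (\<lambda>y. 2 * l y)"
      by (intro continuous_intros continuous_map_from_subtopology lr)
    then have "continuous_map (subtopology Y ?C) (top_of_set {0..1}) (\<lambda>y. 2 * l y)"
      using l01 by (auto simp: continuous_map_in_subtopology)
    moreover have "continuous_map (subtopology Y ?C) X F"
      using continuous_map_from_subtopology_mono[OF F CO] .
    ultimately have "continuous_map (subtopology Y ?C) (prod_topology (top_of_set {0..1}) X) (\<lambda>y. (2 * l y, F y))"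
      by (simp add: continuous_map_paired)
    from continuous_map_compose[OF this K] show ?thesis by (simp add: o_def)
  qed
  show thesis
  proof (rule that[of "\<lambda>y. if l y \<le> 1 / 2 then K (2 * l y, F y) else a"])
    show "continuous_map Y X (\<lambda>y. if l y \<le> 1 / 2 then K (2 * l y, F y) else a)"
    proof (rule continuous_map_cases_le[OF lr _ c1])
      show "K (2 * l y, F y) = a" if "l y = 1 / 2" for y
        using arg_cong[OF that, of "(*) 2"] K1 by simp
    qed (use aX in simp_all)
    show "(if l y \<le> 1 / 2 then K (2 * l y, F y) else a) = F y" if "y \<in> A" for y
      using l(2) that K0 by (auto simp: image_subset_iff)
  qed
qed

text \<open>\<open>q\<close> writes a small multiple of the time into the vacant coordinate 0. At
  positive times the point has left the image of \<open>X\<close> but not \<open>N\<close>, so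
  \<open>r\<close> sends it into \<open>X - Z\<close>; at time 0 it has not moved.\<close>

lemma Z_set_of_retraction:
  fixes X :: "'a topology" and j :: "'a \<Rightarrow> nat \<Rightarrow> real"
  assumes cX: "compact_space X" and Z: "closedin X Z" "nowhere_dense_in X Z"
    and j: "continuous_map X euclidean j" "\<And>x. j x 0 = 0" and N: "open N" "j ` topspace X \<subseteq> N"
    and r: "continuous_map (top_of_set N) X r" "\<And>x. x \<in> topspace X \<Longrightarrow> r (j x) = x"
      "\<And>y. y \<in> N - j ` topspace X \<Longrightarrow> r y \<in> topspace X - Z"
  shows "Z_set X Z"
proof -
  let ?S = "j ` topspace X"
  define q where "q p = (\<lambda>i. if i = 0 then snd p else fst p i)" for p :: "(nat \<Rightarrow> real) \<times> real"
  have contq: "continuous_on T q" for T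
  proof (rule continuous_on_coordinatewise_then_product)
    fix i
    have "continuous_on T (\<lambda>p. fst p i)"
      by (rule continuous_on_compose2[OF continuous_on_coordinate[of UNIV i] continuous_on_fst[OF continuous_on_id]])
        auto
    then show "continuous_on T (\<lambda>p. q p i)"
      by (cases "i = 0") (simp_all add: q_def continuous_on_snd)
  qed
  have q0: "q (j x, 0) = j x" for x
    using j(2) by (auto simp: q_def)
  have compS: "compact ?S"
    using image_compactin[OF _ j(1), of "topspace X"] cX by (simp add: compact_space_def)
  then obtain \<rho> where "\<rho> > 0" and \<rho>: "\<And>y. y \<in> ?S \<Longrightarrow> ball y \<rho> \<subseteq> N"
    using Heine_Borel_lemma[of ?S "{N}"] N by auto
  have "compact (?S \<times> {0..1::real})"
    using compS by (intro compact_Times) auto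
  then have "uniformly_continuous_on (?S \<times> {0..1::real}) q"
    using compact_uniformly_continuous contq by blast
  then obtain d where "d > 0" and d: "\<And>p p'. p \<in> ?S \<times> {0..1} \<Longrightarrow> p' \<in> ?S \<times> {0..1} \<Longrightarrow> dist p' p < d \<Longrightarrow> dist (q p') (q p) < \<rho>"
    unfolding uniformly_continuous_on_def using \<open>\<rho> > 0\<close> by metis
  \<comment> \<open>\<open>d / 2\<close> makes the shift strictly smaller than \<open>d\<close>; the
    bound 1 keeps it in the compact set on which \<open>q\<close> is uniformly continuous.\<close>
  define \<delta> where "\<delta> = min (d / 2) 1"
  have \<delta>: "0 < \<delta>" "\<delta> \<le> 1" "\<delta> < d" using \<open>d > 0\<close> by (auto simp: \<delta>_def)
  define p where "p z = q (j (fst z), \<delta> * snd z)" for z :: "'a \<times> real"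
  have pN: "p (x, t) \<in> N" if "x \<in> topspace X" "t \<in> {0..1}" for x t
  proof -
    have "\<delta> * t \<le> \<delta> * 1" using \<delta> that(2) by (intro mult_left_mono) auto
    then have "\<delta> * t \<le> \<delta>" by simp
    then have t: "0 \<le> \<delta> * t" "\<delta> * t \<le> 1" "\<delta> * t < d" using \<delta> that(2) by (simp, linarith+)
    have "dist (q (j x, \<delta> * t)) (q (j x, 0)) < \<rho>"
      using that t by (intro d) (auto simp: dist_Pair_Pair)
    then have "p (x, t) \<in> ball (j x) \<rho>"
      by (simp add: p_def q0 dist_commute)
    then show ?thesis using \<rho> that(1) by blast
  qed
  let ?P = "prod_topology X (top_of_set {0..1::real})"
  have contp: "continuous_map ?P (top_of_set N) p"
  proof -
    have "continuous_map ?P euclidean (\<lambda>z. j (fst z))"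
      using continuous_map_compose[OF continuous_map_fst j(1)] by (simp add: o_def)
    moreover have "continuous_map ?P euclideanreal (\<lambda>z. \<delta> * snd z)"
      using continuous_map_snd[of X "top_of_set {0..1::real}"]
      by (intro continuous_intros) (simp add: continuous_map_in_subtopology)
    ultimately have "continuous_map ?P euclidean (\<lambda>z. (j (fst z), \<delta> * snd z))"
      by (simp add: continuous_map_paired flip: prod_topology_euclidean)
    moreover have "continuous_map euclidean euclidean q"
      using contq by simp
    ultimately have "continuous_map ?P euclidean p"
      using continuous_map_compose unfolding p_def o_def by fast
    then show ?thesis
      using pN by (auto simp: continuous_map_in_subtopology)
  qed
  show ?thesis
    unfolding Z_set_def
  proof (intro conjI exI[of _ "r \<circ> p"] ballI)
    show "continuous_map ?P X (r \<circ> p)"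
      using contp r(1) continuous_map_compose by blast
    show "(r \<circ> p) (x, 0) = x" if "x \<in> topspace X" for x
      using r(2)[OF that] by (simp add: p_def q0)
    show "(r \<circ> p) ` (topspace X \<times> {0<..1}) \<subseteq> topspace X - Z"
    proof
      fix w assume "w \<in> (r \<circ> p) ` (topspace X \<times> {0<..1})"
      then obtain x t where w: "w = r (p (x, t))" and xt: "x \<in> topspace X" "t \<in> {0<..1}"
        by auto
      have "p (x, t) 0 \<noteq> 0"
        using xt(2) \<delta> by (simp add: p_def q_def)
      then have "p (x, t) \<notin> ?S" using j(2) by auto
      then show "w \<in> topspace X - Z"
        using r(3)[of "p (x, t)"] pN[of x t] xt unfolding w by auto
    qed
  qed (fact Z)+
qed

text \<open>The final map of the Z-set homotopy goes from \<open>X\<close> into \<open>X - Z\<close>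
  and is homotopic to the identity of \<open>X\<close>. Following it by a contraction of
  \<open>X - Z\<close> contracts \<open>X\<close>.\<close>

lemma Z_set_contractible:
  assumes "Z_set X Z" "contractible_space (subtopology X (topspace X - Z))"
  shows "contractible_space X"
proof -
  let ?Y = "subtopology X (topspace X - Z)"
  obtain H where H: "continuous_map (prod_topology X (top_of_set {0..1::real})) X H"
    "\<forall>x\<in>topspace X. H (x, 0) = x" "H ` (topspace X \<times> {0<..1}) \<subseteq> topspace X - Z"
    using assms(1) unfolding Z_set_def by blast
  define h where "h x = H (x, 1)" for x
  have id_H0: "homotopic_with (\<lambda>_. True) X X id (\<lambda>x. H (x, 0))"
    by (rule homotopic_with_equal) (use H(2) in auto)
  have swap: "continuous_map (prod_topology (top_of_set {0..1::real}) X) X (\<lambda>z. H (snd z, fst z))"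
    using continuous_map_compose[OF continuous_map_pairedI[OF continuous_map_snd continuous_map_fst] H(1)]
    by (simp add: o_def)
  then have H0_h: "homotopic_with (\<lambda>_. True) X X (\<lambda>x. H (x, 0)) h"
    unfolding homotopic_with_def h_def by (intro exI[of _ "\<lambda>z. H (snd z, fst z)"]) simp
  have "continuous_map X X h"
    using homotopic_with_imp_continuous_maps[OF H0_h] by blast
  then have h: "continuous_map X ?Y h"
    using H(3) by (auto simp: continuous_map_in_subtopology h_def image_subset_iff)
  obtain a where "homotopic_with (\<lambda>_. True) ?Y ?Y id (\<lambda>_. a)"
    using assms(2) unfolding contractible_space_def by blast
  from homotopic_with_compose_continuous_map_right[OF this h, of "\<lambda>_. True"]
  have "homotopic_with (\<lambda>_. True) X ?Y h (\<lambda>_. a)"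
    by (simp add: o_def)
  moreover have "continuous_map ?Y X id"
    by (simp add: continuous_map_from_subtopology)
  ultimately have "homotopic_with (\<lambda>_. True) X X (id \<circ> h) (id \<circ> (\<lambda>_. a))"
    by (rule homotopic_with_compose_continuous_map_left) simp
  then have "homotopic_with (\<lambda>_. True) X X h (\<lambda>_. a)"
    by (simp add: o_def)
  then show ?thesis
    unfolding contractible_space_def using id_H0 H0_h homotopic_with_trans by blast
qed

theorem theoremB1:
  fixes X :: "'a topology" and Z :: "'a set" and n :: nat
  assumes "compact_space X" and "metrizable_space X"
    and "covering_dim_le X n"
    and "closedin X Z" and "nowhere_dense_in X Z"
    and "LCC n X Z"
    and "LC n (subtopology X (topspace X - Z))"
  shows "compact_ANR TYPE('b) X \<and> Z_set X Z \<and>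
    (nonempty_contractible (subtopology X (topspace X - Z)) \<longrightarrow> compact_AR TYPE('b) X)"
proof (rule neighbourhood_retraction_off_Z[OF assms])
  fix j :: "'a \<Rightarrow> nat \<Rightarrow> real" and N r
  assume j: "continuous_map X euclidean j" "\<And>x. j x 0 = 0" and N: "open N" "j ` topspace X \<subseteq> N"
    and r: "continuous_map (top_of_set N) X r" "\<And>x. x \<in> topspace X \<Longrightarrow> r (j x) = x"
      "\<And>y. y \<in> N - j ` topspace X \<Longrightarrow> r y \<in> topspace X - Z"
  \<comment> \<open>The map to extend is the inverse \<open>e'\<close> of the embedding, defined on
    the closed image; an extension of it followed by \<open>e\<close> will be a retraction.\<close>
  have ext: "\<exists>e' O' F. homeomorphic_maps X (subtopology Y (e ` topspace X)) e e' \<and> openin Y O' \<and>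
      e ` topspace X \<subseteq> O' \<and> continuous_map (subtopology Y O') X F \<and> (\<forall>y\<in>e ` topspace X. F y = e' y)"
    if Y: "metrizable_space Y" "embedding_map X Y e" "closedin Y (e ` topspace X)" for Y :: "'b topology" and e
  proof -
    obtain e' where e': "homeomorphic_maps X (subtopology Y (e ` topspace X)) e e'"
      using Y(2) homeomorphic_map_maps unfolding embedding_map_def by blast
    then have "continuous_map (subtopology Y (e ` topspace X)) X e'"
      by (simp add: homeomorphic_maps_def)
    from neighbourhood_extension[OF j(1) N r(1,2) Y(1,3) this]
    obtain O' F where "openin Y O'" "e ` topspace X \<subseteq> O'" "continuous_map (subtopology Y O') X F"
      "\<And>y. y \<in> e ` topspace X \<Longrightarrow> F y = e' y"
      by blast
    with e' show ?thesis by blast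
  qed
  \<comment> \<open>One argument for both properties: \<open>T\<close> will be the neighbourhood
    \<open>O'\<close> for the ANR and the whole of \<open>Y\<close> for the AR.\<close>
  have retr: "e ` topspace X retract_of_space Y'"
    if e: "homeomorphic_maps X (subtopology Y (e ` topspace X)) e e'"
      and F: "continuous_map Y' X F" "\<forall>y\<in>e ` topspace X. F y = e' y"
      and Y': "Y' = subtopology Y T" "e ` topspace X \<subseteq> topspace Y'" for Y Y' :: "'b topology" and e e' F T
  proof -
    have eT: "e ` topspace X \<subseteq> T" using Y' by auto
    have "continuous_map X (subtopology Y (e ` topspace X)) e" "\<forall>x\<in>topspace X. e' (e x) = x"
      using e by (simp_all add: homeomorphic_maps_def)
    then have "continuous_map X (subtopology Y' (e ` topspace X)) e"
      using eT by (simp add: Y'(1) subtopology_subtopology Int_absorb1)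
    then have "continuous_map Y' (subtopology Y' (e ` topspace X)) (e \<circ> F)"
      using F(1) continuous_map_compose by blast
    moreover have "\<forall>y\<in>e ` topspace X. (e \<circ> F) y = y"
      using F(2) \<open>\<forall>x\<in>topspace X. e' (e x) = x\<close> by auto
    ultimately show ?thesis
      using Y'(2) unfolding retract_of_space_def by blast
  qed
  have ANR: "compact_ANR TYPE('b) X"
    unfolding compact_ANR_def
  proof (intro conjI allI impI assms(1,2), elim conjE)
    fix Y :: "'b topology" and e
    assume Y: "metrizable_space Y" "embedding_map X Y e" "closedin Y (e ` topspace X)"
    obtain e' O' F where O': "homeomorphic_maps X (subtopology Y (e ` topspace X)) e e'" "openin Y O'"
      "e ` topspace X \<subseteq> O'" "continuous_map (subtopology Y O') X F" "\<forall>y\<in>e ` topspace X. F y = e' y"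
      using ext[OF Y] by blast
    have "e ` topspace X \<subseteq> topspace (subtopology Y O')"
      using O'(3) closedin_subset[OF Y(3)] by auto
    from retr[OF O'(1,4,5) refl this] O'(2,3)
    show "\<exists>N. openin Y N \<and> e ` topspace X \<subseteq> N \<and> e ` topspace X retract_of_space subtopology Y N"
      by blast
  qed
  have Zs: "Z_set X Z"
    by (rule Z_set_of_retraction[OF assms(1,4,5) j N r])
  have AR: "compact_AR TYPE('b) X" if "nonempty_contractible (subtopology X (topspace X - Z))"
    unfolding compact_AR_def
  proof (intro conjI allI impI assms(1,2), elim conjE)
    fix Y :: "'b topology" and e
    assume Y: "metrizable_space Y" "embedding_map X Y e" "closedin Y (e ` topspace X)"
    \<comment> \<open>Nonemptiness guarantees that the constant to which the extension is contracted
      is a point of \<open>X\<close>; the empty set is no retract of a nonempty space.\<close>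
    have "contractible_space X" "topspace X \<noteq> {}"
      using that Z_set_contractible[OF Zs] by (auto simp: nonempty_contractible_def)
    note c = this
    obtain e' O' F where O': "homeomorphic_maps X (subtopology Y (e ` topspace X)) e e'" "openin Y O'"
      "e ` topspace X \<subseteq> O'" "continuous_map (subtopology Y O') X F" "\<forall>y\<in>e ` topspace X. F y = e' y"
      using ext[OF Y] by blast
    obtain F' where F': "continuous_map Y X F'" "\<And>y. y \<in> e ` topspace X \<Longrightarrow> F' y = F y"
      by (rule contractible_extension[OF c Y(1,3) O'(2,3,4)]) blast
    have "\<forall>y\<in>e ` topspace X. F' y = e' y" using F'(2) O'(5) by simp
    from retr[OF O'(1) F'(1) this, of "topspace Y"] show "e ` topspace X retract_of_space Y"
      using closedin_subset[OF Y(3)] by simp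
  qed
  show ?thesis using ANR Zs AR by blast
qed

end
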